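(* Let $G$ be a finitely generated, infinite, nilpotent (discrete) group with Hirsch length $\ell_{\mathrm{Hir}}(G)$ and let $X$ be a compact metric space of finite covering dimension. Let $\alpha:G\curvearrowright X$ be a free action (by homeomorphisms). Then the induced C*-algebraic action $\bar\alpha:G\curvearrowright C(X)$ satisfies $$\dim_{\mathrm{am}}(\bar\alpha)+1\;\le\;3^{\ell_{\mathrm{Hir}}(G)}\cdot(\dim(X)+1).$$
   Context: The induced action is $\bar\alpha_g(f)=f\circ\alpha_{g^{-1}}$. $\dim(X)$ is the covering dimension. **Amenability dimension.** For an action $\alpha$ of a countable discrete group $G$ on a C*-algebra $A$, $\dim_{\mathrm{am}}(\alpha)$ is the smallest $d\in\mathbb N$ (including $0$; $\infty$ if none) such that for all $\varepsilon>0$ and finite sets $M\subset G$, $F\subset A$ there are finitely supported maps $\mu^{(l)}:G\to A_{1,+}$, $g\mapsto\mu^{(l)}_g$ (values in the positive contractions of $A$), $l=0,\dots,d$, with: (a) $\|(\sum_{l=0}^d\sum_{g\in G}\mu^{(l)}_g)a-a\|\le\varepsilon$ for all $a\in F$; (b) $\mu^{(l)}_g\mu^{(l)}_h=0$ for all $l$ and $g\ne h$; (c) $\|\sum_{h\in E}(\alpha_g(\mu^{(l)}_h)-\mu^{(l)}_{gh})a\|\le\varepsilon$ for all $a\in F$, all $l$, $g\in M$ and finite $E\subset G$; (d) $\|[\sum_{g\in E}\mu^{(l)}_g,a]\|\le\varepsilon$ for all $a\in F$, all $l$ and finite $E\subset G$. *)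

theory Defs
  imports "HOL-Analysis.Analysis" "HOL-Algebra.Algebra" "HOL-Library.Extended_Nat"
begin

section \<open>Finitely generated nilpotent groups and the Hirsch length\<close>

definition finitely_generated_group :: "('g, 'm) monoid_scheme \<Rightarrow> bool" where
  "finitely_generated_group G \<longleftrightarrow>
     group G \<and> (\<exists>S. finite S \<and> S \<subseteq> carrier G \<and> generate G S = carrier G)"

primrec lower_central_series :: "('g, 'm) monoid_scheme \<Rightarrow> nat \<Rightarrow> 'g set" where
  "lower_central_series G 0 = carrier G"
| "lower_central_series G (Suc n) =
     generate G (\<Union>h\<in>lower_central_series G n. \<Union>k\<in>carrier G.
       {h \<otimes>\<^bsub>G\<^esub> k \<otimes>\<^bsub>G\<^esub> inv\<^bsub>G\<^esub> h \<otimes>\<^bsub>G\<^esub> inv\<^bsub>G\<^esub> k})"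

definition nilpotent_group :: "('g, 'm) monoid_scheme \<Rightarrow> bool" where
  "nilpotent_group G \<longleftrightarrow> group G \<and> (\<exists>n. lower_central_series G n = {\<one>\<^bsub>G\<^esub>})"

text \<open>\<open>polycyclic_series G H n\<close>: the subgroup \<open>H\<close> has a subnormal series from the trivial group
  up to \<open>H\<close> whose factors are all cyclic and of which exactly \<open>n\<close> are infinite.\<close>

inductive polycyclic_series :: "('g, 'm) monoid_scheme \<Rightarrow> 'g set \<Rightarrow> nat \<Rightarrow> bool" for G where
  trivial: "polycyclic_series G {\<one>\<^bsub>G\<^esub>} 0"
| finite_factor: "\<lbrakk>polycyclic_series G K n; subgroup H G; K \<lhd> (G\<lparr>carrier := H\<rparr>);
     cyclic_group ((G\<lparr>carrier := H\<rparr>) Mod K); finite (carrier ((G\<lparr>carrier := H\<rparr>) Mod K))\<rbrakk>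
     \<Longrightarrow> polycyclic_series G H n"
| infinite_factor: "\<lbrakk>polycyclic_series G K n; subgroup H G; K \<lhd> (G\<lparr>carrier := H\<rparr>);
     cyclic_group ((G\<lparr>carrier := H\<rparr>) Mod K); infinite (carrier ((G\<lparr>carrier := H\<rparr>) Mod K))\<rbrakk>
     \<Longrightarrow> polycyclic_series G H (Suc n)"

text \<open>For polycyclic \<open>G\<close> (in particular for finitely generated nilpotent \<open>G\<close>) all polycyclic
  series have the same number of infinite factors, so \<open>LEAST\<close> only picks this common value. For
  other groups the value is meaningless.\<close>

definition Hirsch_length :: "('g, 'm) monoid_scheme \<Rightarrow> nat" where
  "Hirsch_length G = (LEAST n. polycyclic_series G (carrier G) n)"


section \<open>Covering dimension\<close>

definition covering_dim_le :: "'a topology \<Rightarrow> nat \<Rightarrow> bool" where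
  "covering_dim_le T n \<longleftrightarrow>
     (\<forall>\<U>. finite \<U> \<and> (\<forall>U\<in>\<U>. openin T U) \<and> \<Union>\<U> = topspace T \<longrightarrow>
       (\<exists>\<V>. finite \<V> \<and> (\<forall>V\<in>\<V>. openin T V) \<and> \<Union>\<V> = topspace T \<and>
            (\<forall>V\<in>\<V>. \<exists>U\<in>\<U>. V \<subseteq> U) \<and>
            (\<forall>x\<in>topspace T. card {V\<in>\<V>. x \<in> V} \<le> n + 1)))"

text \<open>Intended for nonempty spaces: the convention \<open>dim {} = -1\<close> is not represented. The value is
  \<open>\<infinity>\<close> if \<open>covering_dim_le T n\<close> holds for no \<open>n\<close>.\<close>

definition covering_dim :: "'a topology \<Rightarrow> enat" where
  "covering_dim T = Inf {enat n |n. covering_dim_le T n}"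


section \<open>C*-algebras\<close>

text \<open>The algebra need not be unital. The real normed algebra structure is the restriction of
  the complex one along \<open>complex_of_real\<close>.\<close>

class cstar_algebra = real_normed_algebra + banach +
  fixes scaleC :: "complex \<Rightarrow> 'a \<Rightarrow> 'a" (infixr \<open>*\<^sub>C\<close> 75)
    and adj :: "'a \<Rightarrow> 'a"
  assumes scaleC_add_right: "c *\<^sub>C (a + b) = c *\<^sub>C a + c *\<^sub>C b"
    and scaleC_add_left: "(c + d) *\<^sub>C a = c *\<^sub>C a + d *\<^sub>C a"
    and scaleC_scaleC: "c *\<^sub>C d *\<^sub>C a = (c * d) *\<^sub>C a"
    and scaleC_of_real: "complex_of_real r *\<^sub>C a = r *\<^sub>R a"
    and scaleC_mult_left: "(c *\<^sub>C a) * b = c *\<^sub>C (a * b)"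
    and scaleC_mult_right: "a * (c *\<^sub>C b) = c *\<^sub>C (a * b)"
    and norm_scaleC: "norm (c *\<^sub>C a) = cmod c * norm a"
    and adj_adj: "adj (adj a) = a"
    and adj_add: "adj (a + b) = adj a + adj b"
    and adj_scaleC: "adj (c *\<^sub>C a) = cnj c *\<^sub>C adj a"
    and adj_mult: "adj (a * b) = adj b * adj a"
    and norm_adj_mult: "norm (adj a * a) = (norm a)\<^sup>2"

definition positive :: "'a::cstar_algebra \<Rightarrow> bool" where
  "positive a \<longleftrightarrow> (\<exists>b. a = adj b * b)"

definition positive_contractions :: "'a::cstar_algebra set" where
  "positive_contractions = {a. positive a \<and> norm a \<le> 1}"

instantiation complex :: cstar_algebra
begin

definition scaleC_complex :: "complex \<Rightarrow> complex \<Rightarrow> complex" where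
  "scaleC_complex c z = c * z"

definition adj_complex :: "complex \<Rightarrow> complex" where
  "adj_complex z = cnj z"

instance
  by standard
    (auto simp: scaleC_complex_def adj_complex_def algebra_simps norm_mult power2_eq_square
      scaleR_conv_of_real)

end

text \<open>Bounded continuous functions into a C*-algebra, with pointwise operations and the supremum
  norm. If \<open>X\<close> is compact, then \<open>X \<Rightarrow>\<^sub>C complex\<close> is C(X).\<close>

instantiation bcontfun :: (topological_space, real_normed_algebra) real_normed_algebra
begin

definition times_bcontfun :: "('a \<Rightarrow>\<^sub>C 'b) \<Rightarrow> ('a \<Rightarrow>\<^sub>C 'b) \<Rightarrow> 'a \<Rightarrow>\<^sub>C 'b" where
  "times_bcontfun f g = Bcontfun (\<lambda>x. f x * g x)"

lemma times_bcontfun_apply [simp]: "apply_bcontfun (f * g) x = f x * g x"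
  for f g :: "'a \<Rightarrow>\<^sub>C 'b"
proof -
  have "norm (f x * g x) \<le> norm f * norm g" for x
    by (rule order_trans[OF norm_mult_ineq]) (intro mult_mono norm_bounded norm_ge_zero)
  then have "(\<lambda>x. f x * g x) \<in> bcontfun"
    by (intro bcontfun_normI continuous_intros) auto
  then show ?thesis
    by (simp add: times_bcontfun_def Bcontfun_inverse)
qed

instance
proof
  fix f g :: "'a \<Rightarrow>\<^sub>C 'b"
  show "norm (f * g) \<le> norm f * norm g"
  proof (rule norm_bound)
    fix x
    show "norm (apply_bcontfun (f * g) x) \<le> norm f * norm g"
      unfolding times_bcontfun_apply
      by (rule order_trans[OF norm_mult_ineq]) (intro mult_mono norm_bounded norm_ge_zero)
  qed
qed (auto intro!: bcontfun_eqI simp: algebra_simps)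

end

instance bcontfun :: (metric_space, banach) banach ..

lemma (in cstar_algebra) norm_adj: "norm (adj a) = norm a"
proof -
  have le: "norm b \<le> norm (adj b)" for b
  proof (cases "norm b = 0")
    case False
    have "norm b * norm b \<le> norm (adj b) * norm b"
      using norm_adj_mult[of b] norm_mult_ineq[of "adj b" b] by (simp add: power2_eq_square)
    then show ?thesis
      using False norm_ge_zero[of b] by (simp add: mult_le_cancel_right)
  qed (metis norm_ge_zero)
  show ?thesis
    using le[of a] le[of "adj a"] by (simp add: adj_adj)
qed

lemma continuous_on_scaleC:
  fixes f :: "'a::topological_space \<Rightarrow> 'b::cstar_algebra"
  assumes "continuous_on S f"
  shows "continuous_on S (\<lambda>x. c *\<^sub>C f x)"
proof -
  have "bounded_linear (\<lambda>a::'b. c *\<^sub>C a)"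
    by (rule bounded_linear_intro[where K = "cmod c"])
      (simp_all add: scaleC_add_right norm_scaleC scaleC_scaleC mult.commute
        flip: scaleC_of_real)
  then show ?thesis
    using assms by (rule bounded_linear.continuous_on)
qed

lemma continuous_on_adj:
  fixes f :: "'a::topological_space \<Rightarrow> 'b::cstar_algebra"
  assumes "continuous_on S f"
  shows "continuous_on S (\<lambda>x. adj (f x))"
proof -
  have "bounded_linear (adj :: 'b \<Rightarrow> 'b)"
  proof (rule bounded_linear_intro[where K = 1])
    fix r :: real and a :: 'b
    show "adj (r *\<^sub>R a) = r *\<^sub>R adj a"
      using adj_scaleC[of "complex_of_real r" a] by (simp add: scaleC_of_real)
  qed (simp_all add: adj_add norm_adj)
  then show ?thesis
    using assms by (rule bounded_linear.continuous_on)
qed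

instantiation bcontfun :: (metric_space, cstar_algebra) cstar_algebra
begin

definition scaleC_bcontfun :: "complex \<Rightarrow> ('a \<Rightarrow>\<^sub>C 'b) \<Rightarrow> 'a \<Rightarrow>\<^sub>C 'b" where
  "scaleC_bcontfun c f = Bcontfun (\<lambda>x. c *\<^sub>C f x)"

definition adj_bcontfun :: "('a \<Rightarrow>\<^sub>C 'b) \<Rightarrow> 'a \<Rightarrow>\<^sub>C 'b" where
  "adj_bcontfun f = Bcontfun (\<lambda>x. adj (f x))"

lemma scaleC_bcontfun_apply [simp]: "apply_bcontfun (c *\<^sub>C f) x = c *\<^sub>C f x"
  for f :: "'a \<Rightarrow>\<^sub>C 'b"
proof -
  have "(\<lambda>x. c *\<^sub>C f x) \<in> bcontfun"
    by (rule bcontfun_normI[where b = "cmod c * norm f"])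
      (auto intro!: continuous_on_scaleC mult_left_mono norm_bounded simp: norm_scaleC)
  then show ?thesis
    by (simp add: scaleC_bcontfun_def Bcontfun_inverse)
qed

lemma adj_bcontfun_apply [simp]: "apply_bcontfun (adj f) x = adj (f x)"
  for f :: "'a \<Rightarrow>\<^sub>C 'b"
proof -
  have "(\<lambda>x. adj (f x)) \<in> bcontfun"
    by (rule bcontfun_normI[where b = "norm f"])
      (auto intro!: continuous_on_adj norm_bounded simp: norm_adj)
  then show ?thesis
    by (simp add: adj_bcontfun_def Bcontfun_inverse)
qed

instance
proof
  fix f :: "'a \<Rightarrow>\<^sub>C 'b" and c :: complex
  have le: "norm (d *\<^sub>C h) \<le> cmod d * norm h" for d and h :: "'a \<Rightarrow>\<^sub>C 'b"
    by (rule norm_bound) (auto intro!: mult_left_mono norm_bounded simp: norm_scaleC)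
  show "norm (c *\<^sub>C f) = cmod c * norm f"
  proof (cases "c = 0")
    case True
    then show ?thesis using le[of c f] by simp
  next
    case False
    have "inverse c *\<^sub>C c *\<^sub>C f = f"
      using False scaleC_of_real[of 1] by (intro bcontfun_eqI) (simp add: scaleC_scaleC)
    then have "norm f \<le> cmod (inverse c) * norm (c *\<^sub>C f)"
      using le[of "inverse c" "c *\<^sub>C f"] by simp
    then have "cmod c * norm f \<le> norm (c *\<^sub>C f)"
      using False by (simp add: norm_divide norm_inverse field_simps)
    then show ?thesis using le[of c f] by simp
  qed
  show "norm (adj f * f) = (norm f)\<^sup>2"
  proof (rule antisym)
    show "norm (adj f * f) \<le> (norm f)\<^sup>2"
      by (rule norm_bound) (auto simp: norm_adj_mult intro!: power_mono norm_bounded)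
    have "norm f \<le> sqrt (norm (adj f * f))"
    proof (rule norm_bound)
      fix x
      have "(norm (f x))\<^sup>2 \<le> norm (adj f * f)"
        using norm_bounded[of "adj f * f" x] by (simp add: norm_adj_mult)
      then show "norm (f x) \<le> sqrt (norm (adj f * f))"
        by (rule real_le_rsqrt)
    qed
    then have "(norm f)\<^sup>2 \<le> (sqrt (norm (adj f * f)))\<^sup>2"
      by (intro power_mono) auto
    then show "(norm f)\<^sup>2 \<le> norm (adj f * f)"
      by simp
  qed
qed (auto intro!: bcontfun_eqI simp: scaleC_add_right scaleC_add_left scaleC_scaleC
      scaleC_of_real scaleC_mult_left scaleC_mult_right adj_adj adj_add adj_scaleC adj_mult)

end


section \<open>Actions\<close>

locale topological_action = group_action G UNIV \<alpha>
  for G (structure) and \<alpha> :: "'g \<Rightarrow> 'x::topological_space \<Rightarrow> 'x" +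
  assumes homeomorphism: "g \<in> carrier G \<Longrightarrow> homeomorphic_map euclidean euclidean (\<alpha> g)"

locale cstar_action = group_action G UNIV \<beta>
  for G (structure) and \<beta> :: "'g \<Rightarrow> 'a::cstar_algebra \<Rightarrow> 'a" +
  assumes act_add: "g \<in> carrier G \<Longrightarrow> \<beta> g (a + b) = \<beta> g a + \<beta> g b"
    and act_scaleC: "g \<in> carrier G \<Longrightarrow> \<beta> g (c *\<^sub>C a) = c *\<^sub>C \<beta> g a"
    and act_mult: "g \<in> carrier G \<Longrightarrow> \<beta> g (a * b) = \<beta> g a * \<beta> g b"
    and act_adj: "g \<in> carrier G \<Longrightarrow> \<beta> g (adj a) = adj (\<beta> g a)"

definition free_action :: "('g, 'm) monoid_scheme \<Rightarrow> ('g \<Rightarrow> 'x \<Rightarrow> 'x) \<Rightarrow> bool" where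
  "free_action G \<alpha> \<longleftrightarrow> (\<forall>x. stabilizer G \<alpha> x = {\<one>\<^bsub>G\<^esub>})"

definition induced_action ::
  "('g, 'm) monoid_scheme \<Rightarrow> ('g \<Rightarrow> 'x \<Rightarrow> 'x) \<Rightarrow> 'g
    \<Rightarrow> ('x::metric_space \<Rightarrow>\<^sub>C complex) \<Rightarrow> ('x \<Rightarrow>\<^sub>C complex)" where
  "induced_action G \<alpha> g f = Bcontfun (apply_bcontfun f \<circ> \<alpha> (inv\<^bsub>G\<^esub> g))"

lemma induced_action_apply:
  fixes \<alpha> :: "'g \<Rightarrow> 'x::metric_space \<Rightarrow> 'x"
  assumes "topological_action G \<alpha>" and g: "g \<in> carrier G"
  shows "apply_bcontfun (induced_action G \<alpha> g f) x = f (\<alpha> (inv\<^bsub>G\<^esub> g) x)"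
proof -
  interpret topological_action G \<alpha> by fact
  interpret group_hom G "BijGroup (UNIV :: 'x set)" \<alpha> by (rule group_hom)
  have "continuous_on UNIV (\<alpha> (inv\<^bsub>G\<^esub> g))"
    using homeomorphism[of "inv\<^bsub>G\<^esub> g"] g homeomorphic_imp_continuous_map by fastforce
  then have "continuous_on UNIV (apply_bcontfun f \<circ> \<alpha> (inv\<^bsub>G\<^esub> g))"
    by (intro continuous_on_compose continuous_on_apply_bcontfun)
  then have "apply_bcontfun f \<circ> \<alpha> (inv\<^bsub>G\<^esub> g) \<in> bcontfun"
    by (rule bcontfun_normI[where b = "norm f"]) (simp add: norm_bounded)
  then show ?thesis
    by (simp add: induced_action_def Bcontfun_inverse)
qed

lemma cstar_action_induced_action:
  fixes \<alpha> :: "'g \<Rightarrow> 'x::metric_space \<Rightarrow> 'x"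
  assumes "topological_action G \<alpha>"
  shows "cstar_action G (induced_action G \<alpha>)"
proof -
  interpret topological_action G \<alpha> by fact
  interpret group_hom G "BijGroup (UNIV :: 'x set)" \<alpha> by (rule group_hom)
  note [simp] = induced_action_apply[OF assms]
  have one: "induced_action G \<alpha> \<one>\<^bsub>G\<^esub> f = f" for f
    by (intro bcontfun_eqI) (simp add: fun_cong[OF id_eq_one, symmetric] del: hom_one)
  have mult: "induced_action G \<alpha> (g \<otimes>\<^bsub>G\<^esub> h) f = induced_action G \<alpha> g (induced_action G \<alpha> h f)"
    if "g \<in> carrier G" "h \<in> carrier G" for g h f
    using that composition_rule[of _ "inv\<^bsub>G\<^esub> h" "inv\<^bsub>G\<^esub> g"]
    by (intro bcontfun_eqI) (simp add: G.inv_mult_group)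
  have bij: "bij (induced_action G \<alpha> g)" if "g \<in> carrier G" for g
    using that mult[of g "inv\<^bsub>G\<^esub> g"] mult[of "inv\<^bsub>G\<^esub> g" g] one
    by (intro o_bij[of "induced_action G \<alpha> (inv\<^bsub>G\<^esub> g)"]) (auto simp: fun_eq_iff)
  have "group_hom G (BijGroup UNIV) (induced_action G \<alpha>)"
  proof (intro group_hom.intro group_hom_axioms.intro homI)
    show "induced_action G \<alpha> g \<in> carrier (BijGroup UNIV)" if "g \<in> carrier G" for g
      using bij[OF that] by (simp add: BijGroup_def Bij_def)
    show "induced_action G \<alpha> (g \<otimes>\<^bsub>G\<^esub> h)
        = induced_action G \<alpha> g \<otimes>\<^bsub>BijGroup UNIV\<^esub> induced_action G \<alpha> h"
      if "g \<in> carrier G" "h \<in> carrier G" for g h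
      using that mult bij by (auto simp: BijGroup_def Bij_def compose_def fun_eq_iff)
  qed (rule G.is_group group_BijGroup)+
  then show ?thesis
    by (intro cstar_action.intro group_action.intro cstar_action_axioms.intro)
      (auto intro!: bcontfun_eqI)
qed


section \<open>Amenability dimension\<close>

text \<open>\<open>\<mu> l g\<close> is constrained for \<open>l \<le> d\<close> and \<open>g \<in> carrier G\<close> only. The sum over all of \<open>G\<close> is
  written as a sum over the finite support.\<close>

definition amenability_dim_le ::
  "('g, 'm) monoid_scheme \<Rightarrow> ('g \<Rightarrow> 'a::cstar_algebra \<Rightarrow> 'a) \<Rightarrow> nat \<Rightarrow> bool" where
  "amenability_dim_le G \<beta> d \<longleftrightarrow>
    (\<forall>\<epsilon>>0. \<forall>M F. finite M \<and> M \<subseteq> carrier G \<and> finite F \<longrightarrow>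
      (\<exists>\<mu> :: nat \<Rightarrow> 'g \<Rightarrow> 'a.
        (\<forall>l\<le>d. finite {g \<in> carrier G. \<mu> l g \<noteq> 0}) \<and>
        (\<forall>l\<le>d. \<forall>g\<in>carrier G. \<mu> l g \<in> positive_contractions) \<and>
        (\<forall>a\<in>F. norm ((\<Sum>l\<le>d. \<Sum>g | g \<in> carrier G \<and> \<mu> l g \<noteq> 0. \<mu> l g) * a - a) \<le> \<epsilon>) \<and>
        (\<forall>l\<le>d. \<forall>g\<in>carrier G. \<forall>h\<in>carrier G. g \<noteq> h \<longrightarrow> \<mu> l g * \<mu> l h = 0) \<and>
        (\<forall>a\<in>F. \<forall>l\<le>d. \<forall>g\<in>M. \<forall>E. finite E \<and> E \<subseteq> carrier G \<longrightarrow>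
          norm ((\<Sum>h\<in>E. \<beta> g (\<mu> l h) - \<mu> l (g \<otimes>\<^bsub>G\<^esub> h)) * a) \<le> \<epsilon>) \<and>
        (\<forall>a\<in>F. \<forall>l\<le>d. \<forall>E. finite E \<and> E \<subseteq> carrier G \<longrightarrow>
          norm ((\<Sum>g\<in>E. \<mu> l g) * a - a * (\<Sum>g\<in>E. \<mu> l g)) \<le> \<epsilon>)))"

definition amenability_dim ::
  "('g, 'm) monoid_scheme \<Rightarrow> ('g \<Rightarrow> 'a::cstar_algebra \<Rightarrow> 'a) \<Rightarrow> enat" where
  "amenability_dim G \<beta> = Inf {enat d |d. amenability_dim_le G \<beta> d}"

end

theory Submission
  imports Defs
begin

text \<open>Fix a finite symmetric set \<open>B\<close> in \<open>G\<close>. Since \<open>X\<close> has dimension at most \<open>d\<close>, any \<open>d + 1\<close> real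
  functions on \<open>X\<close> can be perturbed to have no common zero. Applied to functions defining \<open>d + 1\<close>
  covers of \<open>X\<close> by small open sets, this makes the boundaries of the covers, even after translation
  by a large finite subset of \<open>G\<close>, have no common point. Extracting greedily a set \<open>Z k\<close> disjoint
  from its translates by \<open>B - {1}\<close> from the \<open>k\<close>-th cover, one can only miss translates of boundaries,
  so that the \<open>B\<close>-translates of \<open>Z 0, \<dots>, Z d\<close> cover \<open>X\<close>.

  On the side of the group, \<open>B\<close> is chosen together with \<open>3 ^ \<ell>\<close> almost invariant functions on \<open>G\<close>
  whose supports \<open>F\<close> satisfy \<open>F\<inverse>F \<subseteq> B\<close> and whose plateaus cover \<open>B\<close>. For the integers, \<open>B\<close> is an
  interval \<open>[-R, R]\<close>, covered by three trapezoids of width less than \<open>R\<close>. In general one passes to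
  the quotient by an infinite cyclic central subgroup, which lowers the number of infinite factors
  of any polycyclic series, and each such step costs a factor of three. Translating the functions
  along the sets \<open>Z k\<close> and normalising their sum gives the required maps.\<close>

section \<open>Perturbing functions on a space of finite covering dimension\<close>

text \<open>The same \<open>B\<close> has to serve twice: a marker set must miss its translates by
  \<open>B - {1}\<close>, and its translates by \<open>B\<close> must already cover
  \<open>X\<close>. A maximal \<open>B\<close>-separated set has both properties, but need not be
  open. Forcing openness leaves points uncovered that are blocked only by a boundary. The
  \<open>d + 1\<close> copies repair exactly this: a generic map from a \<open>d\<close>-dimensional
  space to R^(d+1) omits the origin, so at each point some copy has no such problem. The factor
  three has a metric origin. A set of integers with all differences in \<open>[-R, R]\<close> lies
  in an interval of length \<open>R\<close>, half of the length of \<open>[-R, R]\<close>. Two such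
  intervals would suffice if the functions had no slopes; almost invariance needs long slopes, and a
  third interval makes room for them.\<close>

lemma perturb_off_hyperplanes:
  fixes P :: "('i \<Rightarrow> real) set" and f :: "'i \<Rightarrow> real"
  assumes "finite I" "finite P" "\<And>p. p \<in> P \<Longrightarrow> \<exists>i\<in>I. p i \<noteq> 0" "\<epsilon> > 0"
  shows "\<exists>y. (\<forall>i\<in>I. \<bar>y i - f i\<bar> < \<epsilon>) \<and> (\<forall>p\<in>P. (\<Sum>i\<in>I. p i * y i) \<noteq> 0)"
  using assms(2,3)
proof (induction)
  case empty
  then show ?case using \<open>\<epsilon> > 0\<close> by (intro exI[of _ f]) auto
next
  case (insert q P)
  then obtain y where y: "\<forall>i\<in>I. \<bar>y i - f i\<bar> < \<epsilon>" "\<forall>p\<in>P. (\<Sum>i\<in>I. p i * y i) \<noteq> 0"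
    by auto
  obtain j where j: "j \<in> I" "q j \<noteq> 0" using insert.prems by blast
  have pos: "(\<Sum>i\<in>I. q i * q i) > 0"
    using j \<open>finite I\<close> by (intro sum_pos2[of _ j]) (auto simp: zero_less_mult_iff not_le)
  have expand: "(\<Sum>i\<in>I. p i * (y i + t * q i)) = (\<Sum>i\<in>I. p i * y i) + t * (\<Sum>i\<in>I. p i * q i)"
    for p t by (simp add: sum_distrib_left sum.distrib algebra_simps)
  have "eventually (\<lambda>t. \<bar>y i + t * q i - f i\<bar> < \<epsilon>) (at_right 0)" if "i \<in> I" for i
  proof -
    have "((\<lambda>t. \<bar>y i + t * q i - f i\<bar>) \<longlongrightarrow> \<bar>y i + 0 * q i - f i\<bar>) (at_right 0)"
      by (intro tendsto_intros)
    then show ?thesis using y(1) that by (auto intro: order_tendstoD(2))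
  qed
  then have "eventually (\<lambda>t. \<forall>i\<in>I. \<bar>y i + t * q i - f i\<bar> < \<epsilon>) (at_right 0)"
    using \<open>finite I\<close> by (simp add: eventually_ball_finite)
  \<comment> \<open>Each sum is affine in \<open>t\<close>. For an old \<open>p\<close> the constant
    term is nonzero by induction, for \<open>p = q\<close> the coefficient of \<open>t\<close> is
    positive; so no sum vanishes for small positive \<open>t\<close>.\<close>
  moreover have "eventually (\<lambda>t. a + t * b \<noteq> 0) (at_right 0)" if "a \<noteq> 0 \<or> b \<noteq> 0" for a b :: real
  proof (cases "a = 0")
    case True
    then show ?thesis using that eventually_at_right_less[of "0::real"]
      by (auto elim!: eventually_mono)
  next
    case False
    have "((\<lambda>t. a + t * b) \<longlongrightarrow> a + 0 * b) (at_right 0)" by (intro tendsto_intros)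
    then show ?thesis using False by (intro tendsto_imp_eventually_ne) auto
  qed
  then have "eventually (\<lambda>t. \<forall>p\<in>insert q P. (\<Sum>i\<in>I. p i * y i) + t * (\<Sum>i\<in>I. p i * q i) \<noteq> 0) (at_right 0)"
    using insert.hyps(1) pos y(2) by (intro eventually_ball_finite) auto
  ultimately have "eventually (\<lambda>t. (\<forall>i\<in>I. \<bar>y i + t * q i - f i\<bar> < \<epsilon>) \<and>
      (\<forall>p\<in>insert q P. (\<Sum>i\<in>I. p i * (y i + t * q i)) \<noteq> 0)) (at_right 0)"
    unfolding expand by eventually_elim blast
  then obtain t where "(\<forall>i\<in>I. \<bar>y i + t * q i - f i\<bar> < \<epsilon>)"
      "(\<forall>p\<in>insert q P. (\<Sum>i\<in>I. p i * (y i + t * q i)) \<noteq> 0)"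
    using eventually_happens'[OF trivial_limit_at_right_real] by blast
  then show ?case by (intro exI[of _ "\<lambda>i. y i + t * q i"]) blast
qed

text \<open>Regard \<open>y 0 i, ..., y (m - 1) i\<close> as the coordinates of a point in R^m
  attached to \<open>i\<close>. The conclusion is linear independence of any at most
  \<open>m\<close> of these points, written through the relations \<open>p\<close> among them. The
  induction adds one coordinate at a time.\<close>

lemma perturb_general_position:
  fixes f :: "nat \<Rightarrow> 'i \<Rightarrow> real"
  assumes I: "finite I" and \<epsilon>: "\<epsilon> > 0"
  shows "\<exists>y. (\<forall>k<m. \<forall>i\<in>I. \<bar>y k i - f k i\<bar> < \<epsilon>) \<and>
    (\<forall>S p. S \<subseteq> I \<and> card S \<le> m \<and> (\<forall>i\<in>I - S. p i = 0) \<and> (\<forall>k<m. (\<Sum>i\<in>I. p i * y k i) = 0)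
       \<longrightarrow> (\<forall>i\<in>I. p i = 0))"
proof (induction m)
  case 0
  have "S = {}" if "S \<subseteq> I" "card S \<le> 0" for S
    using that finite_subset[OF that(1) I] by simp
  then show ?case by auto
next
  case (Suc m)
  then obtain y where y: "\<forall>k<m. \<forall>i\<in>I. \<bar>y k i - f k i\<bar> < \<epsilon>"
    and y_indep: "\<forall>S p. S \<subseteq> I \<and> card S \<le> m \<and> (\<forall>i\<in>I - S. p i = 0) \<and>
      (\<forall>k<m. (\<Sum>i\<in>I. p i * y k i) = 0) \<longrightarrow> (\<forall>i\<in>I. p i = 0)"
    by (elim exE conjE)
  have indep: "p i = 0" if "S \<subseteq> I" "card S \<le> m" "\<And>i. i \<in> I - S \<Longrightarrow> p i = 0"
      "\<And>k. k < m \<Longrightarrow> (\<Sum>i\<in>I. p i * y k i) = 0" "i \<in> I" for S p i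
    using y_indep[rule_format, of S p i] that by simp
  \<comment> \<open>For \<open>card S \<le> Suc m\<close> the space of all \<open>p\<close> with \<open>K S p\<close> is at most one-dimensional, so the new
    vector only has to avoid one hyperplane for each \<open>S\<close>.\<close>
  define K where "K S p \<longleftrightarrow> (\<forall>i\<in>I - S. p i = 0) \<and> (\<forall>k<m. (\<Sum>i\<in>I. p i * y k i) = 0)" for S p
  define \<S> where "\<S> = {S. S \<subseteq> I \<and> card S \<le> Suc m \<and> (\<exists>p. K S p \<and> (\<exists>i\<in>I. p i \<noteq> 0))}"
  have "\<forall>S\<in>\<S>. \<exists>p. K S p \<and> (\<exists>i\<in>I. p i \<noteq> 0)" by (auto simp: \<S>_def)
  then obtain q where q: "\<And>S. S \<in> \<S> \<Longrightarrow> K S (q S)" "\<And>S. S \<in> \<S> \<Longrightarrow> \<exists>i\<in>I. q S i \<noteq> 0"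
    by metis
  have "finite \<S>" by (rule finite_subset[of _ "Pow I"]) (auto simp: \<S>_def I)
  moreover have "\<exists>i\<in>I. p i \<noteq> 0" if "p \<in> q ` \<S>" for p
    using that q(2) by auto
  ultimately have "\<exists>z. (\<forall>i\<in>I. \<bar>z i - f m i\<bar> < \<epsilon>) \<and> (\<forall>p\<in>q ` \<S>. (\<Sum>i\<in>I. p i * z i) \<noteq> 0)"
    by (intro perturb_off_hyperplanes[OF I _ _ \<epsilon>] finite_imageI)
  then obtain z where z: "\<forall>i\<in>I. \<bar>z i - f m i\<bar> < \<epsilon>" "\<And>S. S \<in> \<S> \<Longrightarrow> (\<Sum>i\<in>I. q S i * z i) \<noteq> 0"
    by blast
  define y' where "y' = y(m := z)"
  have "p i = 0" if S: "S \<subseteq> I" "card S \<le> Suc m" and supp: "\<forall>i\<in>I - S. p i = 0"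
    and ker: "\<forall>k<Suc m. (\<Sum>i\<in>I. p i * y' k i) = 0" and "i \<in> I" for S p i
  proof (rule ccontr)
    assume "p i \<noteq> 0"
    have ker': "(\<Sum>i\<in>I. p i * y k i) = 0" if "k < m" for k
      using ker[rule_format, of k] that by (simp add: y'_def)
    then have "K S p" using supp by (simp add: K_def)
    then have "S \<in> \<S>" using S \<open>p i \<noteq> 0\<close> \<open>i \<in> I\<close> by (auto simp: \<S>_def)
    obtain j where j: "j \<in> I" "q S j \<noteq> 0" using q(2)[OF \<open>S \<in> \<S>\<close>] by blast
    have "j \<in> S" using q(1)[OF \<open>S \<in> \<S>\<close>] j by (auto simp: K_def)
    \<comment> \<open>This multiple of \<open>q S\<close> cancels the entry at \<open>j\<close>, so
      the difference is a relation on at most \<open>m\<close> points and vanishes by induction.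
      Thus \<open>p\<close> is proportional to \<open>q S\<close>, a relation that \<open>z\<close>
      was chosen to break.\<close>
    define c where "c = p j / q S j"
    have colinear: "p i - c * q S i = 0" if "i \<in> I" for i
    proof (rule indep[of "S - {j}" "\<lambda>i. p i - c * q S i"])
      show "card (S - {j}) \<le> m"
        using S \<open>j \<in> S\<close> I by (simp add: card_Diff_singleton finite_subset)
      fix i assume "i \<in> I - (S - {j})"
      then show "p i - c * q S i = 0"
        using supp q(1)[OF \<open>S \<in> \<S>\<close>] j by (cases "i = j") (auto simp: K_def c_def)
    next
      fix k assume "k < m"
      then show "(\<Sum>i\<in>I. (p i - c * q S i) * y k i) = 0"
        using ker'[of k] q(1)[OF \<open>S \<in> \<S>\<close>]
        by (simp add: K_def left_diff_distrib sum_subtractf mult.assoc flip: sum_distrib_left)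
    qed (use S that in auto)
    then have "(\<Sum>i\<in>I. p i * z i) = c * (\<Sum>i\<in>I. q S i * z i)"
      by (simp add: sum_distrib_left mult.assoc[symmetric])
    moreover have "(\<Sum>i\<in>I. p i * z i) = 0" using ker[rule_format, of m] by (simp add: y'_def)
    ultimately have "c = 0" using z(2)[OF \<open>S \<in> \<S>\<close>] by simp
    then show False using colinear[OF \<open>i \<in> I\<close>] \<open>p i \<noteq> 0\<close> by simp
  qed
  then show ?case
    using y z(1) by (intro exI[of _ y']) (auto simp: y'_def less_Suc_eq)
qed

text \<open>The functions are the coordinates of a map to R^(d+1). It is replaced by a map through
  the nerve of a fine cover of multiplicity at most \<open>d + 1\<close>: a partition of unity,
  followed by the map that sends each vertex to a point in general position near a value of
  \<open>F\<close>.\<close>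

lemma perturb_no_common_zero:
  fixes F :: "nat \<Rightarrow> 'x::metric_space \<Rightarrow> real"
  assumes cpt: "compact (UNIV :: 'x set)" and dim: "covering_dim_le (euclidean :: 'x topology) d"
    and F: "\<And>k. k \<le> d \<Longrightarrow> continuous_on UNIV (F k)" and \<epsilon>: "\<epsilon> > 0"
  obtains F' where "\<And>k. k \<le> d \<Longrightarrow> continuous_on UNIV (F' k)"
    "\<And>k x. k \<le> d \<Longrightarrow> \<bar>F' k x - F k x\<bar> < \<epsilon>" "\<And>x. \<exists>k\<le>d. F' k x \<noteq> 0"
proof -
  \<comment> \<open>The tolerance is split: members of the refined cover have oscillation below
    \<open>\<epsilon> / 2\<close>, and moving the vertices costs another
    \<open>\<epsilon> / 4\<close>.\<close>
  define N where "N x = (\<Inter>k\<le>d. {y. \<bar>F k y - F k x\<bar> < \<epsilon> / 4})" for x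
  have "open (N x)" for x
    unfolding N_def by (intro open_INT ballI open_Collect_less continuous_intros F) auto
  moreover have N_self: "x \<in> N x" for x using \<epsilon> by (simp add: N_def)
  ultimately obtain C where C: "finite C" "UNIV \<subseteq> (\<Union>x\<in>C. N x)"
    by (rule_tac compactE_image[OF cpt, of UNIV N]) auto
  have "\<exists>\<V>. finite \<V> \<and> (\<forall>V\<in>\<V>. open V) \<and> \<Union>\<V> = UNIV \<and> (\<forall>V\<in>\<V>. \<exists>U\<in>N ` C. V \<subseteq> U) \<and>
      (\<forall>x. card {V \<in> \<V>. x \<in> V} \<le> d + 1)"
    using dim[unfolded covering_dim_le_def, rule_format, of "N ` C"] C \<open>\<And>x. open (N x)\<close> by auto
  then obtain \<V> where "finite \<V> \<and> (\<forall>V\<in>\<V>. open V) \<and> \<Union>\<V> = UNIV \<and> (\<forall>V\<in>\<V>. \<exists>U\<in>N ` C. V \<subseteq> U) \<and>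
      (\<forall>x. card {V \<in> \<V>. x \<in> V} \<le> d + 1)" ..
  then have \<V>: "finite \<V>" "\<And>V. V \<in> \<V> \<Longrightarrow> open V" "\<Union>\<V> = UNIV"
    "\<And>V. V \<in> \<V> \<Longrightarrow> \<exists>U\<in>N ` C. V \<subseteq> U" "\<And>x. card {V \<in> \<V>. x \<in> V} \<le> d + 1"
    by simp_all
  have osc: "\<bar>F k x - F k y\<bar> < \<epsilon> / 2" if "V \<in> \<V>" "x \<in> V" "y \<in> V" "k \<le> d" for V x y k
  proof -
    obtain c where "V \<subseteq> N c" using \<V>(4)[OF \<open>V \<in> \<V>\<close>] by blast
    then have "\<bar>F k x - F k c\<bar> < \<epsilon> / 4" "\<bar>F k y - F k c\<bar> < \<epsilon> / 4"
      using that by (auto simp: N_def)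
    then show ?thesis by linarith
  qed
  obtain p :: "'x set \<Rightarrow> 'x \<Rightarrow> real" where
    p: "\<And>V. V \<in> \<V> \<Longrightarrow> continuous_on UNIV (p V) \<and> (\<forall>x\<in>UNIV. 0 \<le> p V x)"
      "\<And>x V. V \<in> \<V> \<Longrightarrow> x \<in> UNIV \<Longrightarrow> x \<notin> V \<Longrightarrow> p V x = 0"
      "\<And>x. x \<in> UNIV \<Longrightarrow> supp_sum (\<lambda>V. p V x) \<V> = 1"
    by (rule subordinate_partition_of_unity[of UNIV \<V>]) (use \<V> in auto)
  have p1: "(\<Sum>V\<in>\<V>. p V x) = 1" for x
    using p(3)[of x] \<V>(1) unfolding supp_sum_def support_on_def
    by (simp add: sum.mono_neutral_cong_left[of \<V> "{V \<in> \<V>. p V x \<noteq> 0}" "\<lambda>V. p V x"])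
  define a where "a V = (SOME x. x \<in> V)" for V :: "'x set"
  obtain y where y: "\<And>k V. k < d + 1 \<Longrightarrow> V \<in> \<V> \<Longrightarrow> \<bar>y k V - F k (a V)\<bar> < \<epsilon> / 4"
    and indep: "\<forall>S q. S \<subseteq> \<V> \<and> card S \<le> d + 1 \<and> (\<forall>V\<in>\<V> - S. q V = 0) \<and>
      (\<forall>k<d+1. (\<Sum>V\<in>\<V>. q V * y k V) = 0) \<longrightarrow> (\<forall>V\<in>\<V>. q V = 0)"
    using perturb_general_position[OF \<V>(1), of "\<epsilon> / 4" "d + 1" "\<lambda>k V. F k (a V)"] \<epsilon>
    by auto
  \<comment> \<open>At each point the perturbed map is a convex combination of at most \<open>d + 1\<close> linearly
    independent vectors, hence nonzero.\<close>
  show ?thesis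
  proof (rule that[of "\<lambda>k x. \<Sum>V\<in>\<V>. p V x * y k V"])
    show "continuous_on UNIV (\<lambda>x. \<Sum>V\<in>\<V>. p V x * y k V)" for k
      using p(1) by (intro continuous_intros) auto
  next
    fix k x assume "k \<le> d"
    have "(\<Sum>V\<in>\<V>. p V x * y k V) - F k x = (\<Sum>V\<in>\<V>. p V x * (y k V - F k x))"
      using p1[of x] by (simp add: right_diff_distrib sum_subtractf flip: sum_distrib_right)
    also have "\<bar>\<dots>\<bar> \<le> (\<Sum>V\<in>\<V>. p V x * (3 * \<epsilon> / 4))"
    proof (rule sum_abs[THEN order_trans], rule sum_mono)
      fix V assume V: "V \<in> \<V>"
      show "\<bar>p V x * (y k V - F k x)\<bar> \<le> p V x * (3 * \<epsilon> / 4)"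
      proof (cases "x \<in> V")
        case True
        then have "a V \<in> V" by (metis a_def someI)
        from osc[OF V this True \<open>k \<le> d\<close>] have "\<bar>F k (a V) - F k x\<bar> < \<epsilon> / 2" .
        moreover have "\<bar>y k V - F k (a V)\<bar> < \<epsilon> / 4" using y V \<open>k \<le> d\<close> by simp
        ultimately have "\<bar>y k V - F k x\<bar> \<le> 3 * \<epsilon> / 4" by linarith
        from mult_left_mono[OF this, of "p V x"] show ?thesis using p(1)[OF V] by (simp add: abs_mult)
      qed (use p(2) V in simp)
    qed
    also have "\<dots> = 3 * \<epsilon> / 4" unfolding sum_distrib_right[symmetric] p1 by simp
    finally show "\<bar>(\<Sum>V\<in>\<V>. p V x * y k V) - F k x\<bar> < \<epsilon>" using \<epsilon> by simp
  next
    fix x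
    show "\<exists>k\<le>d. (\<Sum>V\<in>\<V>. p V x * y k V) \<noteq> 0"
    proof (rule ccontr)
      assume "\<not> ?thesis"
      then have "p V x = 0" if "V \<in> \<V>" for V
        using that \<V>(5)[of x] p(2)[of _ x]
        by (intro indep[rule_format, of "{V \<in> \<V>. x \<in> V}" "\<lambda>V. p V x"]) auto
      then show False using p1[of x] by simp
    qed
  qed
qed

lemma compact_positive_lower_bound:
  fixes h :: "'x::topological_space \<Rightarrow> real"
  assumes "compact (UNIV :: 'x set)" "continuous_on UNIV h" "\<And>x. h x > 0"
  obtains c where "c > 0" "\<And>x. c \<le> h x"
proof -
  obtain x0 where "\<And>x. h x0 \<le> h x"
    using continuous_attains_inf[OF assms(1) _ assms(2)] by auto
  then show ?thesis using that assms(3) by blast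
qed

text \<open>The functions \<open>f k (snd (c k)) \<circ> fst (c k)\<close> can be perturbed independently of each other,
  because they involve different \<open>k\<close>; the bound \<open>\<delta>\<close> keeps the choices treated before intact.\<close>

lemma perturb_finitely_many_choices:
  fixes f :: "nat \<Rightarrow> 'i \<Rightarrow> 'x::metric_space \<Rightarrow> real" and C :: "(nat \<Rightarrow> ('x \<Rightarrow> 'x) \<times> 'i) set"
  assumes cpt: "compact (UNIV :: 'x set)" and dim: "covering_dim_le (euclidean :: 'x topology) d"
    and "finite C"
    and "\<And>c k. c \<in> C \<Longrightarrow> k \<le> d \<Longrightarrow> \<exists>\<gamma>'. homeomorphism UNIV UNIV (fst (c k)) \<gamma>'"
    and f: "\<And>k i. continuous_on UNIV (f k i)" and "\<epsilon> > 0"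
  shows "\<exists>f' \<delta>. (\<forall>k i. continuous_on UNIV (f' k i)) \<and> (\<forall>k i x. \<bar>f' k i x - f k i x\<bar> < \<epsilon>) \<and> \<delta> > 0 \<and>
     (\<forall>c\<in>C. \<forall>x. \<delta> \<le> (\<Sum>k\<le>d. \<bar>f' k (snd (c k)) (fst (c k) x)\<bar>))"
  using assms(3,4,6)
proof (induction arbitrary: \<epsilon>)
  case empty
  then show ?case using f by (intro exI[of _ f] exI[of _ 1]) auto
next
  case (insert c C)
  have "\<epsilon> / 2 > 0" using insert.prems(2) by simp
  have "\<exists>g \<delta>. (\<forall>k i. continuous_on UNIV (g k i)) \<and> (\<forall>k i x. \<bar>g k i x - f k i x\<bar> < \<epsilon> / 2) \<and> \<delta> > 0 \<and>
      (\<forall>c\<in>C. \<forall>x. \<delta> \<le> (\<Sum>k\<le>d. \<bar>g k (snd (c k)) (fst (c k) x)\<bar>))"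
  proof (rule insert.IH)
    show "\<exists>\<gamma>'. homeomorphism UNIV UNIV (fst (c' k)) \<gamma>'" if "c' \<in> C" "k \<le> d" for c' k
      using insert.prems(1) that by simp
  qed fact
  then obtain g \<delta> where
    "(\<forall>k i. continuous_on UNIV (g k i)) \<and> (\<forall>k i x. \<bar>g k i x - f k i x\<bar> < \<epsilon> / 2) \<and> \<delta> > 0 \<and>
      (\<forall>c\<in>C. \<forall>x. \<delta> \<le> (\<Sum>k\<le>d. \<bar>g k (snd (c k)) (fst (c k) x)\<bar>))"
    by (elim exE)
  then have g: "\<And>k i. continuous_on UNIV (g k i)" "\<And>k i x. \<bar>g k i x - f k i x\<bar> < \<epsilon> / 2" "\<delta> > 0"
      "\<And>c x. c \<in> C \<Longrightarrow> \<delta> \<le> (\<Sum>k\<le>d. \<bar>g k (snd (c k)) (fst (c k) x)\<bar>)"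
    by simp_all
  obtain \<gamma>' where \<gamma>': "\<And>k. k \<le> d \<Longrightarrow> homeomorphism UNIV UNIV (fst (c k)) (\<gamma>' k)"
    using insert.prems(1)[of c] by (metis insertI1)
  \<comment> \<open>The first bound keeps the total perturbation below \<open>\<epsilon>\<close>; by
    the second, \<open>d + 1\<close> summands changed by \<open>\<eta>\<close> lower an earlier sum
    by at most \<open>\<delta> / 2\<close>.\<close>
  define \<eta> where "\<eta> = min (\<epsilon> / 2) (\<delta> / (2 * (real d + 1)))"
  have \<eta>: "\<eta> > 0" "\<eta> \<le> \<epsilon> / 2" "(real d + 1) * \<eta> \<le> \<delta> / 2"
  proof -
    have "(real d + 1) * \<eta> \<le> (real d + 1) * (\<delta> / (2 * (real d + 1)))"
      by (intro mult_left_mono) (auto simp: \<eta>_def)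
    also have "\<dots> = \<delta> / 2" by (simp add: divide_simps)
    finally show "(real d + 1) * \<eta> \<le> \<delta> / 2" .
    show "\<eta> \<le> \<epsilon> / 2" unfolding \<eta>_def by (rule min.cobounded1)
  qed (use g(3) insert.prems(2) in \<open>auto simp: \<eta>_def\<close>)
  have g_cont: "continuous_on UNIV (\<lambda>x. g k (snd (c k)) (fst (c k) x))" if "k \<le> d" for k
    by (rule continuous_on_compose2[OF g(1) homeomorphism_cont1[OF \<gamma>'[OF that]] subset_UNIV])
  obtain F where F: "\<And>k. k \<le> d \<Longrightarrow> continuous_on UNIV (F k)"
    "\<And>k x. k \<le> d \<Longrightarrow> \<bar>F k x - g k (snd (c k)) (fst (c k) x)\<bar> < \<eta>" "\<And>x. \<exists>k\<le>d. F k x \<noteq> 0"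
    by (rule perturb_no_common_zero[OF cpt dim g_cont \<eta>(1)]) (assumption, rule that)
  define h where "h k i = (if k \<le> d \<and> i = snd (c k) then F k \<circ> \<gamma>' k else g k i)" for k i
  have h_cont: "continuous_on UNIV (h k i)" for k i
    using g(1) continuous_on_compose2[OF F(1) homeomorphism_cont2[OF \<gamma>'] subset_UNIV, of k k]
    by (simp add: h_def comp_def)
  have inv1: "\<gamma>' k (fst (c k) x) = x" if "k \<le> d" for k x
    using homeomorphism_apply1[OF \<gamma>'[OF that]] by simp
  have inv2: "fst (c k) (\<gamma>' k x) = x" if "k \<le> d" for k x
    using homeomorphism_apply2[OF \<gamma>'[OF that]] by simp
  have h_close: "\<bar>h k i x - g k i x\<bar> < \<eta>" for k i x
    using F(2)[of k "\<gamma>' k x"] \<eta>(1) inv2[of k x] by (auto simp: h_def)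
  obtain \<delta>' where \<delta>': "\<delta>' > 0" "\<And>x. \<delta>' \<le> (\<Sum>k\<le>d. \<bar>F k x\<bar>)"
  proof (rule compact_positive_lower_bound[OF cpt])
    show "continuous_on UNIV (\<lambda>x. \<Sum>k\<le>d. \<bar>F k x\<bar>)" using F(1) by (intro continuous_intros) auto
    show "(\<Sum>k\<le>d. \<bar>F k x\<bar>) > 0" for x
      using F(3)[of x] by (metis atMost_iff finite_atMost sum_pos2 abs_ge_zero zero_less_abs_iff)
  qed (rule that)
  have "min (\<delta> / 2) \<delta>' \<le> (\<Sum>k\<le>d. \<bar>h k (snd (c' k)) (fst (c' k) x)\<bar>)" if "c' \<in> insert c C" for c' x
  proof (cases "c' = c")
    case True
    have "(\<Sum>k\<le>d. \<bar>h k (snd (c' k)) (fst (c' k) x)\<bar>) = (\<Sum>k\<le>d. \<bar>F k x\<bar>)"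
      using True inv1 by (intro sum.cong) (auto simp: h_def)
    then show ?thesis using \<delta>'(2)[of x] by simp
  next
    case False
    then have "\<delta> \<le> (\<Sum>k\<le>d. \<bar>g k (snd (c' k)) (fst (c' k) x)\<bar>)" using that g(4) by simp
    also have "\<dots> \<le> (\<Sum>k\<le>d. \<bar>h k (snd (c' k)) (fst (c' k) x)\<bar> + \<eta>)"
    proof (rule sum_mono)
      show "\<bar>g k (snd (c' k)) (fst (c' k) x)\<bar> \<le> \<bar>h k (snd (c' k)) (fst (c' k) x)\<bar> + \<eta>" for k
        using h_close[of k "snd (c' k)" "fst (c' k) x"] by linarith
    qed
    also have "\<dots> = (\<Sum>k\<le>d. \<bar>h k (snd (c' k)) (fst (c' k) x)\<bar>) + (real d + 1) * \<eta>"
      by (simp add: sum.distrib algebra_simps)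
    finally show ?thesis using \<eta>(3) by linarith
  qed
  moreover have "\<bar>h k i x - f k i x\<bar> < \<epsilon>" for k i x
    using h_close[of k i x] g(2)[of k i x] \<eta>(2) by linarith
  ultimately show ?case
    using h_cont g(3) \<delta>'(1) by (intro exI[of _ h] exI[of _ "min (\<delta> / 2) \<delta>'"]) auto
qed

text \<open>If the conclusion fails at \<open>x\<close>, each \<open>k \<le> d\<close> comes with a
  pair \<open>(\<gamma>, i)\<close> for which \<open>f' k i\<close> vanishes at
  \<open>\<gamma> x\<close>. These pairs form a choice function, and since there are finitely many
  of those, the common zeros of each have been perturbed away.\<close>

lemma perturb_disjoint_zero_orbits:
  fixes f :: "nat \<Rightarrow> 'i \<Rightarrow> 'x::metric_space \<Rightarrow> real" and \<Gamma> :: "('x \<Rightarrow> 'x) set"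
  assumes cpt: "compact (UNIV :: 'x set)" and dim: "covering_dim_le (euclidean :: 'x topology) d"
    and \<Gamma>: "finite \<Gamma>" "\<And>\<gamma>. \<gamma> \<in> \<Gamma> \<Longrightarrow> \<exists>\<gamma>'. homeomorphism UNIV UNIV \<gamma> \<gamma>'"
    and I: "finite I" and f: "\<And>k i. continuous_on UNIV (f k i)" and \<epsilon>: "\<epsilon> > 0"
  obtains f' where "\<And>k i. continuous_on UNIV (f' k i)" "\<And>k i x. \<bar>f' k i x - f k i x\<bar> < \<epsilon>"
    "\<And>x. \<exists>k\<le>d. \<forall>\<gamma>\<in>\<Gamma>. \<forall>i\<in>I. f' k i (\<gamma> x) \<noteq> 0"
proof -
  define C where "C = PiE {..d} (\<lambda>_. \<Gamma> \<times> I)"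
  have "finite C" unfolding C_def using \<Gamma>(1) I by (intro finite_PiE) auto
  moreover have "\<exists>\<gamma>'. homeomorphism UNIV UNIV (fst (c k)) \<gamma>'" if "c \<in> C" "k \<le> d" for c k
    using that \<Gamma>(2) unfolding C_def by (auto simp: PiE_iff mem_Times_iff)
  ultimately have "\<exists>f' \<delta>. (\<forall>k i. continuous_on UNIV (f' k i)) \<and> (\<forall>k i x. \<bar>f' k i x - f k i x\<bar> < \<epsilon>) \<and> \<delta> > 0 \<and>
     (\<forall>c\<in>C. \<forall>x. \<delta> \<le> (\<Sum>k\<le>d. \<bar>f' k (snd (c k)) (fst (c k) x)\<bar>))"
    by (rule perturb_finitely_many_choices[OF cpt dim]) (use f \<epsilon> in auto)
  then obtain f' \<delta> where "(\<forall>k i. continuous_on UNIV (f' k i)) \<and> (\<forall>k i x. \<bar>f' k i x - f k i x\<bar> < \<epsilon>) \<and> \<delta> > 0 \<and>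
     (\<forall>c\<in>C. \<forall>x. \<delta> \<le> (\<Sum>k\<le>d. \<bar>f' k (snd (c k)) (fst (c k) x)\<bar>))"
    by (elim exE)
  then have f': "\<And>k i. continuous_on UNIV (f' k i)" "\<And>k i x. \<bar>f' k i x - f k i x\<bar> < \<epsilon>" and \<delta>: "\<delta> > 0"
    "\<And>c x. c \<in> C \<Longrightarrow> \<delta> \<le> (\<Sum>k\<le>d. \<bar>f' k (snd (c k)) (fst (c k) x)\<bar>)"
    by simp_all
  have "\<exists>k\<le>d. \<forall>\<gamma>\<in>\<Gamma>. \<forall>i\<in>I. f' k i (\<gamma> x) \<noteq> 0" for x
  proof (rule ccontr)
    assume "\<not> ?thesis"
    then have "\<forall>k\<in>{..d}. \<exists>c\<in>\<Gamma> \<times> I. f' k (snd c) (fst c x) = 0" by fastforce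
    then obtain c where c: "\<And>k. k \<le> d \<Longrightarrow> c k \<in> \<Gamma> \<times> I" "\<And>k. k \<le> d \<Longrightarrow> f' k (snd (c k)) (fst (c k) x) = 0"
      by (metis atMost_iff)
    have "restrict c {..d} \<in> C" using c(1) by (auto simp: C_def)
    from \<delta>(2)[OF this, of x] c(2) \<delta>(1) show False by simp
  qed
  then show ?thesis using that f' by blast
qed


section \<open>Marker sets for free actions\<close>

text \<open>A point blocked in the greedy construction is traced back through at most one
  translation per stage, so products of this length bound the translates of boundaries that can
  interfere.\<close>

primrec word_ball :: "('g, 'm) monoid_scheme \<Rightarrow> 'g set \<Rightarrow> nat \<Rightarrow> 'g set" where
  "word_ball G B 0 = {\<one>\<^bsub>G\<^esub>}"
| "word_ball G B (Suc n) = word_ball G B n \<union> (\<lambda>(g, b). g \<otimes>\<^bsub>G\<^esub> b) ` (word_ball G B n \<times> B)"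

lemma finite_word_ball: "finite B \<Longrightarrow> finite (word_ball G B n)"
  by (induction n) auto

lemma (in group) word_ball_subset: "B \<subseteq> carrier G \<Longrightarrow> word_ball G B n \<subseteq> carrier G"
  by (induction n) auto

lemma one_in_word_ball: "\<one>\<^bsub>G\<^esub> \<in> word_ball G B n"
  by (induction n) auto

section \<open>Greedy extraction of separated open sets\<close>

context topological_action
begin

sublocale G: group G
  using group_hom by (simp add: group_hom_def)

lemma act_one [simp]: "\<alpha> \<one> x = x"
  using fun_cong[OF id_eq_one, of x] by simp

lemma act_mult: "g \<in> carrier G \<Longrightarrow> h \<in> carrier G \<Longrightarrow> \<alpha> (g \<otimes> h) x = \<alpha> g (\<alpha> h x)"
  using composition_rule[of x g h] by simp

lemma act_inv [simp]: "g \<in> carrier G \<Longrightarrow> \<alpha> (inv g) (\<alpha> g x) = x"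
  and act_inv' [simp]: "g \<in> carrier G \<Longrightarrow> \<alpha> g (\<alpha> (inv g) x) = x"
  by (simp_all flip: act_mult)

lemma continuous_on_act: "g \<in> carrier G \<Longrightarrow> continuous_on S (\<alpha> g)"
  using homeomorphism[of g] homeomorphic_imp_continuous_map continuous_on_subset[of UNIV "\<alpha> g" S]
  by fastforce

lemma homeomorphism_act: "g \<in> carrier G \<Longrightarrow> Elementary_Topology.homeomorphism UNIV UNIV (\<alpha> g) (\<alpha> (inv g))"
  by (rule homeomorphismI) (auto intro: continuous_on_act)

lemma act_image: "g \<in> carrier G \<Longrightarrow> \<alpha> g ` S = \<alpha> (inv g) -` S"
  by (auto simp: image_iff) (metis act_inv')

lemma open_act_image: "g \<in> carrier G \<Longrightarrow> open S \<Longrightarrow> open (\<alpha> g ` S)"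
  unfolding act_image by (intro open_vimage continuous_on_act) auto

lemma closed_act_image: "g \<in> carrier G \<Longrightarrow> closed S \<Longrightarrow> closed (\<alpha> g ` S)"
  unfolding act_image by (intro closed_vimage continuous_on_act) auto

text \<open>Removing translates of the closure, rather than of the set, keeps every stage open. The
  price is that a point of \<open>U n\<close> can be excluded by a boundary point of an earlier
  stage without meeting a translate of that stage; the sets \<open>L i\<close> below, which contain
  the boundaries of the \<open>U i\<close>, control this.\<close>

primrec greedy_marker :: "'g set \<Rightarrow> (nat \<Rightarrow> 'x set) \<Rightarrow> nat \<Rightarrow> 'x set" where
  "greedy_marker B U 0 = {}"
| "greedy_marker B U (Suc n) =
    greedy_marker B U n \<union> (U n - (\<Union>b\<in>B. \<alpha> b ` closure (greedy_marker B U n)))"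

lemma greedy_marker_mono: "m \<le> n \<Longrightarrow> greedy_marker B U m \<subseteq> greedy_marker B U n"
  by (induction rule: dec_induct) auto

context
  fixes B :: "'g set" and U L :: "nat \<Rightarrow> 'x set" and N :: nat
  assumes B: "finite B" "B \<subseteq> carrier G" "\<one> \<in> B" "\<And>b. b \<in> B \<Longrightarrow> inv b \<in> B"
    and U: "\<And>i. open (U i)" "\<And>i b x. i < N \<Longrightarrow> b \<in> B \<Longrightarrow> b \<noteq> \<one> \<Longrightarrow> x \<in> U i \<Longrightarrow> \<alpha> b x \<notin> U i"
    and L: "\<And>i. i < N \<Longrightarrow> closure (U i) \<subseteq> U i \<union> L i"
begin

lemma open_greedy_marker: "open (greedy_marker B U n)"
  using B U by (induction n) (auto intro!: open_Un open_Diff closed_UN closed_act_image)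

text \<open>Points taken at the same stage are separated because \<open>U n\<close> misses its own
  translates, points taken at different stages by the removal, in both orders because
  \<open>B\<close> is closed under inverses.\<close>

lemma greedy_marker_disjoint:
  assumes "n \<le> N" "b \<in> B" "b \<noteq> \<one>" "x \<in> greedy_marker B U n"
  shows "\<alpha> b x \<notin> greedy_marker B U n"
  using assms
proof (induction n arbitrary: b x)
  case (Suc n)
  let ?S = "greedy_marker B U n"
  let ?W = "U n - (\<Union>b\<in>B. \<alpha> b ` closure ?S)"
  have bG: "b \<in> carrier G" using Suc.prems B by auto
  have cl: "?S \<subseteq> closure ?S" by (rule closure_subset)
  have "\<alpha> b x \<notin> ?W" if "x \<in> ?S" using that cl Suc.prems by auto
  moreover have "\<alpha> b x \<notin> ?S" if "x \<in> ?W"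
  proof
    assume "\<alpha> b x \<in> ?S"
    then have "\<alpha> (inv b) (\<alpha> b x) \<in> \<alpha> (inv b) ` closure ?S" using cl by blast
    then show False using that B(4)[OF \<open>b \<in> B\<close>] bG by auto
  qed
  ultimately show ?case using Suc U(2)[of n b x] by auto
qed simp

text \<open>A boundary point of the \<open>n\<close>-th greedy set is, up to translation by an element of \<open>B\<close>, either
  a boundary point of some \<open>U i\<close> or a boundary point of an earlier greedy set.\<close>

lemma closure_greedy_marker:
  assumes "n \<le> N" "y \<in> closure (greedy_marker B U n)"
    and "\<And>g i. g \<in> word_ball G B n \<Longrightarrow> i < N \<Longrightarrow> \<alpha> g y \<notin> L i"
  shows "y \<in> greedy_marker B U n"
  using assms
proof (induction n arbitrary: y)
  case (Suc n)
  let ?S = "greedy_marker B U n"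
  let ?W = "U n - (\<Union>b\<in>B. \<alpha> b ` closure ?S)"
  have IH: "z \<in> ?S" if "z \<in> closure ?S" "\<And>g i. g \<in> word_ball G B n \<Longrightarrow> i < N \<Longrightarrow> \<alpha> g z \<notin> L i" for z
    using Suc.IH that Suc.prems(1) by simp
  show ?case
  proof (cases "y \<in> closure ?S")
    case True
    then have "y \<in> ?S" using Suc.prems(3) by (intro IH) auto
    then show ?thesis by simp
  next
    case False
    then have W: "y \<in> closure ?W" using Suc.prems(2) by (simp add: closure_Un)
    then have "y \<in> closure (U n)" using closure_mono[of ?W "U n"] by blast
    moreover have "y \<notin> L n"
      using Suc.prems(3)[of \<one> n] Suc.prems(1) one_in_word_ball[of G B "Suc n"] by (simp del: word_ball.simps)
    ultimately have "y \<in> U n" using L[of n] Suc.prems(1) by auto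
    show ?thesis
    proof (rule ccontr)
      assume "y \<notin> greedy_marker B U (Suc n)"
      then obtain b z where b: "b \<in> B" "z \<in> closure ?S" "y = \<alpha> b z" using \<open>y \<in> U n\<close> by auto
      have bG: "b \<in> carrier G" using b B by auto
      have "z \<in> ?S"
      proof (rule IH[OF b(2)])
        fix g i assume g: "g \<in> word_ball G B n" "i < N"
        then have "g \<in> carrier G" using G.word_ball_subset[OF B(2)] by blast
        then have "\<alpha> g z = \<alpha> (g \<otimes> inv b) y" using bG b by (simp add: act_mult)
        moreover have "g \<otimes> inv b \<in> word_ball G B (Suc n)" using g B(4)[OF b(1)] by force
        ultimately show "\<alpha> g z \<notin> L i" using Suc.prems(3) g(2) by metis
      qed
      \<comment> \<open>An open translate of the earlier stage is a neighbourhood of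
        \<open>y\<close>, and \<open>y\<close> is in the closure of \<open>?W\<close>; but
        \<open>?W\<close> was formed by removing that translate.\<close>
      then have "y \<in> \<alpha> b ` ?S" using b by simp
      moreover have "open (\<alpha> b ` ?S)" using bG open_greedy_marker open_act_image by blast
      ultimately have "\<alpha> b ` ?S \<inter> ?W \<noteq> {}"
        using W open_Int_closure_eq_empty[of "\<alpha> b ` ?S" ?W] by (metis IntI empty_iff)
      then show False using closure_subset[of ?S] b(1) by blast
    qed
  qed
qed simp

text \<open>A point of \<open>U i\<close> is either taken by stage \<open>i + 1\<close> or equals
  \<open>\<alpha> b z\<close> with \<open>z\<close> in the closure of an earlier stage. In the
  second case \<open>z\<close> lies in the final set, because its orbit inherits from
  \<open>x\<close> the avoidance of the sets \<open>L i\<close>; so \<open>inv b\<close> moves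
  \<open>x\<close> into it. The translation by \<open>b\<close> is the reason for the radius
  \<open>Suc N\<close> in place of \<open>N\<close>.\<close>

lemma greedy_marker_covers:
  assumes "i < N" "x \<in> U i" "\<And>g i. g \<in> word_ball G B (Suc N) \<Longrightarrow> i < N \<Longrightarrow> \<alpha> g x \<notin> L i"
  shows "\<exists>b\<in>B. \<alpha> b x \<in> greedy_marker B U N"
proof (cases "x \<in> greedy_marker B U (Suc i)")
  case True
  then have "x \<in> greedy_marker B U N"
    using greedy_marker_mono[of "Suc i" N B U] assms(1) by (metis Suc_leI subsetD)
  then show ?thesis using B by (intro bexI[of _ \<one>]) auto
next
  case False
  then obtain b z where b: "b \<in> B" "z \<in> closure (greedy_marker B U i)" "x = \<alpha> b z" using assms by auto
  have sub: "greedy_marker B U i \<subseteq> greedy_marker B U N"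
    using assms by (intro greedy_marker_mono) auto
  have bG: "b \<in> carrier G" using b B by auto
  have "z \<in> greedy_marker B U N"
  proof (rule closure_greedy_marker)
    show "z \<in> closure (greedy_marker B U N)" using b(2) closure_mono[OF sub] by blast
    fix g i assume g: "g \<in> word_ball G B N" "i < N"
    then have "g \<in> carrier G" using G.word_ball_subset[OF B(2)] by blast
    then have "\<alpha> g z = \<alpha> (g \<otimes> inv b) x" using bG b by (simp add: act_mult)
    moreover have "g \<otimes> inv b \<in> word_ball G B (Suc N)" using g B(4)[OF b(1)] by force
    ultimately show "\<alpha> g z \<notin> L i" using assms(3) g(2) by metis
  qed simp
  then show ?thesis using b B(4) bG by (intro bexI[of _ "inv b"]) auto
qed



end

end

lemma free_action_displacement:
  fixes \<alpha> :: "'g \<Rightarrow> 'x::metric_space \<Rightarrow> 'x"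
  assumes act: "topological_action G \<alpha>" and free: "free_action G \<alpha>" and cpt: "compact (UNIV :: 'x set)"
    and B: "finite B" "B \<subseteq> carrier G"
  obtains r where "r > 0" "\<And>b x. b \<in> B \<Longrightarrow> b \<noteq> \<one>\<^bsub>G\<^esub> \<Longrightarrow> r \<le> dist (\<alpha> b x) x"
proof -
  interpret topological_action G \<alpha> by fact
  have "\<exists>c>0. \<forall>x. c \<le> dist (\<alpha> b x) x" if "b \<in> B - {\<one>\<^bsub>G\<^esub>}" for b
  proof (rule compact_positive_lower_bound[OF cpt, of "\<lambda>x. dist (\<alpha> b x) x"])
    show "continuous_on UNIV (\<lambda>x. dist (\<alpha> b x) x)"
      using that B by (intro continuous_intros continuous_on_act) auto
    show "dist (\<alpha> b x) x > 0" for x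
      using that B free unfolding free_action_def stabilizer_def by auto
  qed blast
  then obtain c where c: "\<And>b. b \<in> B - {\<one>\<^bsub>G\<^esub>} \<Longrightarrow> c b > 0 \<and> (\<forall>x. c b \<le> dist (\<alpha> b x) x)"
    by metis
  \<comment> \<open>The extra entry \<open>1\<close> provides a minimum when \<open>B\<close> has no
    element besides the identity.\<close>
  show ?thesis
    by (rule that[of "Min (insert 1 (c ` (B - {\<one>\<^bsub>G\<^esub>})))"]) (use c B in \<open>auto intro: Min_le order_trans simp: Min_le_iff\<close>)
qed

text \<open>Before the perturbation all \<open>d + 1\<close> covers are the same cover by small
  balls. Perturbing the defining functions makes the translates of each point avoid all boundaries
  for at least one \<open>k\<close>, and for this \<open>k\<close> a translate of the greedy set
  reaches the point. The necessary word length is known beforehand, since it depends only on the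
  number of balls.\<close>

lemma free_action_marker_sets:
  fixes \<alpha> :: "'g \<Rightarrow> 'x::metric_space \<Rightarrow> 'x"
  assumes act: "topological_action G \<alpha>" and free: "free_action G \<alpha>" and cpt: "compact (UNIV :: 'x set)"
    and dim: "covering_dim_le (euclidean :: 'x topology) d"
    and B: "finite B" "B \<subseteq> carrier G" "\<one>\<^bsub>G\<^esub> \<in> B" "\<And>b. b \<in> B \<Longrightarrow> inv\<^bsub>G\<^esub> b \<in> B"
  obtains Z where "\<And>k. open (Z k)"
    "\<And>k b x. b \<in> B \<Longrightarrow> b \<noteq> \<one>\<^bsub>G\<^esub> \<Longrightarrow> x \<in> Z k \<Longrightarrow> \<alpha> b x \<notin> Z k"
    "\<And>x. \<exists>k\<le>d. \<exists>b\<in>B. \<alpha> b x \<in> Z k"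
proof -
  interpret topological_action G \<alpha> by fact
  obtain r where r: "r > 0" "\<And>b x. b \<in> B \<Longrightarrow> b \<noteq> \<one>\<^bsub>G\<^esub> \<Longrightarrow> r \<le> dist (\<alpha> b x) x"
    using free_action_displacement[OF act free cpt B(1,2)] by blast
  obtain C :: "'x set" where C: "finite C" "UNIV \<subseteq> (\<Union>x\<in>C. ball x (r / 12))"
  proof (rule compactE_image[OF cpt, of UNIV "\<lambda>x. ball x (r / 12)"])
    show "UNIV \<subseteq> (\<Union>c\<in>UNIV. ball c (r / 12))" using r(1) by (auto intro: centre_in_ball[THEN iffD2])
  qed auto
  then obtain a :: "nat \<Rightarrow> 'x" and N where aN: "C = a ` {..<N}"
    by (metis finite_imp_nat_seg_image_inj_on lessThan_def)
  \<comment> \<open>The margins: on a ball of radius \<open>r / 12\<close> the unperturbed value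
    exceeds \<open>r / 12\<close>, so it stays positive; conversely a positive perturbed value
    forces the distance from the centre below \<open>r / 4\<close>, hence two points of one set are
    closer than the displacement \<open>r\<close>.\<close>
  obtain f where f: "\<And>k i. continuous_on UNIV (f k i)"
      "\<And>k i x. \<bar>f k i x - (r / 6 - dist x (a i))\<bar> < r / 12"
      "\<And>x. \<exists>k\<le>d. \<forall>\<gamma>\<in>\<alpha> ` word_ball G B (Suc N). \<forall>i\<in>{..<N}. f k i (\<gamma> x) \<noteq> (0::real)"
  proof (rule perturb_disjoint_zero_orbits[OF cpt dim, where \<epsilon> = "r / 12" and I = "{..<N}"
        and f = "\<lambda>k i x. r / 6 - dist x (a i)" and \<Gamma> = "\<alpha> ` word_ball G B (Suc N)"])
    show "finite (\<alpha> ` word_ball G B (Suc N))" using finite_word_ball[OF B(1)] by blast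
    show "\<exists>\<gamma>'. Elementary_Topology.homeomorphism UNIV UNIV \<gamma> \<gamma>'" if "\<gamma> \<in> \<alpha> ` word_ball G B (Suc N)" for \<gamma>
      using that G.word_ball_subset[OF B(2)] homeomorphism_act by blast
    show "continuous_on UNIV (\<lambda>x. r / 6 - dist x (a i))" for k :: nat and i
      by (intro continuous_intros)
    show "finite {..<N}" "r / 12 > 0" using r(1) by simp_all
  qed (rule that)
  define U where "U k i = {x. 0 < f k i x}" for k i
  have U_open: "open (U k i)" for k i
    unfolding U_def by (intro open_Collect_less continuous_intros f)
  have U_small: "\<alpha> b x \<notin> U k i" if "b \<in> B" "b \<noteq> \<one>\<^bsub>G\<^esub>" "x \<in> U k i" for k i b x
  proof
    have near: "dist y (a i) < r / 4" if "y \<in> U k i" for y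
      using f(2)[of k i y] that unfolding U_def mem_Collect_eq by linarith
    assume "\<alpha> b x \<in> U k i"
    from near[OF this] near[OF that(3)] have "dist (\<alpha> b x) x < r"
      using r(1) dist_triangle2[of "\<alpha> b x" x "a i"] by linarith
    then show False using r(2)[OF that(1,2), of x] by simp
  qed
  have U_closure: "closure (U k i) \<subseteq> U k i \<union> {x. f k i x = 0}" for k i
  proof -
    have "closure (U k i) \<subseteq> {x. 0 \<le> f k i x}"
      by (rule closure_minimal) (auto simp: U_def intro!: closed_Collect_le continuous_intros f)
    then show ?thesis by (force simp: U_def)
  qed
  note props = B U_open U_small U_closure
  show ?thesis
  proof (rule that[of "\<lambda>k. greedy_marker B (U k) N"])
    show "open (greedy_marker B (U k) N)" for k
      by (rule open_greedy_marker[where N = N]) (rule props; assumption?)+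
    show "\<alpha> b x \<notin> greedy_marker B (U k) N"
      if "b \<in> B" "b \<noteq> \<one>\<^bsub>G\<^esub>" "x \<in> greedy_marker B (U k) N" for k b x
      by (rule greedy_marker_disjoint[where N = N]) (use props that in auto)
    fix x
    obtain k where k: "k \<le> d" "\<And>g i. g \<in> word_ball G B (Suc N) \<Longrightarrow> i < N \<Longrightarrow> f k i (\<alpha> g x) \<noteq> 0"
      using f(3)[of x] by auto
    have "x \<in> (\<Union>c\<in>C. ball c (r / 12))" using C(2) by blast
    then obtain i where i: "i < N" "dist (a i) x < r / 12" by (auto simp: aN)
    have "x \<in> U k i"
      using f(2)[of k i x] i(2) unfolding U_def mem_Collect_eq dist_commute[of x] by linarith
    then have "\<exists>b\<in>B. \<alpha> b x \<in> greedy_marker B (U k) N"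
      using k(2) i(1)
      by (intro greedy_marker_covers[where L = "\<lambda>i. {x. f k i x = 0}" and i = i] props) auto
    then show "\<exists>k\<le>d. \<exists>b\<in>B. \<alpha> b x \<in> greedy_marker B (U k) N" using k(1) by blast
  qed
qed

section \<open>Polycyclic series\<close>

lemma (in normal) cyclic_FactGroup_iff:
  "cyclic_group (G Mod H) \<longleftrightarrow> (\<exists>t\<in>carrier G. \<forall>x\<in>carrier G. \<exists>n::int. x \<in> H #> t [^] n)"
proof -
  interpret Q: group "G Mod H" by (rule factorgroup_is_group)
  have repr: "x \<in> H #> t [^] n \<longleftrightarrow> H #> x = H #> t [^] n"
    if "x \<in> carrier G" "t \<in> carrier G" for x t and n :: int
    using that repr_independence[of x H "t [^] n"] rcos_self[OF _ is_subgroup, of x] is_subgroup by auto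
  show ?thesis
  proof
    assume "cyclic_group (G Mod H)"
    then obtain t where t: "t \<in> carrier G" "carrier (G Mod H) = range (\<lambda>n::int. (H #> t) [^]\<^bsub>G Mod H\<^esub> n)"
      unfolding Q.cyclic_group by (auto simp: carrier_FactGroup)
    have "\<exists>n::int. x \<in> H #> t [^] n" if "x \<in> carrier G" for x
    proof -
      have "H #> x \<in> carrier (G Mod H)" using that by (auto simp: carrier_FactGroup)
      then obtain n :: int where "H #> x = (H #> t) [^]\<^bsub>G Mod H\<^esub> n" using t by auto
      then show ?thesis using repr that t FactGroup_int_pow by auto
    qed
    then show "\<exists>t\<in>carrier G. \<forall>x\<in>carrier G. \<exists>n::int. x \<in> H #> t [^] n" using t by blast
  next
    assume "\<exists>t\<in>carrier G. \<forall>x\<in>carrier G. \<exists>n::int. x \<in> H #> t [^] n"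
    then obtain t where t: "t \<in> carrier G" "\<And>x. x \<in> carrier G \<Longrightarrow> \<exists>n::int. x \<in> H #> t [^] n" by blast
    have "H #> x \<in> range (\<lambda>n::int. H #> t [^] n)" if "x \<in> carrier G" for x
      using t(2)[OF that] repr[OF that t(1)] by auto
    then have "carrier (G Mod H) = range (\<lambda>n::int. H #> t [^] n)"
      using t(1) unfolding carrier_FactGroup by auto
    then show "cyclic_group (G Mod H)"
      unfolding Q.cyclic_group using t FactGroup_int_pow
      by (intro bexI[of _ "H #> t"]) (auto simp: carrier_FactGroup)
  qed
qed

lemma (in normal) finite_cyclic_FactGroup_iff:
  assumes t: "t \<in> carrier G" "\<And>x. x \<in> carrier G \<Longrightarrow> \<exists>n::int. x \<in> H #> t [^] n"
  shows "finite (carrier (G Mod H)) \<longleftrightarrow> (\<exists>m::int. m \<noteq> 0 \<and> t [^] m \<in> H)"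
proof
  assume fin: "finite (carrier (G Mod H))"
  have "range (\<lambda>n::int. H #> t [^] n) \<subseteq> carrier (G Mod H)"
    using t(1) by (auto simp: carrier_FactGroup)
  then have "\<not> inj (\<lambda>n::int. H #> t [^] n)"
    using fin finite_subset finite_imageD infinite_UNIV_int by blast
  then obtain i j :: int where ij: "i \<noteq> j" "H #> t [^] i = H #> t [^] j" by (auto simp: inj_on_def)
  then have "t [^] i \<in> H #> t [^] j" using rcos_self[OF _ is_subgroup, of "t [^] i"] t(1) by simp
  then have "t [^] i \<otimes> inv (t [^] j) \<in> H"
    using rcos_module_imp[OF is_group, of "t [^] j" "t [^] i"] t(1) by simp
  then show "\<exists>m::int. m \<noteq> 0 \<and> t [^] m \<in> H"
    using ij t(1) by (intro exI[of _ "i - j"]) (simp add: int_pow_diff)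
next
  assume "\<exists>m::int. m \<noteq> 0 \<and> t [^] m \<in> H"
  then obtain m :: int where m: "m \<noteq> 0" "t [^] m \<in> H" by blast
  have tm: "t [^] \<bar>m\<bar> \<in> H"
    using m(2) t(1) by (cases "m \<ge> 0") (auto simp: int_pow_neg)
  have "H #> t [^] n = H #> t [^] (n mod \<bar>m\<bar>)" for n :: int
  proof -
    have "t [^] n = (t [^] \<bar>m\<bar>) [^] (n div \<bar>m\<bar>) \<otimes> t [^] (n mod \<bar>m\<bar>)"
      using t(1) by (simp add: int_pow_pow flip: int_pow_mult)
    moreover have "(t [^] \<bar>m\<bar>) [^] (n div \<bar>m\<bar>) \<in> H"
      using subgroup_int_pow_closed[OF is_subgroup tm] .
    ultimately have "t [^] n \<in> H #> t [^] (n mod \<bar>m\<bar>)"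
      using t(1) by (auto simp: r_coset_def)
    then show ?thesis using repr_independence[OF _ _ is_subgroup] t(1) by simp
  qed
  moreover have "n mod \<bar>m\<bar> \<in> {0..<\<bar>m\<bar>}" for n using m(1) by simp
  ultimately have powers: "H #> t [^] n \<in> (\<lambda>n. H #> t [^] n) ` {0..<\<bar>m\<bar>}" for n :: int
    by (metis imageI)
  have "H #> x \<in> (\<lambda>n. H #> t [^] n) ` {0..<\<bar>m\<bar>}" if x: "x \<in> carrier G" for x
  proof -
    obtain n :: int where "x \<in> H #> t [^] n" using t(2)[OF x] by blast
    then show ?thesis using repr_independence[OF _ _ is_subgroup] t(1) powers by (metis int_pow_closed)
  qed
  then have "carrier (G Mod H) \<subseteq> (\<lambda>n. H #> t [^] n) ` {0..<\<bar>m\<bar>}"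
    unfolding carrier_FactGroup by blast
  then show "finite (carrier (G Mod H))" by (rule finite_subset) simp
qed

lemma (in normal) int_pow_in_coset:
  assumes "t \<in> carrier G" "x \<in> H #> t [^] (n::int)"
  shows "x [^] (m::int) \<in> H #> t [^] (n * m)"
proof -
  have x: "x \<in> carrier G" using assms r_coset_subset_G[OF subset, of "t [^] n"] by auto
  have "H #> x = H #> t [^] n"
    using repr_independence[OF assms(2) _ is_subgroup] assms(1) by simp
  then have "H #> x [^] m = H #> (t [^] n) [^] m"
    using FactGroup_int_pow x assms(1) by (metis int_pow_closed)
  then show ?thesis
    using rcos_self[OF _ is_subgroup, of "x [^] m"] x assms(1) by (simp add: int_pow_pow)
qed

text \<open>An element-wise form of a cyclic factor with a chosen generator. Homomorphisms carry it
  along directly, and finiteness of the factor becomes the condition that a nonzero power of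
  \<open>t\<close> lies in \<open>K\<close>.\<close>

definition cyclic_extension :: "('g, 'm) monoid_scheme \<Rightarrow> 'g set \<Rightarrow> 'g set \<Rightarrow> 'g \<Rightarrow> bool" where
  "cyclic_extension G K H t \<longleftrightarrow> subgroup H G \<and> K \<lhd> G\<lparr>carrier := H\<rparr> \<and> t \<in> H \<and>
     (\<forall>x\<in>H. \<exists>n::int. x \<in> K #>\<^bsub>G\<^esub> t [^]\<^bsub>G\<^esub> n)"

context group
begin

lemma cyclic_extension_iff:
  assumes "subgroup H G" "K \<lhd> G\<lparr>carrier := H\<rparr>"
  shows "cyclic_group (G\<lparr>carrier := H\<rparr> Mod K) \<longleftrightarrow> (\<exists>t. cyclic_extension G K H t)"
  using normal.cyclic_FactGroup_iff[OF assms(2)] assms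
  by (auto simp: cyclic_extension_def r_coset_def simp flip: int_pow_consistent)

lemma cyclic_extension_finite_iff:
  assumes "cyclic_extension G K H t"
  shows "finite (carrier (G\<lparr>carrier := H\<rparr> Mod K)) \<longleftrightarrow> (\<exists>m::int. m \<noteq> 0 \<and> t [^] m \<in> K)"
  using normal.finite_cyclic_FactGroup_iff[of K "G\<lparr>carrier := H\<rparr>" t] assms
  by (auto simp: cyclic_extension_def r_coset_def simp flip: int_pow_consistent)

lemma cyclic_extension_imp_cyclic:
  assumes "cyclic_extension G K H t"
  shows "subgroup H G" "K \<lhd> G\<lparr>carrier := H\<rparr>" "cyclic_group (G\<lparr>carrier := H\<rparr> Mod K)"
proof -
  show *: "subgroup H G" "K \<lhd> G\<lparr>carrier := H\<rparr>" using assms by (simp_all add: cyclic_extension_def)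
  show "cyclic_group (G\<lparr>carrier := H\<rparr> Mod K)"
    unfolding cyclic_extension_iff[OF *] using assms by blast
qed

lemma polycyclic_series_finite:
  assumes "polycyclic_series G K n" "cyclic_extension G K H t" "m \<noteq> 0" "t [^] (m::int) \<in> K"
  shows "polycyclic_series G H n"
proof (rule polycyclic_series.finite_factor[OF assms(1) cyclic_extension_imp_cyclic[OF assms(2)]])
  show "finite (carrier (G\<lparr>carrier := H\<rparr> Mod K))"
    unfolding cyclic_extension_finite_iff[OF assms(2)] using assms by blast
qed

lemma polycyclic_series_extend:
  assumes "polycyclic_series G K n" "cyclic_extension G K H t"
  shows "\<exists>n'\<le>Suc n. polycyclic_series G H n'"
proof (cases "finite (carrier (G\<lparr>carrier := H\<rparr> Mod K))")
  case True
  from polycyclic_series.finite_factor[OF assms(1) cyclic_extension_imp_cyclic[OF assms(2)] this]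
  show ?thesis by (intro exI[of _ n]) simp
next
  case False
  from polycyclic_series.infinite_factor[OF assms(1) cyclic_extension_imp_cyclic[OF assms(2)] this]
  show ?thesis by (intro exI[of _ "Suc n"]) simp
qed

lemma polycyclic_series_induct [consumes 1, case_names trivial finite infinite]:
  assumes "polycyclic_series G H n"
    and "P {\<one>} 0"
    and "\<And>K H t n m. polycyclic_series G K n \<Longrightarrow> P K n \<Longrightarrow> cyclic_extension G K H t \<Longrightarrow>
      m \<noteq> 0 \<Longrightarrow> t [^] (m::int) \<in> K \<Longrightarrow> P H n"
    and "\<And>K H t n. polycyclic_series G K n \<Longrightarrow> P K n \<Longrightarrow> cyclic_extension G K H t \<Longrightarrow>
      (\<And>m::int. t [^] m \<in> K \<Longrightarrow> m = 0) \<Longrightarrow> P H (Suc n)"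
  shows "P H n"
  using assms(1)
proof induction
  case (finite_factor K n H)
  obtain t where t: "cyclic_extension G K H t"
    using finite_factor.hyps(4) unfolding cyclic_extension_iff[OF finite_factor.hyps(2,3)] ..
  obtain m :: int where "m \<noteq> 0" "t [^] m \<in> K"
    using finite_factor.hyps(5) unfolding cyclic_extension_finite_iff[OF t] by blast
  with assms(3)[OF finite_factor.hyps(1) finite_factor.IH t] show ?case by blast
next
  case (infinite_factor K n H)
  obtain t where t: "cyclic_extension G K H t"
    using infinite_factor.hyps(4) unfolding cyclic_extension_iff[OF infinite_factor.hyps(2,3)] ..
  have "\<And>m::int. t [^] m \<in> K \<Longrightarrow> m = 0"
    using infinite_factor.hyps(5) unfolding cyclic_extension_finite_iff[OF t] by blast
  with assms(4)[OF infinite_factor.hyps(1) infinite_factor.IH t] show ?case by blast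
qed (fact assms(2))

lemma cyclic_extensionD:
  assumes "cyclic_extension G K H t"
  shows "subgroup H G" "subgroup K G" "K \<subseteq> H" "t \<in> H" "t \<in> carrier G"
    "\<And>x. x \<in> H \<Longrightarrow> \<exists>n::int. x \<in> K #> t [^] n"
    "\<And>h k. h \<in> H \<Longrightarrow> k \<in> K \<Longrightarrow> h \<otimes> k \<otimes> inv h \<in> K"
proof -
  show H: "subgroup H G" and t: "t \<in> H" and "\<And>x. x \<in> H \<Longrightarrow> \<exists>n::int. x \<in> K #> t [^] n"
    using assms by (auto simp: cyclic_extension_def)
  interpret H: group "G\<lparr>carrier := H\<rparr>" using subgroup_imp_group[OF H] .
  interpret K: normal K "G\<lparr>carrier := H\<rparr>" using assms by (simp add: cyclic_extension_def)
  show "subgroup K G" using K.is_subgroup H by (rule incl_subgroup[rotated])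
  show "K \<subseteq> H" using K.subset by simp
  show "t \<in> carrier G" using t subgroup.subset[OF H] by blast
  show "h \<otimes> k \<otimes> inv h \<in> K" if "h \<in> H" "k \<in> K" for h k
    using K.inv_op_closed2[of h k] that H by simp
qed

lemma cyclic_extensionI:
  assumes "subgroup H G" "subgroup K G" "K \<subseteq> H" "t \<in> H" "\<And>x. x \<in> H \<Longrightarrow> \<exists>n::int. x \<in> K #> t [^] n"
    "\<And>h k. h \<in> H \<Longrightarrow> k \<in> K \<Longrightarrow> h \<otimes> k \<otimes> inv h \<in> K"
  shows "cyclic_extension G K H t"
proof -
  have "K \<lhd> G\<lparr>carrier := H\<rparr>"
    using assms subgroup_incl[OF assms(2,1,3)]
    by (intro group.normal_invI subgroup_imp_group) auto
  then show ?thesis using assms by (simp add: cyclic_extension_def)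
qed

lemma cyclic_extension_int_pow:
  assumes "cyclic_extension G K H t" "x \<in> K #> t [^] (n::int)"
  shows "x [^] (m::int) \<in> K #> t [^] (n * m)"
proof -
  note E = cyclic_extensionD[OF assms(1)]
  obtain k where k: "k \<in> K" "x = k \<otimes> t [^] n" using assms(2) by (auto simp: r_coset_def)
  have "x \<in> H"
    unfolding k using subgroup.m_closed[OF E(1)] subgroup_int_pow_closed[OF E(1,4)] E(3) k(1) by blast
  then show ?thesis
    using normal.int_pow_in_coset[of K "G\<lparr>carrier := H\<rparr>" t x n m] assms E
    by (simp add: cyclic_extension_def r_coset_def flip: int_pow_consistent)
qed

text \<open>As \<open>H\<close> consists of finitely many cosets of \<open>K\<close>, it suffices to
  look at each of them; a coset that meets \<open>L\<close> in \<open>y\<close> meets it inside the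
  translate of \<open>K \<inter> L\<close> by \<open>y\<close>.\<close>

lemma finite_extension_Int:
  assumes ext: "cyclic_extension G K H t" and m: "m \<noteq> 0" "t [^] (m::int) \<in> K"
    and L: "subgroup L G" "finite (K \<inter> L)"
  shows "finite (H \<inter> L)"
proof -
  note E = cyclic_extensionD[OF ext]
  interpret H: group "G\<lparr>carrier := H\<rparr>" using subgroup_imp_group[OF E(1)] .
  let ?C = "carrier (G\<lparr>carrier := H\<rparr> Mod K)"
  have C: "?C = (\<lambda>x. K #> x) ` H" by (auto simp: carrier_FactGroup r_coset_def)
  have "finite ?C" using cyclic_extension_finite_iff[OF ext] m by blast
  moreover have "finite (Y \<inter> L)" if Y: "Y \<in> ?C" for Y
  proof (cases "Y \<inter> L = {}")
    case False
    then obtain y where y: "y \<in> Y" "y \<in> L" by blast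
    obtain x where x: "x \<in> H" "Y = K #> x" using Y C by blast
    have xG: "x \<in> carrier G" and yG: "y \<in> carrier G"
      using x E(1) y L(1) subgroup.mem_carrier by metis+
    have Ky: "Y = K #> y" using repr_independence[OF _ xG E(2), of y] y x by simp
    have "Y \<inter> L \<subseteq> (\<lambda>k. k \<otimes> y) ` (K \<inter> L)"
    proof
      fix z assume z: "z \<in> Y \<inter> L"
      then obtain k where k: "k \<in> K" "z = k \<otimes> y" unfolding Ky r_coset_def by blast
      then have "k = z \<otimes> inv y" using yG subgroup.mem_carrier[OF E(2) k(1)] by (simp add: m_assoc)
      then have "k \<in> L"
        using z y subgroup.m_closed[OF L(1)] subgroup.m_inv_closed[OF L(1)] by simp
      then show "z \<in> (\<lambda>k. k \<otimes> y) ` (K \<inter> L)" using k by blast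
    qed
    then show ?thesis using L(2) finite_subset by blast
  qed simp
  ultimately have "finite (\<Union>Y\<in>?C. Y \<inter> L)" by blast
  moreover have "H \<inter> L \<subseteq> (\<Union>Y\<in>?C. Y \<inter> L)"
    using rcos_self[OF _ E(2)] subgroup.mem_carrier[OF E(1)] unfolding C by blast
  ultimately show ?thesis using finite_subset by blast
qed

text \<open>Going up the series, the intersection with \<open>L\<close> starts finite and ends
  infinite, and finite factors cannot bring the change about. At the infinite factor where it
  happens, some element of \<open>L\<close> has a nonzero class in an infinite cyclic group.\<close>

lemma infinite_order_element:
  assumes "polycyclic_series G H n" "subgroup L G" "infinite (H \<inter> L)"
  obtains x where "x \<in> L" "\<And>m::int. x [^] m = \<one> \<Longrightarrow> m = 0"
proof -
  have "\<exists>x\<in>L. \<forall>m::int. x [^] m = \<one> \<longrightarrow> m = 0"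
    using assms(1,3)
  proof (induction rule: polycyclic_series_induct)
    case trivial
    then show ?case by simp
  next
    case (finite K H t n m)
    then show ?case using finite_extension_Int[OF finite.hyps(2,3,4) assms(2)] by blast
  next
    case (infinite K H t n)
    note E = cyclic_extensionD[OF infinite.hyps(2)]
    show ?case
    proof (cases "finite (K \<inter> L)")
      case True
      then have "\<not> H \<inter> L \<subseteq> K \<inter> L" using infinite.prems finite_subset by blast
      then obtain x where x: "x \<in> H" "x \<in> L" "x \<notin> K" by blast
      obtain n :: int where n: "x \<in> K #> t [^] n" using E(6) x by blast
      have "n \<noteq> 0" using x(3) n subgroup.subset[OF E(2)] by (auto simp: coset_mult_one)
      have "m = 0" if "x [^] m = \<one>" for m :: int
      proof -
        have "\<one> \<in> K #> t [^] (n * m)" using cyclic_extension_int_pow[OF infinite.hyps(2) n, of m] that by simp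
        then have "\<one> \<otimes> inv (t [^] (n * m)) \<in> K"
          using subgroup.rcos_module_imp[OF E(2) is_group int_pow_closed[OF E(5)]] by blast
        then have "t [^] (- (n * m)) \<in> K" using E(5) by (simp add: int_pow_neg)
        from infinite.hyps(3)[OF this] show ?thesis using \<open>n \<noteq> 0\<close> by simp
      qed
      then show ?thesis using x by blast
    qed (use infinite in blast)
  qed
  then show ?thesis using that by blast
qed

end

lemma (in group_hom) cyclic_extension_image:
  assumes "cyclic_extension G K K' t"
  shows "cyclic_extension H (h ` K) (h ` K') (h t)"
proof -
  note E = G.cyclic_extensionD[OF assms]
  show ?thesis
  proof (rule H.cyclic_extensionI)
    show "subgroup (h ` K') H" "subgroup (h ` K) H" using E(1,2) subgroup_img_is_subgroup by auto
    show "h ` K \<subseteq> h ` K'" "h t \<in> h ` K'" using E by auto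
    have sub: "K \<subseteq> carrier G" "K' \<subseteq> carrier G" using E(1,2) subgroup.subset by auto
    show "\<exists>n::int. y \<in> h ` K #>\<^bsub>H\<^esub> h t [^]\<^bsub>H\<^esub> n" if y: "y \<in> h ` K'" for y
    proof -
      obtain x where x: "x \<in> K'" "y = h x" using y by blast
      obtain n :: int where "x \<in> K #> t [^] n" using E(6) x by blast
      then obtain k where "k \<in> K" "x = k \<otimes> t [^] n" by (auto simp: r_coset_def)
      then have "y = h k \<otimes>\<^bsub>H\<^esub> h t [^]\<^bsub>H\<^esub> n" using x sub E(5) by (auto simp: hom_int_pow)
      then show ?thesis using \<open>k \<in> K\<close> by (auto simp: r_coset_def)
    qed
    show "x \<otimes>\<^bsub>H\<^esub> k \<otimes>\<^bsub>H\<^esub> inv\<^bsub>H\<^esub> x \<in> h ` K" if xk: "x \<in> h ` K'" "k \<in> h ` K" for x k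
    proof -
      obtain y l where "y \<in> K'" "x = h y" "l \<in> K" "k = h l" using xk by blast
      then show ?thesis using E(7)[of y l] sub
        by (auto simp: subset_iff intro!: image_eqI[of _ h "y \<otimes> l \<otimes> inv y"])
    qed
  qed
qed

text \<open>Each factor of the image series is a quotient of the original factor, so no infinite
  factor is created. Where the intersection with the kernel becomes infinite, the factor is infinite
  and contains the class of a kernel element outside \<open>K\<close>; as this element maps to the
  identity, the image factor is finite, which is the strict drop.\<close>

lemma (in group_hom) polycyclic_series_image:
  assumes "polycyclic_series G K n"
  shows "\<exists>n'\<le>n. polycyclic_series H (h ` K) n' \<and> (infinite (K \<inter> kernel G H h) \<longrightarrow> n' < n)"
  using assms
proof (induction rule: G.polycyclic_series_induct)
  case trivial
  then show ?case using polycyclic_series.trivial[of H] by auto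
next
  case (finite K K' t n m)
  note E = G.cyclic_extensionD[OF finite.hyps(2)]
  obtain n' where n': "n' \<le> n" "polycyclic_series H (h ` K) n'" "infinite (K \<inter> kernel G H h) \<longrightarrow> n' < n"
    using finite.IH by blast
  have "h t [^]\<^bsub>H\<^esub> m \<in> h ` K" using finite.hyps(4) E(5) by (auto simp flip: hom_int_pow)
  then have "polycyclic_series H (h ` K') n'"
    by (rule H.polycyclic_series_finite[OF n'(2) cyclic_extension_image[OF finite.hyps(2)] finite.hyps(3)])
  moreover have "infinite (K \<inter> kernel G H h)" if "infinite (K' \<inter> kernel G H h)"
    using G.finite_extension_Int[OF finite.hyps(2,3,4) subgroup_kernel] that by blast
  ultimately show ?case using n' by blast
next
  case (infinite K K' t n)
  note E = G.cyclic_extensionD[OF infinite.hyps(2)]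
  note ext = cyclic_extension_image[OF infinite.hyps(2)]
  obtain n' where n': "n' \<le> n" "polycyclic_series H (h ` K) n'" "infinite (K \<inter> kernel G H h) \<longrightarrow> n' < n"
    using infinite.IH by blast
  show ?case
  proof (cases "infinite (K' \<inter> kernel G H h) \<and> finite (K \<inter> kernel G H h)")
    case False
    obtain n'' where "n'' \<le> Suc n'" "polycyclic_series H (h ` K') n''"
      using H.polycyclic_series_extend[OF n'(2) ext] by blast
    then show ?thesis using n' False by (intro exI[of _ n'']) auto
  next
    case True
    then have "\<not> K' \<inter> kernel G H h \<subseteq> K \<inter> kernel G H h" using finite_subset by blast
    then obtain x where x: "x \<in> K'" "x \<notin> K" "x \<in> carrier G" "h x = \<one>\<^bsub>H\<^esub>" by (auto simp: kernel_def)
    obtain m :: int where "x \<in> K #> t [^] m" using E(6) x by blast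
    then obtain k where k: "k \<in> K" "x = k \<otimes> t [^] m" by (auto simp: r_coset_def)
    have kG: "k \<in> carrier G" using subgroup.mem_carrier[OF E(2) k(1)] .
    have "m \<noteq> 0" using k x(2) kG by (intro notI) simp
    have "h k \<otimes>\<^bsub>H\<^esub> h t [^]\<^bsub>H\<^esub> m = \<one>\<^bsub>H\<^esub>" using x k kG E(5) by (simp add: hom_int_pow)
    then have "h t [^]\<^bsub>H\<^esub> m = inv\<^bsub>H\<^esub> (h k)" using kG E(5) by (metis H.inv_equality H.inv_inv H.int_pow_closed hom_closed)
    then have "h t [^]\<^bsub>H\<^esub> m = h (inv k)" using kG by simp
    then have "h t [^]\<^bsub>H\<^esub> m \<in> h ` K" using subgroup.m_inv_closed[OF E(2) k(1)] by simp
    then have "polycyclic_series H (h ` K') n'"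
      using H.polycyclic_series_finite[OF n'(2) ext \<open>m \<noteq> 0\<close>] by blast
    then show ?thesis using n'(1) by (intro exI[of _ n']) auto
  qed
qed

section \<open>The lower central series of a finitely generated nilpotent group\<close>

lemma subset_generate: "S \<subseteq> generate G S"
  by (rule subsetI) (rule generate.incl)

lemma (in group) inv_mult_cancel_left:
  "x \<in> carrier G \<Longrightarrow> y \<in> carrier G \<Longrightarrow> inv x \<otimes> (x \<otimes> y) = y"
  "x \<in> carrier G \<Longrightarrow> y \<in> carrier G \<Longrightarrow> x \<otimes> (inv x \<otimes> y) = y"
  by (simp_all flip: m_assoc)

lemma (in group) lower_central_series_normal: "lower_central_series G i \<lhd> G"
proof (induction i)
  case 0
  then show ?case using normal_self by simp
next
  case (Suc i)
  interpret N: normal "lower_central_series G i" G by (rule Suc)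
  let ?S = "\<Union>h\<in>lower_central_series G i. \<Union>k\<in>carrier G. {h \<otimes> k \<otimes> inv h \<otimes> inv k}"
  have "generate G ?S \<lhd> G"
  proof (rule normal_generateI)
    show "?S \<subseteq> carrier G" by auto
    fix c g assume "c \<in> ?S" and g: "g \<in> carrier G"
    then obtain h k where hk: "h \<in> lower_central_series G i" "k \<in> carrier G" "c = h \<otimes> k \<otimes> inv h \<otimes> inv k"
      by blast
    have h: "h \<in> carrier G" using hk by simp
    define h' k' where "h' = g \<otimes> h \<otimes> inv g" and "k' = g \<otimes> k \<otimes> inv g"
    have "h' \<in> lower_central_series G i" "k' \<in> carrier G"
      using hk g N.inv_op_closed2 by (auto simp: h'_def k'_def)
    moreover have "g \<otimes> c \<otimes> inv g = h' \<otimes> k' \<otimes> inv h' \<otimes> inv k'"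
      using g h hk(2) by (simp add: hk(3) h'_def k'_def inv_mult_group m_assoc inv_mult_cancel_left)
    ultimately show "g \<otimes> c \<otimes> inv g \<in> ?S" by blast
  qed
  then show ?case by simp
qed

lemma (in group) lower_central_series_subgroup: "subgroup (lower_central_series G i) G"
  using lower_central_series_normal normal_imp_subgroup by blast

lemma (in group) lower_central_series_carrier: "x \<in> lower_central_series G i \<Longrightarrow> x \<in> carrier G"
  using subgroup.mem_carrier[OF lower_central_series_subgroup] .

lemma (in group) commutator_in_lower_central_series:
  assumes "h \<in> lower_central_series G i" "k \<in> carrier G"
  shows "h \<otimes> k \<otimes> inv h \<otimes> inv k \<in> lower_central_series G (Suc i)"
  using assms by (auto intro: generate.incl)

lemma (in group) lower_central_series_Suc_subset:
  "lower_central_series G (Suc i) \<subseteq> lower_central_series G i"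
proof -
  interpret N: normal "lower_central_series G i" G by (rule lower_central_series_normal)
  have "h \<otimes> k \<otimes> inv h \<otimes> inv k \<in> lower_central_series G i"
    if hk: "h \<in> lower_central_series G i" "k \<in> carrier G" for h k
  proof -
    have "h \<otimes> (k \<otimes> inv h \<otimes> inv k) \<in> lower_central_series G i"
      using N.m_closed[OF hk(1) N.inv_op_closed2[OF hk(2) N.m_inv_closed[OF hk(1)]]] .
    then show ?thesis using hk by (simp add: m_assoc)
  qed
  then show ?thesis
    unfolding lower_central_series.simps(2)
    by (intro generate_subgroup_incl N.is_subgroup) blast
qed

lemma (in group_hom) lower_central_series_image:
  assumes "h ` carrier G = carrier H"
  shows "lower_central_series H i = h ` lower_central_series G i"
proof (induction i)
  case (Suc i)
  have carr: "x \<in> carrier G" if "x \<in> lower_central_series G i" for x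
    using that by (rule G.lower_central_series_carrier)
  let ?S = "\<Union>x\<in>lower_central_series G i. \<Union>k\<in>carrier G. {x \<otimes> k \<otimes> inv x \<otimes> inv k}"
  have img: "(\<Union>x\<in>lower_central_series H i. \<Union>k\<in>carrier H. {x \<otimes>\<^bsub>H\<^esub> k \<otimes>\<^bsub>H\<^esub> inv\<^bsub>H\<^esub> x \<otimes>\<^bsub>H\<^esub> inv\<^bsub>H\<^esub> k}) = h ` ?S"
    (is "?T = _")
  proof -
    have "?T = (\<Union>x\<in>lower_central_series G i. \<Union>k\<in>carrier G.
        {h x \<otimes>\<^bsub>H\<^esub> h k \<otimes>\<^bsub>H\<^esub> inv\<^bsub>H\<^esub> h x \<otimes>\<^bsub>H\<^esub> inv\<^bsub>H\<^esub> h k})"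
      unfolding Suc.IH assms[symmetric] by (simp only: UN_simps)
    also have "\<dots> = (\<Union>x\<in>lower_central_series G i. \<Union>k\<in>carrier G. {h (x \<otimes> k \<otimes> inv x \<otimes> inv k)})"
      by (intro SUP_cong refl) (simp add: carr)
    also have "\<dots> = h ` ?S" by (simp only: image_UN image_insert image_empty)
    finally show ?thesis .
  qed
  have "?S \<subseteq> carrier G" using carr by auto
  show ?case
    unfolding lower_central_series.simps(2) img by (rule generate_img[OF \<open>?S \<subseteq> carrier G\<close>])
qed (simp add: assms)

lemma (in group_hom) nilpotent_group_image:
  assumes "h ` carrier G = carrier H" "nilpotent_group G"
  shows "nilpotent_group H"
proof -
  obtain n where "lower_central_series G n = {\<one>}"
    using assms(2) unfolding nilpotent_group_def by blast
  then have "lower_central_series H n = {\<one>\<^bsub>H\<^esub>}"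
    unfolding lower_central_series_image[OF assms(1)] by simp
  then show ?thesis using H.is_group unfolding nilpotent_group_def by blast
qed

context group
begin

text \<open>In the quotient by \<open>L\<close> the elements of \<open>S\<close> commute with
  generators of \<open>G\<close>, hence with \<open>G\<close>, and so does the subgroup they
  generate. The two inductions spell this out with identities such as
  \<open>[ab, k] = (a [b, k] a^-1) [a, k]\<close>, where normality of \<open>L\<close> absorbs the
  conjugation.\<close>

lemma commutator_closure:
  assumes L: "L \<lhd> G" and S: "S \<subseteq> carrier G" and T: "generate G T = carrier G" "T \<subseteq> carrier G"
    and ST: "\<And>s t. s \<in> S \<Longrightarrow> t \<in> T \<Longrightarrow> s \<otimes> t \<otimes> inv s \<otimes> inv t \<in> L"
    and h: "h \<in> generate G S" and k: "k \<in> carrier G"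
  shows "h \<otimes> k \<otimes> inv h \<otimes> inv k \<in> L"
proof -
  interpret L: normal L G by fact
  have left: "s \<otimes> k \<otimes> inv s \<otimes> inv k \<in> L" if s: "s \<in> S" and k: "k \<in> generate G T" for s k
    using k
  proof (induction rule: generate.induct)
    case one
    then show ?case using s S by auto
  next
    case (incl t)
    then show ?case using ST s by blast
  next
    case (inv t)
    have c: "s \<in> carrier G" "t \<in> carrier G" using s S inv T by auto
    have "inv t \<otimes> inv (s \<otimes> t \<otimes> inv s \<otimes> inv t) \<otimes> t \<in> L"
      by (rule L.inv_op_closed1[OF c(2) L.m_inv_closed[OF ST[OF s inv]]])
    moreover have "inv t \<otimes> inv (s \<otimes> t \<otimes> inv s \<otimes> inv t) \<otimes> t = s \<otimes> inv t \<otimes> inv s \<otimes> inv (inv t)"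
      using c by (simp add: inv_mult_group m_assoc inv_mult_cancel_left)
    ultimately show ?case by simp
  next
    case (eng a b)
    have c: "s \<in> carrier G" "a \<in> carrier G" "b \<in> carrier G"
      using s S eng generate_in_carrier[OF T(2)] by auto
    have "(s \<otimes> a \<otimes> inv s \<otimes> inv a) \<otimes> (a \<otimes> (s \<otimes> b \<otimes> inv s \<otimes> inv b) \<otimes> inv a) \<in> L"
      by (rule L.m_closed[OF eng.IH(1) L.inv_op_closed2[OF c(2) eng.IH(2)]])
    moreover have "(s \<otimes> a \<otimes> inv s \<otimes> inv a) \<otimes> (a \<otimes> (s \<otimes> b \<otimes> inv s \<otimes> inv b) \<otimes> inv a)
        = s \<otimes> (a \<otimes> b) \<otimes> inv s \<otimes> inv (a \<otimes> b)"
      using c by (simp add: inv_mult_group m_assoc inv_mult_cancel_left)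
    ultimately show ?case by simp
  qed
  show ?thesis
    using h
  proof (induction rule: generate.induct)
    case one
    then show ?case using k by auto
  next
    case (incl s)
    then show ?case using left T k by simp
  next
    case (inv s)
    have c: "s \<in> carrier G" using S inv by auto
    have "s \<otimes> k \<otimes> inv s \<otimes> inv k \<in> L" using left[OF inv] k T by simp
    then have "inv s \<otimes> inv (s \<otimes> k \<otimes> inv s \<otimes> inv k) \<otimes> s \<in> L"
      by (rule L.inv_op_closed1[OF c L.m_inv_closed])
    moreover have "inv s \<otimes> inv (s \<otimes> k \<otimes> inv s \<otimes> inv k) \<otimes> s = inv s \<otimes> k \<otimes> inv (inv s) \<otimes> inv k"
      using c k by (simp add: inv_mult_group m_assoc inv_mult_cancel_left)
    ultimately show ?case by simp
  next
    case (eng a b)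
    have c: "a \<in> carrier G" "b \<in> carrier G"
      using eng generate_in_carrier[OF S] by auto
    have "(a \<otimes> (b \<otimes> k \<otimes> inv b \<otimes> inv k) \<otimes> inv a) \<otimes> (a \<otimes> k \<otimes> inv a \<otimes> inv k) \<in> L"
      by (rule L.m_closed[OF L.inv_op_closed2[OF c(1) eng.IH(2)] eng.IH(1)])
    moreover have "(a \<otimes> (b \<otimes> k \<otimes> inv b \<otimes> inv k) \<otimes> inv a) \<otimes> (a \<otimes> k \<otimes> inv a \<otimes> inv k)
        = a \<otimes> b \<otimes> k \<otimes> inv (a \<otimes> b) \<otimes> inv k"
      using c k by (simp add: inv_mult_group m_assoc inv_mult_cancel_left)
    ultimately show ?case by simp
  qed
qed

text \<open>Conjugates are recovered from commutators by
  \<open>g a g^-1 = [a, g]^-1 a\<close>.\<close>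

lemma normal_if_commutators:
  assumes "subgroup L G" "\<And>g a. g \<in> carrier G \<Longrightarrow> a \<in> L \<Longrightarrow> a \<otimes> g \<otimes> inv a \<otimes> inv g \<in> L"
  shows "L \<lhd> G"
proof (rule normal_invI[OF assms(1)])
  fix g a assume g: "g \<in> carrier G" and a: "a \<in> L"
  have aG: "a \<in> carrier G" using subgroup.mem_carrier[OF assms(1) a] .
  have "inv (a \<otimes> g \<otimes> inv a \<otimes> inv g) \<otimes> a \<in> L"
    using assms(2)[OF g a] a subgroup.m_closed[OF assms(1)] subgroup.m_inv_closed[OF assms(1)] by blast
  moreover have "inv (a \<otimes> g \<otimes> inv a \<otimes> inv g) \<otimes> a = g \<otimes> a \<otimes> inv g"
    using g aG by (simp add: inv_mult_group m_assoc)
  ultimately show "g \<otimes> a \<otimes> inv g \<in> L" by simp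
qed

text \<open>Modulo term \<open>i + 2\<close>, term \<open>i + 1\<close> is generated by the
  commutators of generators of term \<open>i\<close> modulo term \<open>i + 1\<close> with
  generators of \<open>G\<close>. The subgroup \<open>L\<close> spanned by these commutators and
  term \<open>i + 2\<close> is normal, since commutators of its elements with \<open>G\<close>
  already lie in term \<open>i + 2\<close>; this makes \<open>commutator_closure\<close>
  applicable.\<close>

lemma lower_central_series_finitely_generated:
  assumes T: "finite T" "T \<subseteq> carrier G" "generate G T = carrier G"
  shows "\<exists>S. finite S \<and> S \<subseteq> lower_central_series G i \<and>
    lower_central_series G i = generate G (S \<union> lower_central_series G (Suc i))"
proof (induction i)
  case 0
  have "generate G (T \<union> lower_central_series G (Suc 0)) = carrier G"
  proof
    have "T \<union> lower_central_series G (Suc 0) \<subseteq> carrier G"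
      using T(2) lower_central_series_carrier[of _ "Suc 0"] by blast
    then show "generate G (T \<union> lower_central_series G (Suc 0)) \<subseteq> carrier G" by (rule generate_incl)
    show "carrier G \<subseteq> generate G (T \<union> lower_central_series G (Suc 0))"
      unfolding T(3)[symmetric] by (rule mono_generate) simp
  qed
  then show ?case using T by (intro exI[of _ T]) simp
next
  case (Suc i)
  let ?\<gamma> = "lower_central_series G"
  obtain S where S: "finite S" "S \<subseteq> ?\<gamma> i" "?\<gamma> i = generate G (S \<union> ?\<gamma> (Suc i))"
    using Suc by (elim exE conjE)
  define S' where "S' = (\<lambda>(s, t). s \<otimes> t \<otimes> inv s \<otimes> inv t) ` (S \<times> T)"
  define L where "L = generate G (S' \<union> ?\<gamma> (Suc (Suc i)))"
  have S': "finite S'" "S' \<subseteq> ?\<gamma> (Suc i)"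
  proof -
    show "finite S'" unfolding S'_def by (intro finite_imageI finite_cartesian_product S(1) T(1))
    show "S' \<subseteq> ?\<gamma> (Suc i)"
    proof
      fix c assume "c \<in> S'"
      then obtain s t where "s \<in> S" "t \<in> T" "c = s \<otimes> t \<otimes> inv s \<otimes> inv t" by (auto simp: S'_def)
      then show "c \<in> ?\<gamma> (Suc i)"
        using commutator_in_lower_central_series[of s i t] S(2) T(2) by blast
    qed
  qed
  have gens: "S' \<union> ?\<gamma> (Suc (Suc i)) \<subseteq> ?\<gamma> (Suc i)"
    using S' lower_central_series_Suc_subset[of "Suc i"] by blast
  have L: "subgroup L G" "L \<subseteq> ?\<gamma> (Suc i)" "S' \<subseteq> L" "?\<gamma> (Suc (Suc i)) \<subseteq> L"
  proof -
    show "subgroup L G" unfolding L_def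
      using gens lower_central_series_carrier[of _ "Suc i"] by (intro generate_is_subgroup) blast
    show "L \<subseteq> ?\<gamma> (Suc i)" unfolding L_def
      by (intro generate_subgroup_incl[OF gens] lower_central_series_subgroup)
    show "S' \<subseteq> L" "?\<gamma> (Suc (Suc i)) \<subseteq> L"
      unfolding L_def using subset_generate[of "S' \<union> ?\<gamma> (Suc (Suc i))" G] by simp_all
  qed
  have "L \<lhd> G"
    using L(2,4) commutator_in_lower_central_series[of _ "Suc i"]
    by (intro normal_if_commutators[OF L(1)]) blast
  have "h \<otimes> k \<otimes> inv h \<otimes> inv k \<in> L" if h: "h \<in> ?\<gamma> i" and k: "k \<in> carrier G" for h k
  proof (rule commutator_closure[OF \<open>L \<lhd> G\<close> _ T(3,2)])
    show "S \<union> ?\<gamma> (Suc i) \<subseteq> carrier G"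
      using S(2) lower_central_series_carrier[of _ i] lower_central_series_carrier[of _ "Suc i"] by blast
    show "s \<otimes> t \<otimes> inv s \<otimes> inv t \<in> L" if s: "s \<in> S \<union> ?\<gamma> (Suc i)" and t: "t \<in> T" for s t
    proof (cases "s \<in> S")
      case True
      then have "s \<otimes> t \<otimes> inv s \<otimes> inv t \<in> S'" using t by (force simp: S'_def)
      then show ?thesis using L(3) by blast
    next
      case False
      then have "s \<otimes> t \<otimes> inv s \<otimes> inv t \<in> ?\<gamma> (Suc (Suc i))"
        using s t T(2) by (intro commutator_in_lower_central_series) blast+
      then show ?thesis using L(4) by blast
    qed
    show "h \<in> generate G (S \<union> ?\<gamma> (Suc i))" using h unfolding S(3) .
  qed (rule k)
  then have "?\<gamma> (Suc i) \<subseteq> L"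
    unfolding lower_central_series.simps(2)[of G i] by (intro generate_subgroup_incl L(1)) blast
  then show ?case using S' L(2) unfolding L_def by blast
qed

lemma cyclic_extension_insert:
  assumes K: "subgroup K G" and t: "t \<in> carrier G"
    and H: "subgroup H G" "t \<in> H" "K \<subseteq> H" and norm: "\<And>h k. h \<in> H \<Longrightarrow> k \<in> K \<Longrightarrow> h \<otimes> k \<otimes> inv h \<in> K"
  shows "cyclic_extension G K (generate G (insert t K)) t"
proof -
  let ?E = "generate G (insert t K)"
  interpret K: subgroup K G by fact
  have sub: "insert t K \<subseteq> carrier G" using t K.subset by auto
  have EH: "?E \<subseteq> H" using H by (intro generate_subgroup_incl) auto
  have tn: "t [^] n \<otimes> k \<otimes> inv (t [^] n) \<in> K" if "k \<in> K" for k and n :: int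
    using norm subgroup_int_pow_closed[OF H(1,2)] that by blast
  have "\<exists>n::int. x \<in> K #> t [^] n" if "x \<in> ?E" for x
    using that
  proof (induction rule: generate.induct)
    case one
    show ?case by (rule exI[of _ 0]) (auto simp: r_coset_def intro!: bexI[of _ \<one>])
  next
    case (incl h)
    then show ?case
    proof
      assume "h = t"
      then show ?thesis using t by (intro exI[of _ 1]) (auto simp: r_coset_def intro!: bexI[of _ \<one>])
    next
      assume "h \<in> K"
      then show ?thesis by (intro exI[of _ 0]) (auto simp: r_coset_def intro!: bexI[of _ h])
    qed
  next
    case (inv h)
    then show ?case
    proof
      assume "h = t"
      then show ?thesis using t by (intro exI[of _ "-1"]) (auto simp: r_coset_def int_pow_neg intro!: bexI[of _ \<one>])
    next
      assume "h \<in> K"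
      then show ?thesis by (intro exI[of _ 0]) (auto simp: r_coset_def intro!: bexI[of _ "inv h"])
    qed
  next
    case (eng x y)
    then obtain n m :: int and k l where kl: "k \<in> K" "x = k \<otimes> t [^] n" "l \<in> K" "y = l \<otimes> t [^] m"
      by (auto simp: r_coset_def)
    have "x \<otimes> y = (k \<otimes> (t [^] n \<otimes> l \<otimes> inv (t [^] n))) \<otimes> (t [^] n \<otimes> t [^] m)"
      using kl t by (simp add: m_assoc inv_mult_cancel_left)
    also have "\<dots> \<in> K #> t [^] (n + m)"
      using kl t tn[of l n] by (auto simp: r_coset_def int_pow_mult)
    finally show ?case by blast
  qed
  moreover have "K \<subseteq> ?E" using subset_generate[of "insert t K" G] by blast
  ultimately show ?thesis
    using norm EH K generate_is_subgroup[OF sub] generate.incl[of t "insert t K" G]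
    by (intro cyclic_extensionI) auto
qed

text \<open>The lower central series is refined by adjoining generators of one term over the next,
  one at a time. Every intermediate group is normal in \<open>G\<close>, because its commutators
  with \<open>G\<close> fall into the lower term, which it contains; so each adjunction is a cyclic
  extension.\<close>

lemma polycyclic_series_fg_nilpotent:
  assumes "finitely_generated_group G" "nilpotent_group G"
  shows "\<exists>n. polycyclic_series G (carrier G) n"
proof -
  let ?\<gamma> = "lower_central_series G"
  obtain T where T: "finite T" "T \<subseteq> carrier G" "generate G T = carrier G"
    using assms(1) unfolding finitely_generated_group_def by blast
  have step: "\<exists>n. polycyclic_series G (?\<gamma> i) n" if series: "\<exists>n. polycyclic_series G (?\<gamma> (Suc i)) n" for i
  proof -
    obtain S where S: "finite S" "S \<subseteq> ?\<gamma> i" "?\<gamma> i = generate G (S \<union> ?\<gamma> (Suc i))"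
      using lower_central_series_finitely_generated[OF T] by metis
    have "\<exists>n. polycyclic_series G (generate G (S \<union> ?\<gamma> (Suc i))) n"
      using S(1,2)
    proof (induction rule: finite_induct)
      case empty
      have "generate G (?\<gamma> (Suc i)) = ?\<gamma> (Suc i)"
        using generateI[OF lower_central_series_subgroup[of "Suc i"] order_refl] by (simp del: lower_central_series.simps)
      then show ?case using series by (simp del: lower_central_series.simps)
    next
      case (insert t S)
      define K where "K = generate G (S \<union> ?\<gamma> (Suc i))"
      obtain n where n: "polycyclic_series G K n" using insert unfolding K_def by blast
      have sub: "S \<union> ?\<gamma> (Suc i) \<subseteq> ?\<gamma> i" using insert.prems lower_central_series_Suc_subset by blast
      have carr: "S \<union> ?\<gamma> (Suc i) \<subseteq> carrier G" using sub lower_central_series_carrier by blast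
      have K: "subgroup K G" "K \<subseteq> ?\<gamma> i" "?\<gamma> (Suc i) \<subseteq> K" "S \<union> ?\<gamma> (Suc i) \<subseteq> K"
        unfolding K_def using generate_is_subgroup[OF carr] generate_subgroup_incl[OF sub lower_central_series_subgroup]
          subset_generate[of "S \<union> ?\<gamma> (Suc i)" G] by simp_all
      have "K \<lhd> G"
        using K(2,3) commutator_in_lower_central_series[of _ i] by (intro normal_if_commutators[OF K(1)]) blast
      then have norm: "h \<otimes> k \<otimes> inv h \<in> K" if "h \<in> carrier G" "k \<in> K" for h k
        using normal.inv_op_closed2[OF \<open>K \<lhd> G\<close>] that by simp
      have t: "t \<in> carrier G" using insert.prems lower_central_series_carrier[of t i] by simp
      have "cyclic_extension G K (generate G (insert t K)) t"
        by (rule cyclic_extension_insert[OF K(1) t subgroup_self t subgroup.subset[OF K(1)] norm])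
      from polycyclic_series_extend[OF n this]
      obtain n' where "polycyclic_series G (generate G (insert t K)) n'" by blast
      moreover have "generate G (insert t K) = generate G (insert t S \<union> ?\<gamma> (Suc i))"
      proof
        have *: "insert t S \<union> ?\<gamma> (Suc i) \<subseteq> carrier G" using carr t by blast
        have "K \<subseteq> generate G (insert t S \<union> ?\<gamma> (Suc i))" unfolding K_def by (rule mono_generate) blast
        then show "generate G (insert t K) \<subseteq> generate G (insert t S \<union> ?\<gamma> (Suc i))"
          using subset_generate[of "insert t S \<union> ?\<gamma> (Suc i)" G]
          by (intro generate_subgroup_incl generate_is_subgroup[OF *]) blast
        show "generate G (insert t S \<union> ?\<gamma> (Suc i)) \<subseteq> generate G (insert t K)"
          using K(4) by (intro mono_generate) blast
      qed
      ultimately show ?case by metis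
    qed
    then show ?thesis using S(3) by metis
  qed
  obtain N where "?\<gamma> N = {\<one>}" using assms(2) unfolding nilpotent_group_def by blast
  then have "\<exists>n. polycyclic_series G (?\<gamma> N) n" using polycyclic_series.trivial[of G] by metis
  then have "\<exists>n. polycyclic_series G (?\<gamma> 0) n"
  proof (induction N)
    case (Suc N)
    then show ?case using step by blast
  qed
  then show ?thesis by simp
qed

end

section \<open>Central elements of infinite order\<close>

context group
begin

text \<open>Conjugation by \<open>x\<close> permutes the finite set \<open>A\<close>, so each
  \<open>a\<close> returns to itself after finitely many steps; a product of such return times works
  for all of \<open>A\<close>.\<close>

lemma finite_normal_centralizing_power:
  assumes A: "A \<lhd> G" "finite A" and x: "x \<in> carrier G"
  shows "\<exists>p>0. \<forall>a\<in>A. x [^] (p::nat) \<otimes> a = a \<otimes> x [^] p"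
proof -
  interpret A: normal A G by fact
  have single: "\<exists>p>0. x [^] (p::nat) \<otimes> a = a \<otimes> x [^] p" if a: "a \<in> A" for a
  proof -
    define f where "f n = x [^] n \<otimes> a \<otimes> inv (x [^] n)" for n :: nat
    have "range f \<subseteq> A" using a x A.inv_op_closed2 by (auto simp: f_def)
    then have "\<not> inj f" using A(2) finite_subset finite_imageD infinite_UNIV_nat by blast
    then obtain m n where mn: "m < n" "f m = f n" by (metis injI linorder_neqE_nat)
    define y where "y = x [^] (n - m)"
    have y: "y \<in> carrier G" "x [^] n = x [^] m \<otimes> y"
      using x mn(1) by (auto simp: y_def nat_pow_mult)
    have "a \<in> carrier G" using a by simp
    then have "x [^] m \<otimes> a \<otimes> inv (x [^] m) = x [^] m \<otimes> (y \<otimes> a \<otimes> inv y) \<otimes> inv (x [^] m)"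
      using mn(2) x y by (simp add: f_def inv_mult_group m_assoc)
    then have "a = y \<otimes> a \<otimes> inv y" using x y \<open>a \<in> carrier G\<close> by simp
    then have "a \<otimes> y = (y \<otimes> a \<otimes> inv y) \<otimes> y" by simp
    then have "y \<otimes> a = a \<otimes> y" using y \<open>a \<in> carrier G\<close> by (simp add: m_assoc)
    then show ?thesis using mn(1) unfolding y_def by (intro exI[of _ "n - m"]) simp
  qed
  have "\<exists>p>0. \<forall>a\<in>S. x [^] (p::nat) \<otimes> a = a \<otimes> x [^] p" if "finite S" "S \<subseteq> A" for S
    using that
  proof (induction S)
    case (insert a S)
    then obtain p where p: "p > 0" "\<And>b. b \<in> S \<Longrightarrow> x [^] (p::nat) \<otimes> b = b \<otimes> x [^] p" by auto
    obtain q where q: "q > 0" "x [^] (q::nat) \<otimes> a = a \<otimes> x [^] q" using single[of a] insert.prems by blast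
    have "x [^] (p * q) \<otimes> b = b \<otimes> x [^] (p * q)" if "b \<in> insert a S" for b
    proof -
      have b: "b \<in> carrier G" using that insert.prems A.mem_carrier by blast
      show ?thesis
      proof (cases "b = a")
        case True
        then have "(x [^] q) [^] p \<otimes> b = b \<otimes> (x [^] q) [^] p"
          using group_commutes_pow[of "x [^] q" b p] q(2) x b by simp
        then show ?thesis using x by (simp add: nat_pow_pow mult.commute)
      next
        case False
        then have "(x [^] p) [^] q \<otimes> b = b \<otimes> (x [^] p) [^] q"
          using group_commutes_pow[of "x [^] p" b q] p(2)[of b] that x b by simp
        then show ?thesis using x by (simp add: nat_pow_pow)
      qed
    qed
    then show ?case using p(1) q(1) by (intro exI[of _ "p * q"]) simp
  qed (auto intro: exI[of _ 1])
  then show ?thesis using A(2) by blast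
qed

lemma finite_subgroup_exponent:
  assumes "subgroup A G" "finite A"
  shows "\<exists>q>0. \<forall>a\<in>A. a [^] (q::nat) = \<one>"
proof -
  interpret A: group "G\<lparr>carrier := A\<rparr>" using subgroup_imp_group[OF assms(1)] .
  have "a [^] card A = \<one>" if "a \<in> A" for a
    using A.pow_order_eq_1[of a] that nat_pow_consistent[of a "card A" A] by (simp add: order_def)
  moreover have "card A > 0" using assms subgroup.one_closed card_gt_0_iff by blast
  ultimately show ?thesis by blast
qed

text \<open>The hypotheses say that \<open>a\<close> is the commutator \<open>[y, g]\<close> and
  commutes with \<open>y\<close>; then \<open>[y^k, g] = a^k\<close>.\<close>

lemma commutator_powers:
  assumes y: "y \<in> carrier G" and g: "g \<in> carrier G" and a: "a \<in> carrier G"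
    and yg: "y \<otimes> g = a \<otimes> g \<otimes> y" and ya: "y \<otimes> a = a \<otimes> y"
  shows "y [^] (k::nat) \<otimes> g = a [^] k \<otimes> g \<otimes> y [^] k"
proof (induction k)
  case 0
  then show ?case using g by simp
next
  case (Suc k)
  have yka: "y [^] k \<otimes> a = a \<otimes> y [^] k" by (rule group_commutes_pow[OF ya y a])
  have "y [^] Suc k \<otimes> g = y [^] k \<otimes> (y \<otimes> g)" using y g by (simp add: m_assoc)
  also have "\<dots> = (y [^] k \<otimes> a) \<otimes> g \<otimes> y" using y g a by (simp add: yg m_assoc)
  also have "\<dots> = a \<otimes> (y [^] k \<otimes> g) \<otimes> y" using y g a by (simp add: yka m_assoc)
  also have "\<dots> = (a \<otimes> a [^] k) \<otimes> g \<otimes> (y [^] k \<otimes> y)" using y g a by (simp add: Suc m_assoc)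
  finally show ?case using a y by (simp add: nat_pow_Suc2[OF a, symmetric])
qed

lemma nilpotent_central_infinite_order:
  assumes "nilpotent_group G" "infinite (carrier G)" "polycyclic_series G (carrier G) n"
  obtains z where "z \<in> carrier G" "\<And>g. g \<in> carrier G \<Longrightarrow> z \<otimes> g = g \<otimes> z"
    "\<And>m::int. z [^] m = \<one> \<Longrightarrow> m = 0"
proof -
  let ?\<gamma> = "lower_central_series G"
  obtain N where "?\<gamma> N = {\<one>}" using assms(1) unfolding nilpotent_group_def by blast
  then have "finite (?\<gamma> N)" by simp
  moreover have "infinite (?\<gamma> 0)" using assms(2) by simp
  \<comment> \<open>The commutators of an element of \<open>?\<gamma> i\<close> of infinite order lie in the finite group \<open>?\<gamma> (Suc i)\<close>,
    so a suitable power of it is central.\<close>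
  ultimately obtain i where i: "infinite (?\<gamma> i)" "finite (?\<gamma> (Suc i))"
    using nat_induct[of "\<lambda>i. infinite (?\<gamma> i)" N] by blast
  have "carrier G \<inter> ?\<gamma> i = ?\<gamma> i" using lower_central_series_carrier by blast
  then have "infinite (carrier G \<inter> ?\<gamma> i)" using i(1) by simp
  then obtain x where x: "x \<in> ?\<gamma> i" "\<And>m::int. x [^] m = \<one> \<Longrightarrow> m = 0"
    using infinite_order_element[OF assms(3) lower_central_series_subgroup] by blast
  have xG: "x \<in> carrier G" using lower_central_series_carrier[OF x(1)] .
  obtain p :: nat where p: "p > 0" "\<And>a. a \<in> ?\<gamma> (Suc i) \<Longrightarrow> x [^] p \<otimes> a = a \<otimes> x [^] p"
    using finite_normal_centralizing_power[OF lower_central_series_normal i(2) xG] by blast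
  obtain q :: nat where q: "q > 0" "\<And>a. a \<in> ?\<gamma> (Suc i) \<Longrightarrow> a [^] q = \<one>"
    using finite_subgroup_exponent[OF lower_central_series_subgroup i(2)] by blast
  \<comment> \<open>The exponent \<open>p\<close> makes \<open>y\<close> commute with its own
    commutators, and \<open>q\<close> annihilates these; hence
    \<open>[y^q, g] = [y, g]^q = 1\<close>.\<close>
  define y where "y = x [^] p"
  have yG: "y \<in> carrier G" using xG by (simp add: y_def)
  have y\<gamma>: "y \<in> ?\<gamma> i"
    using subgroup_int_pow_closed[OF lower_central_series_subgroup x(1), of "int p"] by (simp add: y_def int_pow_int)
  show ?thesis
  proof
    show "y [^] q \<in> carrier G" using yG by simp
    fix g assume g: "g \<in> carrier G"
    define a where "a = y \<otimes> g \<otimes> inv y \<otimes> inv g"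
    have a: "a \<in> ?\<gamma> (Suc i)" unfolding a_def by (rule commutator_in_lower_central_series[OF y\<gamma> g])
    have aG: "a \<in> carrier G" using lower_central_series_carrier[OF a] .
    have "y \<otimes> g = a \<otimes> g \<otimes> y" using yG g by (simp add: a_def m_assoc)
    moreover have "y \<otimes> a = a \<otimes> y" using p(2)[OF a] by (simp add: y_def)
    ultimately have "y [^] q \<otimes> g = a [^] q \<otimes> g \<otimes> y [^] q" by (rule commutator_powers[OF yG g aG])
    then show "y [^] q \<otimes> g = g \<otimes> y [^] q" using q(2)[OF a] g yG by simp
  next
    fix m :: int assume "(y [^] q) [^] m = \<one>"
    then have "((x [^] int p) [^] int q) [^] m = \<one>" by (simp add: y_def int_pow_int)
    then have "x [^] (int p * int q * m) = \<one>" using xG by (simp add: int_pow_pow)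
    from x(2)[OF this] show "m = 0" using p(1) q(1) by simp
  qed
qed

end

section \<open>Almost invariant bump functions on nilpotent groups\<close>

text \<open>The quotient is realised on the element type of \<open>G\<close>, which allows an induction over all groups
  with elements in that type.\<close>

lemma (in normal) quotient_epimorphism:
  obtains Q :: "'a monoid" and \<pi> where "group_hom G Q \<pi>" "\<pi> ` carrier G = carrier Q" "kernel G Q \<pi> = H"
proof -
  define rep :: "'a set \<Rightarrow> 'a" where "rep = (\<lambda>U. SOME g. g \<in> U)"
  define Q where "Q = flatten (G Mod H) rep"
  define \<pi> where "\<pi> = (\<lambda>x. rep (H #> x))"
  have iso: "rep \<in> iso (G Mod H) Q" unfolding rep_def Q_def by (rule flatten_set_group_mod_iso)
  have "group Q" unfolding rep_def Q_def by (rule flatten_set_group_mod)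
  have "\<pi> \<in> hom G Q"
  proof (rule homI)
    have r: "(#>) H \<in> hom G (G Mod H)" by (rule r_coset_hom_Mod)
    have rep: "rep \<in> hom (G Mod H) Q" using iso by (simp add: iso_def)
    show "\<pi> x \<in> carrier Q" if "x \<in> carrier G" for x
      unfolding \<pi>_def by (intro hom_in_carrier[OF rep] hom_in_carrier[OF r] that)
    show "\<pi> (x \<otimes> y) = \<pi> x \<otimes>\<^bsub>Q\<^esub> \<pi> y" if "x \<in> carrier G" "y \<in> carrier G" for x y
      unfolding \<pi>_def hom_mult[OF r that] by (intro hom_mult[OF rep] hom_in_carrier[OF r] that)
  qed
  then have hom: "group_hom G Q \<pi>" using \<open>group Q\<close> is_group by (intro group_hom.intro group_hom_axioms.intro)
  have bij: "bij_betw rep (carrier (G Mod H)) (carrier Q)" using iso by (simp add: iso_def)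
  have surj: "\<pi> ` carrier G = carrier Q"
    using bij_betw_imp_surj_on[OF bij] unfolding carrier_FactGroup \<pi>_def by (simp add: image_image)
  have "\<pi> x = \<one>\<^bsub>Q\<^esub> \<longleftrightarrow> x \<in> H" if x: "x \<in> carrier G" for x
  proof -
    have "\<one>\<^bsub>Q\<^esub> = rep H" by (simp add: Q_def flatten_def FactGroup_def)
    moreover have "H #> x \<in> carrier (G Mod H)" "H \<in> carrier (G Mod H)"
      using x subgroup_in_rcosets[OF is_group] by (auto simp: FactGroup_def RCOSETS_def)
    ultimately have "\<pi> x = \<one>\<^bsub>Q\<^esub> \<longleftrightarrow> H #> x = H"
      using bij_betw_imp_inj_on[OF bij] by (simp add: \<pi>_def inj_on_eq_iff)
    then show ?thesis using x rcos_self[OF x is_subgroup] coset_join2[OF x is_subgroup] by blast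
  qed
  moreover have "x \<in> carrier G" if "x \<in> H" for x using that by simp
  ultimately have "kernel G Q \<pi> = H" unfolding kernel_def by blast
  then show ?thesis using that hom surj by blast
qed

text \<open>The element \<open>inv x \<otimes> y\<close> is unchanged when both arguments are
  multiplied on the left, in accordance with almost invariance under left multiplication by
  \<open>M\<close>. Plateaus are required over \<open>B\<close> alone, not over all of the group,
  because every point of \<open>X\<close> reaches a marker set through an element of
  \<open>B\<close>.\<close>

definition bump_cover ::
  "('g, 'm) monoid_scheme \<Rightarrow> nat \<Rightarrow> real \<Rightarrow> 'g set \<Rightarrow> 'g set \<Rightarrow> (nat \<Rightarrow> 'g \<Rightarrow> real) \<Rightarrow> bool" where
  "bump_cover G D \<epsilon> M B \<phi> \<longleftrightarrow>
     finite B \<and> B \<subseteq> carrier G \<and> \<one>\<^bsub>G\<^esub> \<in> B \<and> (\<forall>b\<in>B. inv\<^bsub>G\<^esub> b \<in> B) \<and>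
     (\<forall>j<D. \<forall>x\<in>carrier G. 0 \<le> \<phi> j x \<and> \<phi> j x \<le> 1) \<and>
     (\<forall>j<D. \<forall>x\<in>carrier G. \<forall>y\<in>carrier G. \<phi> j x \<noteq> 0 \<and> \<phi> j y \<noteq> 0 \<longrightarrow> inv\<^bsub>G\<^esub> x \<otimes>\<^bsub>G\<^esub> y \<in> B) \<and>
     (\<forall>j<D. \<forall>g\<in>M. \<forall>x\<in>carrier G. \<bar>\<phi> j (g \<otimes>\<^bsub>G\<^esub> x) - \<phi> j x\<bar> \<le> \<epsilon>) \<and>
     (\<forall>b\<in>B. \<exists>j<D. \<phi> j b = 1)"

definition has_bump_covers :: "('g, 'm) monoid_scheme \<Rightarrow> nat \<Rightarrow> bool" where
  "has_bump_covers G D \<longleftrightarrow>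
     (\<forall>\<epsilon>>0. \<forall>M. finite M \<and> M \<subseteq> carrier G \<longrightarrow> (\<exists>B \<phi>. bump_cover G D \<epsilon> M B \<phi>))"

lemma bump_coverD:
  assumes "bump_cover G D \<epsilon> M B \<phi>"
  shows "finite B" "B \<subseteq> carrier G" "\<one>\<^bsub>G\<^esub> \<in> B" "\<And>b. b \<in> B \<Longrightarrow> inv\<^bsub>G\<^esub> b \<in> B"
    "\<And>j x. j < D \<Longrightarrow> x \<in> carrier G \<Longrightarrow> 0 \<le> \<phi> j x"
    "\<And>j x. j < D \<Longrightarrow> x \<in> carrier G \<Longrightarrow> \<phi> j x \<le> 1"
    "\<And>j x y. j < D \<Longrightarrow> x \<in> carrier G \<Longrightarrow> y \<in> carrier G \<Longrightarrow> \<phi> j x \<noteq> 0 \<Longrightarrow> \<phi> j y \<noteq> 0 \<Longrightarrow> inv\<^bsub>G\<^esub> x \<otimes>\<^bsub>G\<^esub> y \<in> B"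
    "\<And>j g x. j < D \<Longrightarrow> g \<in> M \<Longrightarrow> x \<in> carrier G \<Longrightarrow> \<bar>\<phi> j (g \<otimes>\<^bsub>G\<^esub> x) - \<phi> j x\<bar> \<le> \<epsilon>"
    "\<And>b. b \<in> B \<Longrightarrow> \<exists>j<D. \<phi> j b = 1"
  using assms unfolding bump_cover_def by auto

lemma (in group) bump_cover_finite_support:
  assumes "bump_cover G D \<epsilon> M B \<phi>" "j < D"
  shows "finite {x \<in> carrier G. \<phi> j x \<noteq> 0}"
proof (cases "{x \<in> carrier G. \<phi> j x \<noteq> 0} = {}")
  case False
  then obtain x where x: "x \<in> carrier G" "\<phi> j x \<noteq> 0" by blast
  note B = bump_coverD[OF assms(1)]
  have "y \<in> (\<lambda>b. x \<otimes> b) ` B" if y: "y \<in> carrier G" "\<phi> j y \<noteq> 0" for y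
    using B(7)[OF assms(2) x(1) y(1) x(2) y(2)] x(1) y(1)
    by (intro image_eqI[of _ _ "inv x \<otimes> y"]) (simp_all flip: m_assoc)
  then have "{x \<in> carrier G. \<phi> j x \<noteq> 0} \<subseteq> (\<lambda>b. x \<otimes> b) ` B" by blast
  then show ?thesis using B(1) finite_subset by blast
qed (simp only: finite.emptyI)

lemma has_bump_covers_mono:
  assumes "has_bump_covers G D" "D \<le> D'"
  shows "has_bump_covers G D'"
  unfolding has_bump_covers_def
proof (intro allI impI)
  fix \<epsilon> :: real and M assume \<epsilon>: "0 < \<epsilon>" and "finite M \<and> M \<subseteq> carrier G"
  then obtain B \<phi> where "bump_cover G D \<epsilon> M B \<phi>" using assms(1) unfolding has_bump_covers_def by blast
  note B = bump_coverD[OF this]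
  define \<phi>' where "\<phi>' j = (if j < D then \<phi> j else (\<lambda>_. 0))" for j
  have "bump_cover G D' \<epsilon> M B \<phi>'"
    unfolding bump_cover_def
  proof (intro conjI ballI allI impI)
    show "\<exists>j<D'. \<phi>' j b = 1" if b: "b \<in> B" for b
    proof -
      obtain j where "j < D" "\<phi> j b = 1" using B(9)[OF b] by blast
      then show ?thesis using assms(2) by (intro exI[of _ j]) (simp add: \<phi>'_def)
    qed
    show "0 \<le> \<phi>' j x" "\<phi>' j x \<le> 1" if "x \<in> carrier G" for j x
      using B(5,6)[of j x] that by (simp_all add: \<phi>'_def)
    show "inv\<^bsub>G\<^esub> x \<otimes>\<^bsub>G\<^esub> y \<in> B" if "x \<in> carrier G" "y \<in> carrier G" "\<phi>' j x \<noteq> 0 \<and> \<phi>' j y \<noteq> 0" for j x y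
      using B(7)[of j x y] that by (simp add: \<phi>'_def split: if_splits)
    show "\<bar>\<phi>' j (g \<otimes>\<^bsub>G\<^esub> x) - \<phi>' j x\<bar> \<le> \<epsilon>" if "g \<in> M" "x \<in> carrier G" for j g x
      using B(8)[of j g x] that \<epsilon> by (simp add: \<phi>'_def)
  qed (rule B; assumption)+
  then show "\<exists>B \<phi>. bump_cover G D' \<epsilon> M B \<phi>" by blast
qed

lemma (in group) has_bump_covers_finite:
  assumes "finite (carrier G)"
  shows "has_bump_covers G 1"
  unfolding has_bump_covers_def bump_cover_def
  by (intro allI impI exI[of _ "carrier G"] exI[of _ "\<lambda>_ _. 1"]) (use assms in auto)


text \<open>\<open>\<tau>\<close> is the exponent of \<open>z\<close> relative to a set-theoretic section of \<open>h\<close>; the point of the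
  last two properties is that its failure to be additive depends on images under \<open>h\<close> only.\<close>

lemma (in group_hom) central_extension_coordinate:
  assumes surj: "h ` carrier G = carrier H"
    and z: "z \<in> carrier G" "\<And>g. g \<in> carrier G \<Longrightarrow> z \<otimes> g = g \<otimes> z" "\<And>m::int. z [^] m = \<one> \<Longrightarrow> m = 0"
    and ker: "kernel G H h = range (\<lambda>n::int. z [^] n)"
  obtains s :: "'c \<Rightarrow> 'a" and \<tau> :: "'a \<Rightarrow> int"
  where "\<And>q. q \<in> carrier H \<Longrightarrow> s q \<in> carrier G"
    "\<And>g. g \<in> carrier G \<Longrightarrow> g = s (h g) \<otimes> z [^] \<tau> g"
    "\<And>g x. g \<in> carrier G \<Longrightarrow> x \<in> carrier G \<Longrightarrow> \<tau> (g \<otimes> x) = \<tau> (g \<otimes> s (h x)) + \<tau> x"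
    "\<And>x y. x \<in> carrier G \<Longrightarrow> y \<in> carrier G \<Longrightarrow> \<tau> (inv x \<otimes> y) = \<tau> (inv (s (h x)) \<otimes> s (h y)) + \<tau> y - \<tau> x"
proof -
  define s where "s q = (SOME g. g \<in> carrier G \<and> h g = q)" for q
  have s: "s q \<in> carrier G" "h (s q) = q" if "q \<in> carrier H" for q
  proof -
    have "q \<in> h ` carrier G" using that surj by simp
    then have "\<exists>g. g \<in> carrier G \<and> h g = q" by blast
    from someI_ex[OF this] show "s q \<in> carrier G" "h (s q) = q" by (simp_all add: s_def)
  qed
  have zn: "z [^] n \<in> carrier G" "h (z [^] n) = \<one>\<^bsub>H\<^esub>" for n :: int
    using ker z(1) by (auto simp: kernel_def)
  have "\<exists>n::int. g = s (h g) \<otimes> z [^] n" if g: "g \<in> carrier G" for g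
  proof -
    have "inv (s (h g)) \<otimes> g \<in> kernel G H h" using g s[of "h g"] by (simp add: kernel_def)
    then obtain n :: int where "inv (s (h g)) \<otimes> g = z [^] n" using ker by auto
    then show ?thesis using g s[of "h g"] by (metis G.inv_solve_left' hom_closed zn(1))
  qed
  then obtain \<tau> :: "'a \<Rightarrow> int" where \<tau>: "\<And>g. g \<in> carrier G \<Longrightarrow> g = s (h g) \<otimes> z [^] \<tau> g" by metis
  \<comment> \<open>The factor \<open>z [^] n\<close> lies in the kernel and leaves the chosen
    representative unchanged, so only the exponent moves; infinite order of \<open>z\<close> makes
    the exponent unique.\<close>
  have shift: "\<tau> (g \<otimes> z [^] n) = \<tau> g + n" if g: "g \<in> carrier G" for g and n :: int
  proof -
    define g' where "g' = g \<otimes> z [^] n"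
    have g': "g' \<in> carrier G" "h g' = h g" using g zn by (auto simp: g'_def)
    have "s (h g) \<otimes> z [^] \<tau> g' = g'" using \<tau>[OF g'(1)] g'(2) by simp
    also have "g' = (s (h g) \<otimes> z [^] \<tau> g) \<otimes> z [^] n" unfolding g'_def using \<tau>[OF g] by simp
    also have "\<dots> = s (h g) \<otimes> z [^] (\<tau> g + n)" using s[of "h g"] g z(1) by (simp add: G.m_assoc G.int_pow_mult)
    finally have "z [^] \<tau> g' = z [^] (\<tau> g + n)" using s(1)[of "h g"] g zn(1) by simp
    then have "z [^] (\<tau> g' - (\<tau> g + n)) = \<one>" using z(1) by (simp add: G.int_pow_diff)
    from z(3)[OF this] show ?thesis by (simp add: g'_def)
  qed
  have comm: "z [^] n \<otimes> g = g \<otimes> z [^] n" if g: "g \<in> carrier G" for g and n :: int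
  proof (cases "n \<ge> 0")
    case True
    then obtain k where "n = int k" using nonneg_int_cases by blast
    then show ?thesis using G.group_commutes_pow[OF z(2)[OF g] z(1) g, of k] by (simp add: int_pow_int)
  next
    case False
    then obtain k where k: "n = - int k" using int_cases4[of n] by fastforce
    have c: "z [^] k \<otimes> g = g \<otimes> z [^] k" using G.group_commutes_pow[OF z(2)[OF g] z(1) g] .
    have "inv (z [^] k) \<otimes> g = inv (z [^] k) \<otimes> (g \<otimes> z [^] k) \<otimes> inv (z [^] k)"
      using g z(1) by (simp add: G.m_assoc)
    also have "\<dots> = g \<otimes> inv (z [^] k)"
      using g z(1) by (simp add: G.m_assoc G.inv_mult_cancel_left flip: c)
    finally show ?thesis using z(1) by (simp add: k G.int_pow_neg_int)
  qed
  show ?thesis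
  proof (rule that)
    fix g x assume g: "g \<in> carrier G" and x: "x \<in> carrier G"
    have "g \<otimes> x = (g \<otimes> s (h x)) \<otimes> z [^] \<tau> x"
      using g s(1)[of "h x"] x zn(1) \<tau>[OF x] by (metis G.m_assoc hom_closed)
    then show "\<tau> (g \<otimes> x) = \<tau> (g \<otimes> s (h x)) + \<tau> x" using g s(1)[of "h x"] x shift by simp
  next
    fix x y assume x: "x \<in> carrier G" and y: "y \<in> carrier G"
    define a b where "a = s (h x)" and "b = s (h y)"
    have ab: "a \<in> carrier G" "b \<in> carrier G" using s(1) x y by (auto simp: a_def b_def)
    have "inv x = inv (a \<otimes> z [^] \<tau> x)" using \<tau>[OF x] by (simp add: a_def)
    also have "\<dots> = inv a \<otimes> z [^] (- \<tau> x)"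
      using ab zn z(1) comm[of "inv a" "- \<tau> x"] by (simp add: G.inv_mult_group G.int_pow_neg)
    finally have "inv x \<otimes> y = (inv a \<otimes> z [^] (- \<tau> x)) \<otimes> (b \<otimes> z [^] \<tau> y)"
      using \<tau>[OF y] by (simp add: b_def)
    also have "\<dots> = inv a \<otimes> (z [^] (- \<tau> x) \<otimes> b) \<otimes> z [^] \<tau> y"
      using ab zn(1) by (simp add: G.m_assoc)
    also have "\<dots> = (inv a \<otimes> b) \<otimes> z [^] (- \<tau> x + \<tau> y)"
      using ab zn(1) z(1) unfolding comm[OF ab(2)] by (simp add: G.m_assoc flip: G.int_pow_mult)
    finally have "\<tau> (inv x \<otimes> y) = \<tau> (inv a \<otimes> b) + (- \<tau> x + \<tau> y)" using shift ab by simp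
    then show "\<tau> (inv x \<otimes> y) = \<tau> (inv (s (h x)) \<otimes> s (h y)) + \<tau> y - \<tau> x" by (simp add: a_def b_def)
  qed (use s \<tau> in blast)+
qed

text \<open>A plateau of radius \<open>u\<close> around the centre \<open>c\<close>, with flanks of
  width \<open>w\<close> and slope \<open>1 / w\<close>.\<close>

definition trapezoid :: "real \<Rightarrow> real \<Rightarrow> real \<Rightarrow> real \<Rightarrow> real" where
  "trapezoid c u w n = max 0 (min 1 (1 + (u - \<bar>n - c\<bar>) / w))"

lemma trapezoid_bounds: "0 \<le> trapezoid c u w n" "trapezoid c u w n \<le> 1"
  by (simp_all add: trapezoid_def)

lemma trapezoid_eq_1: "w > 0 \<Longrightarrow> \<bar>n - c\<bar> \<le> u \<Longrightarrow> trapezoid c u w n = 1"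
  by (simp add: trapezoid_def)

lemma trapezoid_support:
  assumes "w > 0" "trapezoid c u w n \<noteq> 0"
  shows "\<bar>n - c\<bar> < u + w"
proof (rule ccontr)
  assume "\<not> ?thesis"
  then have "(u - \<bar>n - c\<bar>) / w \<le> -1" using assms(1) by (simp add: divide_le_eq)
  then show False using assms(2) by (simp add: trapezoid_def)
qed

lemma trapezoid_lipschitz:
  assumes "w > 0"
  shows "\<bar>trapezoid c u w m - trapezoid c u w n\<bar> \<le> \<bar>m - n\<bar> / w"
proof -
  have "\<bar>max 0 (min 1 a) - max 0 (min 1 b)\<bar> \<le> \<bar>a - b\<bar>" for a b :: real by linarith
  then have "\<bar>trapezoid c u w m - trapezoid c u w n\<bar>
      \<le> \<bar>(1 + (u - \<bar>m - c\<bar>) / w) - (1 + (u - \<bar>n - c\<bar>) / w)\<bar>"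
    unfolding trapezoid_def .
  also have "\<dots> = \<bar>\<bar>n - c\<bar> - \<bar>m - c\<bar>\<bar> / w" using assms by (simp add: diff_divide_distrib[symmetric])
  also have "\<dots> \<le> \<bar>m - n\<bar> / w" using assms by (intro divide_right_mono) linarith+
  finally show ?thesis .
qed


text \<open>Each new function is the product of a bump function on the quotient and a trapezoid in
  the exponent \<open>\<tau>\<close>; an index below \<open>3 * D\<close> encodes the pair by
  division by \<open>D\<close>. The exponent is not additive, but over the finite set
  \<open>A\<close> of classes that carry some \<open>\<phi>\<close> the relevant defects are bounded
  by a constant \<open>C\<close>, fixed before the widths of the trapezoids.\<close>

lemma (in group_hom) has_bump_covers_central_extension:
  assumes surj: "h ` carrier G = carrier H"
    and z: "z \<in> carrier G" "\<And>g. g \<in> carrier G \<Longrightarrow> z \<otimes> g = g \<otimes> z" "\<And>m::int. z [^] m = \<one> \<Longrightarrow> m = 0"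
    and ker: "kernel G H h = range (\<lambda>n::int. z [^] n)"
    and H: "has_bump_covers H D"
  shows "has_bump_covers G (3 * D)"
  unfolding has_bump_covers_def
proof (intro allI impI, elim conjE)
  fix \<epsilon> :: real and M assume \<epsilon>: "0 < \<epsilon>" and M: "finite M" "M \<subseteq> carrier G"
  obtain s :: "'c \<Rightarrow> 'a" and \<tau> :: "'a \<Rightarrow> int"
  where s: "\<And>q. q \<in> carrier H \<Longrightarrow> s q \<in> carrier G"
    and \<tau>: "\<And>g. g \<in> carrier G \<Longrightarrow> g = s (h g) \<otimes> z [^] \<tau> g"
    and \<tau>_mult: "\<And>g x. g \<in> carrier G \<Longrightarrow> x \<in> carrier G \<Longrightarrow> \<tau> (g \<otimes> x) = \<tau> (g \<otimes> s (h x)) + \<tau> x"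
    and \<tau>_inv: "\<And>x y. x \<in> carrier G \<Longrightarrow> y \<in> carrier G \<Longrightarrow>
        \<tau> (inv x \<otimes> y) = \<tau> (inv (s (h x)) \<otimes> s (h y)) + \<tau> y - \<tau> x"
    using central_extension_coordinate[OF surj z ker] by metis
  have "finite (h ` M)" "h ` M \<subseteq> carrier H" "\<epsilon> / 2 > 0" using M \<epsilon> by auto
  then obtain BH \<phi> where bump: "bump_cover H D (\<epsilon> / 2) (h ` M) BH \<phi>"
    using H unfolding has_bump_covers_def by blast
  note BH = bump_coverD[OF bump]
  define A where "A = (\<Union>j<D. {q \<in> carrier H. \<phi> j q \<noteq> 0})"
  have A: "finite A" "A \<subseteq> carrier H"
    unfolding A_def using H.bump_cover_finite_support[OF bump] by auto
  \<comment> \<open>The two images collect the defects for almost invariance and for the size of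
    supports; the entry for the identity makes the set nonempty and puts the identity into
    \<open>B\<close>.\<close>
  define T where "T = insert \<bar>\<tau> \<one>\<bar> ((\<lambda>(g, q). \<bar>\<tau> (g \<otimes> s q)\<bar>) ` (M \<times> A) \<union> (\<lambda>(p, q). \<bar>\<tau> (inv (s p) \<otimes> s q)\<bar>) ` (A \<times> A))"
  define C where "C = real_of_int (Max T)"
  have "finite T" unfolding T_def using A(1) M(1) by simp
  then have C: "real_of_int t \<le> C" if "t \<in> T" for t
    using that by (simp add: C_def)
  have C_one: "\<bar>real_of_int (\<tau> \<one>)\<bar> \<le> C" using C[of "\<bar>\<tau> \<one>\<bar>"] by (simp add: T_def)
  then have C_nonneg: "0 \<le> C" by linarith
  have C_mult: "\<bar>real_of_int (\<tau> (g \<otimes> s q))\<bar> \<le> C" if "g \<in> M" "q \<in> A" for g q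
  proof -
    have "\<bar>\<tau> (g \<otimes> s q)\<bar> \<in> T" using that unfolding T_def by (intro insertI2 UnI1 image_eqI[of _ _ "(g, q)"]) auto
    from C[OF this] show ?thesis by simp
  qed
  have C_inv: "\<bar>real_of_int (\<tau> (inv (s p) \<otimes> s q))\<bar> \<le> C" if "p \<in> A" "q \<in> A" for p q
  proof -
    have "\<bar>\<tau> (inv (s p) \<otimes> s q)\<bar> \<in> T" using that unfolding T_def by (intro insertI2 UnI2 image_eqI[of _ _ "(p, q)"]) auto
    from C[OF this] show ?thesis by simp
  qed
  \<comment> \<open>The plateaus of the trapezoids with centres \<open>-2u, 0, 2u\<close> cover \<open>[-3u, 3u]\<close>, and differences of
    points in a support are bounded by \<open>2 (u + w) = 3u - C\<close>, which leaves room for the error \<open>C\<close>.\<close>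
  define w where "w = 2 * C / \<epsilon> + 1"
  define u where "u = 2 * w + C"
  define R where "R = 3 * u"
  have w: "w > 0" using C_nonneg \<epsilon> by (simp add: w_def add_nonneg_pos)
  \<comment> \<open>A change of the exponent by \<open>C\<close> alters a trapezoid by at most
    \<open>\<epsilon> / 2\<close>; the other half is spent on \<open>\<phi>\<close>.\<close>
  have w_C: "C / w \<le> \<epsilon> / 2"
  proof -
    have "\<epsilon> / 2 * w = C + \<epsilon> / 2" using \<epsilon> by (simp add: w_def field_simps)
    then have "C \<le> \<epsilon> / 2 * w" using \<epsilon> by linarith
    then show ?thesis using w by (simp add: divide_le_eq)
  qed
  define \<psi> where "\<psi> i n = trapezoid (2 * u * (real i - 1)) u w (real_of_int n)" for i :: nat and n :: int
  define \<Phi> where "\<Phi> j x = \<phi> (j mod D) (h x) * \<psi> (j div D) (\<tau> x)" for j x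
  \<comment> \<open>The inverse gets its own bound because its exponent need not be the negative of
    that of \<open>g\<close>; this makes \<open>B\<close> symmetric.\<close>
  define B where "B = {g \<in> carrier G. h g \<in> BH \<and> \<bar>real_of_int (\<tau> g)\<bar> \<le> R \<and> \<bar>real_of_int (\<tau> (inv g))\<bar> \<le> R}"
  have D: "j mod D < D" if "j < 3 * D" for j using that by (cases "D = 0") auto
  have A_I: "h x \<in> A" if "j < 3 * D" "x \<in> carrier G" "\<phi> (j mod D) (h x) \<noteq> 0" for j x
    using D[OF that(1)] that(2,3) by (auto simp: A_def)
  have \<phi>01: "0 \<le> \<phi> (j mod D) (h x)" "\<phi> (j mod D) (h x) \<le> 1" if "j < 3 * D" "x \<in> carrier G" for j x
    using BH(5,6)[OF D[OF that(1)], of "h x"] that(2) by auto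
  have \<psi>01: "0 \<le> \<psi> i n" "\<psi> i n \<le> 1" for i n by (simp_all add: \<psi>_def trapezoid_bounds)
  have fin: "finite B"
  proof (rule finite_subset)
    show "B \<subseteq> (\<lambda>(q, n). s q \<otimes> z [^] n) ` (BH \<times> {- \<lceil>R\<rceil>..\<lceil>R\<rceil>})"
    proof
      fix g assume g: "g \<in> B"
      then have "\<bar>real_of_int (\<tau> g)\<bar> \<le> R" by (simp add: B_def)
      then have "\<tau> g \<in> {- \<lceil>R\<rceil>..\<lceil>R\<rceil>}" by (simp add: abs_le_iff) linarith
      then show "g \<in> (\<lambda>(q, n). s q \<otimes> z [^] n) ` (BH \<times> {- \<lceil>R\<rceil>..\<lceil>R\<rceil>})"
        using g \<tau>[of g] by (intro image_eqI[of _ _ "(h g, \<tau> g)"]) (auto simp: B_def)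
    qed
  qed (use BH(1) in simp)
  have small: "\<bar>real_of_int (\<tau> (inv x \<otimes> y))\<bar> \<le> R"
    if j: "j < 3 * D" and x: "x \<in> carrier G" "\<Phi> j x \<noteq> 0" and y: "y \<in> carrier G" "\<Phi> j y \<noteq> 0" for j x y
  proof -
    have "h x \<in> A" "h y \<in> A" using A_I[OF j] x y by (auto simp: \<Phi>_def)
    then have c: "\<bar>real_of_int (\<tau> (inv (s (h x)) \<otimes> s (h y)))\<bar> \<le> C" by (rule C_inv)
    define m where "m = 2 * u * (real (j div D) - 1)"
    have "\<psi> (j div D) (\<tau> x) \<noteq> 0" "\<psi> (j div D) (\<tau> y) \<noteq> 0" using x y by (auto simp: \<Phi>_def)
    then have "\<bar>real_of_int (\<tau> x) - m\<bar> < u + w" "\<bar>real_of_int (\<tau> y) - m\<bar> < u + w"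
      unfolding \<psi>_def m_def using trapezoid_support[OF w] by blast+
    moreover have "real_of_int (\<tau> (inv x \<otimes> y))
        = real_of_int (\<tau> (inv (s (h x)) \<otimes> s (h y))) + real_of_int (\<tau> y) - real_of_int (\<tau> x)"
      using \<tau>_inv[OF x(1) y(1)] by simp
    moreover have "\<bar>d\<bar> \<le> R" if "\<bar>a - m\<bar> < u + w" "\<bar>b - m\<bar> < u + w" "d = e + b - a" "\<bar>e\<bar> \<le> C"
      for a b d e m :: real
      using that unfolding R_def u_def by (auto simp: abs_le_iff)
    ultimately show ?thesis using c by blast
  qed
  have "bump_cover G (3 * D) \<epsilon> M B \<Phi>"
    unfolding bump_cover_def
  proof (intro conjI ballI allI impI)
    show "finite B" by (rule fin)
    show "B \<subseteq> carrier G" by (auto simp: B_def)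
    show "\<one> \<in> B" using BH(3) C_one C_nonneg w by (simp add: B_def R_def u_def)
    show "inv b \<in> B" if "b \<in> B" for b using that BH(4) by (simp add: B_def)
    show "0 \<le> \<Phi> j x" "\<Phi> j x \<le> 1" if "j < 3 * D" "x \<in> carrier G" for j x
      using \<phi>01[OF that] \<psi>01 by (simp_all add: \<Phi>_def mult_le_one)
  next
    fix j x y assume j: "j < 3 * D" and x: "x \<in> carrier G" and y: "y \<in> carrier G"
      and "\<Phi> j x \<noteq> 0 \<and> \<Phi> j y \<noteq> 0"
    then have nz: "\<Phi> j x \<noteq> 0" "\<Phi> j y \<noteq> 0" by auto
    have "\<phi> (j mod D) (h x) \<noteq> 0" "\<phi> (j mod D) (h y) \<noteq> 0" using nz by (auto simp: \<Phi>_def)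
    then have "inv\<^bsub>H\<^esub> h x \<otimes>\<^bsub>H\<^esub> h y \<in> BH" using x y by (intro BH(7)[OF D[OF j]]) auto
    moreover have "inv (inv x \<otimes> y) = inv y \<otimes> x" using x y by (simp add: G.inv_mult_group)
    ultimately show "inv x \<otimes> y \<in> B"
      using small[OF j x nz(1) y nz(2)] small[OF j y nz(2) x nz(1)] x y by (simp add: B_def)
  next
    fix j g x assume j: "j < 3 * D" and g: "g \<in> M" and x: "x \<in> carrier G"
    have gG: "g \<in> carrier G" using g M(2) by blast
    let ?a = "\<phi> (j mod D) (h (g \<otimes> x))" and ?b = "\<phi> (j mod D) (h x)"
    let ?p = "\<psi> (j div D) (\<tau> (g \<otimes> x))" and ?q = "\<psi> (j div D) (\<tau> x)"
    have ab: "\<bar>?a - ?b\<bar> \<le> \<epsilon> / 2" using BH(8)[OF D[OF j], of "h g" "h x"] g gG x by simp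
    have pq: "\<bar>?p - ?q\<bar> \<le> \<epsilon> / 2" if "?b \<noteq> 0"
    proof -
      have "\<bar>?p - ?q\<bar> \<le> \<bar>real_of_int (\<tau> (g \<otimes> x)) - real_of_int (\<tau> x)\<bar> / w"
        unfolding \<psi>_def by (rule trapezoid_lipschitz[OF w])
      also have "\<dots> = \<bar>real_of_int (\<tau> (g \<otimes> s (h x)))\<bar> / w" using \<tau>_mult[OF gG x] by simp
      also have "\<dots> \<le> C / w" using w C_mult[OF g A_I[OF j x that]] by (intro divide_right_mono) auto
      finally show ?thesis using w_C by linarith
    qed
    \<comment> \<open>In this splitting the trapezoids are compared with weight \<open>?b\<close>,
      so the defect bound is called for only when the class of \<open>x\<close> belongs to
      \<open>A\<close>.\<close>
    have "\<bar>\<Phi> j (g \<otimes> x) - \<Phi> j x\<bar> = \<bar>(?a - ?b) * ?p + ?b * (?p - ?q)\<bar>"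
      unfolding \<Phi>_def by (simp add: algebra_simps)
    also have "\<dots> \<le> \<bar>?a - ?b\<bar> * ?p + ?b * \<bar>?p - ?q\<bar>"
      using \<psi>01 \<phi>01(1)[OF j x] by (intro order_trans[OF abs_triangle_ineq]) (simp add: abs_mult)
    also have "\<dots> \<le> \<epsilon> / 2 * 1 + \<epsilon> / 2"
    proof (rule add_mono)
      show "\<bar>?a - ?b\<bar> * ?p \<le> \<epsilon> / 2 * 1" using ab \<psi>01 \<epsilon> by (intro mult_mono) auto
      show "?b * \<bar>?p - ?q\<bar> \<le> \<epsilon> / 2"
      proof (cases "?b = 0")
        case False
        have "?b * \<bar>?p - ?q\<bar> \<le> 1 * (\<epsilon> / 2)" using pq[OF False] \<phi>01[OF j x] by (intro mult_mono) auto
        then show ?thesis by simp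
      qed (use \<epsilon> in simp)
    qed
    finally show "\<bar>\<Phi> j (g \<otimes> x) - \<Phi> j x\<bar> \<le> \<epsilon>" by simp
  next
    fix b assume "b \<in> B"
    then have b: "h b \<in> BH" "\<bar>real_of_int (\<tau> b)\<bar> \<le> 3 * u" by (auto simp: B_def R_def)
    obtain j where j: "j < D" "\<phi> j (h b) = 1" using BH(9)[OF b(1)] by blast
    define i :: nat where "i = (if real_of_int (\<tau> b) < - u then 0 else if real_of_int (\<tau> b) \<le> u then 1 else 2)"
    have i: "i < 3" "\<bar>real_of_int (\<tau> b) - 2 * u * (real i - 1)\<bar> \<le> u"
      using b(2) by (auto simp: i_def abs_le_iff)
    have "\<psi> i (\<tau> b) = 1" unfolding \<psi>_def by (rule trapezoid_eq_1[OF w i(2)])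
    then have "\<Phi> (i * D + j) b = 1" using j by (simp add: \<Phi>_def)
    moreover have "i * D + j < 3 * D"
    proof -
      have "i * D \<le> 2 * D" using i(1) by (intro mult_right_mono) auto
      then show ?thesis using j(1) by linarith
    qed
    ultimately show "\<exists>j<3 * D. \<Phi> j b = 1" by blast
  qed
  then show "\<exists>B \<phi>. bump_cover G (3 * D) \<epsilon> M B \<phi>" by blast
qed

lemma (in group) normal_central_powers:
  assumes z: "z \<in> carrier G" "\<And>g. g \<in> carrier G \<Longrightarrow> z \<otimes> g = g \<otimes> z"
  shows "range (\<lambda>n::int. z [^] n) \<lhd> G"
proof -
  have gen: "range (\<lambda>n::int. z [^] n) = generate G {z}" using generate_pow[OF z(1)] by auto
  have "generate G {z} \<lhd> G"
  proof (rule normal_generateI)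
    show "g \<otimes> x \<otimes> inv g \<in> {z}" if "x \<in> {z}" "g \<in> carrier G" for x g
      using that z(1) by (simp add: m_assoc flip: z(2))
  qed (use z in simp)
  then show ?thesis unfolding gen .
qed

text \<open>The induction hypothesis speaks of plain monoid records, the form in which the quotient
  arises, while \<open>G\<close> may be any extended record. Isolating the step allows its use
  inside the induction and once more for \<open>G\<close> itself. The count may drop by more than
  one; zero functions then fill up to \<open>3 ^ n\<close>.\<close>

lemma has_bump_covers_step:
  fixes G :: "('g, 'm) monoid_scheme"
  assumes "group G" "nilpotent_group G" "polycyclic_series G (carrier G) n"
    and IH: "\<And>(Q :: 'g monoid) k. k < n \<Longrightarrow> group Q \<Longrightarrow> nilpotent_group Q \<Longrightarrow>
      polycyclic_series Q (carrier Q) k \<Longrightarrow> has_bump_covers Q (3 ^ k)"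
  shows "has_bump_covers G (3 ^ n)"
proof -
  interpret group G by fact
  show ?thesis
  proof (cases "finite (carrier G)")
    case True
    show ?thesis by (rule has_bump_covers_mono[OF has_bump_covers_finite[OF True]]) simp
  next
    case False
    obtain z where z: "z \<in> carrier G" "\<And>g. g \<in> carrier G \<Longrightarrow> z \<otimes>\<^bsub>G\<^esub> g = g \<otimes>\<^bsub>G\<^esub> z"
      "\<And>m::int. z [^]\<^bsub>G\<^esub> m = \<one>\<^bsub>G\<^esub> \<Longrightarrow> m = 0"
      using nilpotent_central_infinite_order[OF assms(2) False assms(3)] by blast
    have "range (\<lambda>n::int. z [^]\<^bsub>G\<^esub> n) \<lhd> G" by (rule normal_central_powers[OF z(1,2)])
    then obtain Q :: "'g monoid" and \<pi> where Q: "group_hom G Q \<pi>" "\<pi> ` carrier G = carrier Q"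
      "kernel G Q \<pi> = range (\<lambda>n::int. z [^]\<^bsub>G\<^esub> n)"
      using normal.quotient_epimorphism by blast
    interpret \<pi>: group_hom G Q \<pi> by (rule Q(1))
    have "inj (\<lambda>n::int. z [^]\<^bsub>G\<^esub> n)"
    proof (rule injI)
      fix m n :: int assume "z [^]\<^bsub>G\<^esub> m = z [^]\<^bsub>G\<^esub> n"
      then have "z [^]\<^bsub>G\<^esub> (m - n) = \<one>\<^bsub>G\<^esub>" using z(1) by (simp add: int_pow_diff)
      from z(3)[OF this] show "m = n" by simp
    qed
    then have "infinite (kernel G Q \<pi>)" unfolding Q(3) using finite_imageD infinite_UNIV_int by blast
    moreover have "carrier G \<inter> kernel G Q \<pi> = kernel G Q \<pi>" by (auto simp: kernel_def)
    ultimately obtain k where k: "k < n" "polycyclic_series Q (carrier Q) k"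
      using \<pi>.polycyclic_series_image[OF assms(3)] unfolding Q(2) by auto
    have "has_bump_covers Q (3 ^ k)"
      by (rule IH[OF k(1) \<pi>.H.is_group \<pi>.nilpotent_group_image[OF Q(2) assms(2)] k(2)])
    then have "has_bump_covers G (3 * 3 ^ k)"
      using z by (intro \<pi>.has_bump_covers_central_extension[OF Q(2) z(1) _ _ Q(3)])
    moreover have "(3::nat) * 3 ^ k \<le> 3 ^ n"
      using k(1) power_increasing[of "Suc k" n "3::nat"] by simp
    ultimately show ?thesis by (rule has_bump_covers_mono)
  qed
qed

lemma has_bump_covers_monoid:
  fixes Q :: "'g monoid"
  assumes "group Q" "nilpotent_group Q" "polycyclic_series Q (carrier Q) n"
  shows "has_bump_covers Q (3 ^ n)"
  using assms
proof (induction n arbitrary: Q rule: less_induct)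
  case (less n)
  show ?case by (rule has_bump_covers_step[OF less.prems less.IH])
qed

lemma has_bump_covers_Hirsch_length:
  assumes "group G" "finitely_generated_group G" "nilpotent_group G"
  shows "has_bump_covers G (3 ^ Hirsch_length G)"
proof -
  have "polycyclic_series G (carrier G) (Hirsch_length G)"
    unfolding Hirsch_length_def
    using group.polycyclic_series_fg_nilpotent[OF assms] by (rule LeastI_ex)
  then show ?thesis
    by (rule has_bump_covers_step[OF assms(1,3) _ has_bump_covers_monoid])
qed

section \<open>The amenability dimension\<close>

lemma apply_bcontfun_sum:
  fixes f :: "'i \<Rightarrow> ('a::topological_space \<Rightarrow>\<^sub>C 'b::real_normed_vector)"
  shows "apply_bcontfun (\<Sum>i\<in>I. f i) x = (\<Sum>i\<in>I. apply_bcontfun (f i) x)"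
  by (induction I rule: infinite_finite_induct) (auto simp: zero_bcontfun.rep_eq plus_bcontfun.rep_eq)

text \<open>At a fixed point of \<open>X\<close>, disjoint supports leave at most one nonzero term
  in each of two families to be compared, so the difference of their sums is bounded independently
  of \<open>E\<close>.\<close>

lemma abs_sum_le_two_terms:
  fixes f :: "'i \<Rightarrow> real"
  assumes "finite E" "P \<subseteq> E" "Q \<subseteq> E" "card P \<le> 1" "card Q \<le> 1"
    and "\<And>h. h \<in> E \<Longrightarrow> h \<notin> P \<Longrightarrow> h \<notin> Q \<Longrightarrow> f h = 0"
    and "\<And>h. h \<in> E \<Longrightarrow> \<bar>f h\<bar> \<le> c" "0 \<le> c"
  shows "\<bar>\<Sum>h\<in>E. f h\<bar> \<le> 2 * c"
proof -
  have "(\<Sum>h\<in>E. f h) = (\<Sum>h\<in>P \<union> Q. f h)"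
    using assms(1-3,6) by (intro sum.mono_neutral_right) auto
  also have "\<bar>\<dots>\<bar> \<le> (\<Sum>h\<in>P \<union> Q. c)"
    using assms(2,3,7) by (intro order_trans[OF sum_abs] sum_mono) auto
  also have "\<dots> = real (card (P \<union> Q)) * c" by simp
  also have "\<dots> \<le> 2 * c"
    using assms(4,5,8) card_Un_le[of P Q] by (intro mult_right_mono) auto
  finally show ?thesis .
qed

lemma abs_divide_diff_le:
  fixes a b s t :: real
  assumes "\<bar>a - b\<bar> \<le> e" "\<bar>s - t\<bar> \<le> e'" "0 \<le> b" "b \<le> 1" "1 \<le> s" "1 \<le> t"
  shows "\<bar>a / s - b / t\<bar> \<le> e + e'"
proof -
  have "a / s - b / t = (a - b) / s + b * (t - s) / (s * t)"
    using assms(5,6) by (simp add: field_simps)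
  also have "\<bar>\<dots>\<bar> \<le> \<bar>(a - b) / s\<bar> + \<bar>b * (t - s) / (s * t)\<bar>" by (rule abs_triangle_ineq)
  also have "\<dots> \<le> e + e'"
  proof (rule add_mono)
    have "\<bar>(a - b) / s\<bar> \<le> \<bar>a - b\<bar> / 1" using assms(5) by (simp add: abs_divide divide_le_eq mult_le_cancel_left1 mult_left_le)
    then show "\<bar>(a - b) / s\<bar> \<le> e" using assms(1) by simp
    have st: "1 \<le> s * t" using assms(5,6) mult_mono[of 1 s 1 t] by simp
    have "\<bar>b * (t - s) / (s * t)\<bar> = (b * \<bar>t - s\<bar>) / (s * t)" using st assms(3,5,6) by (simp add: abs_mult)
    also have "\<dots> \<le> (b * \<bar>t - s\<bar>) / 1" using st assms(3) by (intro divide_left_mono) auto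
    also have "\<dots> \<le> 1 * \<bar>t - s\<bar>" using mult_right_mono[OF assms(4) abs_ge_zero[of "t - s"]] by simp
    finally show "\<bar>b * (t - s) / (s * t)\<bar> \<le> e'" using assms(2) by simp
  qed
  finally show ?thesis .
qed

definition real_bcontfun :: "('x::metric_space \<Rightarrow> real) \<Rightarrow> 'x \<Rightarrow>\<^sub>C complex" where
  "real_bcontfun f = Bcontfun (\<lambda>x. complex_of_real (f x))"

lemma real_bcontfun_apply:
  assumes "continuous_on UNIV f" "\<And>x. 0 \<le> f x" "\<And>x. f x \<le> 1"
  shows "apply_bcontfun (real_bcontfun f) x = complex_of_real (f x)"
proof -
  have "(\<lambda>x. complex_of_real (f x)) \<in> bcontfun"
    using assms by (intro bcontfun_normI[where b = 1] continuous_intros) auto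
  then show ?thesis by (simp add: real_bcontfun_def Bcontfun_inverse)
qed

lemma real_bcontfun_positive_contraction:
  assumes f: "continuous_on UNIV f" "\<And>x. 0 \<le> f x" "\<And>x. f x \<le> 1"
  shows "real_bcontfun f \<in> positive_contractions"
proof -
  have g: "apply_bcontfun (real_bcontfun (\<lambda>x. sqrt (f x))) x = complex_of_real (sqrt (f x))" for x
    using f by (intro real_bcontfun_apply continuous_intros) auto
  have "real_bcontfun f = adj (real_bcontfun (\<lambda>x. sqrt (f x))) * real_bcontfun (\<lambda>x. sqrt (f x))"
    using f(2) by (intro bcontfun_eqI)
      (simp add: g real_bcontfun_apply[OF f] adj_complex_def flip: of_real_mult)
  moreover have "norm (real_bcontfun f) \<le> 1"
    using f(2,3) by (intro norm_bound) (simp add: real_bcontfun_apply[OF f])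
  ultimately show ?thesis unfolding positive_contractions_def positive_def by blast
qed

lemma bcontfun_mult_commute:
  fixes a b :: "'x::metric_space \<Rightarrow>\<^sub>C complex"
  shows "a * b = b * a"
  by (intro bcontfun_eqI) (simp add: mult.commute)

text \<open>A version in real functions before normalisation. In place of a sum equal to one, some
  function takes the value \<open>1\<close> at each point, and equivariance is asked for one
  \<open>h\<close> at a time; disjointness takes care of sums over finite sets.\<close>

definition equivariant_bumps ::
  "('g, 'm) monoid_scheme \<Rightarrow> ('g \<Rightarrow> 'x::metric_space \<Rightarrow> 'x) \<Rightarrow> nat \<Rightarrow> real \<Rightarrow> 'g set \<Rightarrow>
    (nat \<Rightarrow> 'g \<Rightarrow> 'x \<Rightarrow> real) \<Rightarrow> bool" where
  "equivariant_bumps G \<alpha> d \<epsilon> M u \<longleftrightarrow>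
     (\<forall>l\<le>d. finite {g \<in> carrier G. \<exists>x. u l g x \<noteq> 0}) \<and>
     (\<forall>l\<le>d. \<forall>g\<in>carrier G. continuous_on UNIV (u l g)) \<and>
     (\<forall>l\<le>d. \<forall>g\<in>carrier G. \<forall>x. 0 \<le> u l g x \<and> u l g x \<le> 1) \<and>
     (\<forall>l\<le>d. \<forall>g\<in>carrier G. \<forall>h\<in>carrier G. \<forall>x. g \<noteq> h \<longrightarrow> u l g x = 0 \<or> u l h x = 0) \<and>
     (\<forall>l\<le>d. \<forall>g\<in>M. \<forall>h\<in>carrier G. \<forall>x. \<bar>u l h (\<alpha> (inv\<^bsub>G\<^esub> g) x) - u l (g \<otimes>\<^bsub>G\<^esub> h) x\<bar> \<le> \<epsilon>) \<and>
     (\<forall>x. \<exists>l\<le>d. \<exists>g\<in>carrier G. u l g x = 1)"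

text \<open>Dividing by the total sum \<open>s \<ge> 1\<close> gives a partition of unity, so the
  first approximation is exact, and commutators vanish in a commutative algebra. Only equivariance
  costs an error.\<close>

lemma amenability_dim_le_if_equivariant_bumps:
  fixes G :: "('g, 'm) monoid_scheme" and \<alpha> :: "'g \<Rightarrow> 'x::metric_space \<Rightarrow> 'x"
  assumes act: "topological_action G \<alpha>"
    and bumps: "\<And>\<epsilon> M. \<epsilon> > 0 \<Longrightarrow> finite M \<Longrightarrow> M \<subseteq> carrier G \<Longrightarrow> \<exists>u. equivariant_bumps G \<alpha> d \<epsilon> M u"
  shows "amenability_dim_le G (induced_action G \<alpha>) d"
  unfolding amenability_dim_le_def
proof (intro allI impI, elim conjE)
  fix \<epsilon> :: real and M :: "'g set" and F :: "('x \<Rightarrow>\<^sub>C complex) set"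
  assume \<epsilon>: "0 < \<epsilon>" and M: "finite M" "M \<subseteq> carrier G" and F: "finite F"
  interpret topological_action G \<alpha> by fact
  define K where "K = 1 + (\<Sum>a\<in>F. norm a)"
  have K: "norm a \<le> K" if "a \<in> F" for a
    using member_le_sum[OF that _ F, of norm] by (simp add: K_def)
  have K_pos: "0 < K" unfolding K_def by (intro add_pos_nonneg sum_nonneg) auto
  \<comment> \<open>One \<open>e\<close> accounts for the numerators and \<open>(d + 1) * e\<close>
    for the denominator, two summands survive at each point, and \<open>K\<close> bounds the norms
    in \<open>F\<close>.\<close>
  define c where "c = 2 * (real d + 2) * K"
  define e where "e = \<epsilon> / c"
  have "0 < c" using K_pos by (simp add: c_def)
  then have e_pos: "0 < e" and "e * c = \<epsilon>" using \<epsilon> by (simp_all add: e_def)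
  then have e: "0 < e" "2 * ((real d + 2) * e) * K = \<epsilon>" by (simp_all add: c_def algebra_simps)
  obtain u where "equivariant_bumps G \<alpha> d e M u" using bumps[OF e(1) M] by blast
  then have fin: "\<And>l. l \<le> d \<Longrightarrow> finite {g \<in> carrier G. \<exists>x. u l g x \<noteq> 0}"
    and cont: "\<And>l g. l \<le> d \<Longrightarrow> g \<in> carrier G \<Longrightarrow> continuous_on UNIV (u l g)"
    and u0: "\<And>l g x. l \<le> d \<Longrightarrow> g \<in> carrier G \<Longrightarrow> 0 \<le> u l g x"
    and u1: "\<And>l g x. l \<le> d \<Longrightarrow> g \<in> carrier G \<Longrightarrow> u l g x \<le> 1"
    and disj: "\<And>l g h x. l \<le> d \<Longrightarrow> g \<in> carrier G \<Longrightarrow> h \<in> carrier G \<Longrightarrow> u l g x \<noteq> 0 \<Longrightarrow> u l h x \<noteq> 0 \<Longrightarrow> g = h"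
    and equi: "\<And>l g h x. l \<le> d \<Longrightarrow> g \<in> M \<Longrightarrow> h \<in> carrier G \<Longrightarrow>
      \<bar>u l h (\<alpha> (inv\<^bsub>G\<^esub> g) x) - u l (g \<otimes>\<^bsub>G\<^esub> h) x\<bar> \<le> e"
    and cover: "\<And>x. \<exists>l\<le>d. \<exists>g\<in>carrier G. u l g x = 1"
    unfolding equivariant_bumps_def by meson+
  define S where "S = (\<Union>l\<le>d. {g \<in> carrier G. \<exists>x. u l g x \<noteq> 0})"
  have S: "finite S" "S \<subseteq> carrier G" unfolding S_def using fin by auto
  have S_I: "g \<in> S" if "l \<le> d" "g \<in> carrier G" "u l g x \<noteq> 0" for l g x
    using that unfolding S_def by blast
  define v where "v l x = (\<Sum>g\<in>S. u l g x)" for l x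
  have v_eq: "v l x = u l h x" if l: "l \<le> d" and h: "h \<in> carrier G" "u l h x \<noteq> 0" for l h x
  proof -
    have "v l x = u l h x + (\<Sum>g\<in>S - {h}. u l g x)"
      unfolding v_def using S(1) S_I[OF l h] by (rule sum.remove)
    also have "(\<Sum>g\<in>S - {h}. u l g x) = 0"
      using disj[OF l h(1) _ h(2)] S(2) by (intro sum.neutral) blast
    finally show ?thesis by simp
  qed
  have v_0: "v l x = 0" if "\<And>h. h \<in> carrier G \<Longrightarrow> u l h x = 0" for l x
    unfolding v_def using that S(2) by (intro sum.neutral) blast
  have v_nonneg: "0 \<le> v l x" if "l \<le> d" for l x
    unfolding v_def using u0[OF that] S(2) by (intro sum_nonneg) blast
  have v_ge: "u l h x \<le> v l x" if "l \<le> d" "h \<in> carrier G" for l h x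
    using v_eq[OF that, of x] v_nonneg[OF that(1), of x] by (cases "u l h x = 0") auto
  \<comment> \<open>The size of \<open>S\<close> is unknown when \<open>e\<close> is chosen, so a
    termwise estimate would not do. At each point \<open>v l\<close> has at most one nonzero
    summand, and comparing that with the summand of the translated index gives the error
    \<open>e\<close> in each direction.\<close>
  have v_equi: "\<bar>v l (\<alpha> (inv\<^bsub>G\<^esub> g) x) - v l x\<bar> \<le> e" if l: "l \<le> d" and g: "g \<in> M" for l g x
  proof -
    let ?y = "\<alpha> (inv\<^bsub>G\<^esub> g) x"
    have gG: "g \<in> carrier G" using g M(2) by blast
    have "v l ?y \<le> v l x + e"
    proof (cases "\<exists>h\<in>carrier G. u l h ?y \<noteq> 0")
      case True
      then obtain h where h: "h \<in> carrier G" "u l h ?y \<noteq> 0" by blast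
      have "u l (g \<otimes>\<^bsub>G\<^esub> h) x \<le> v l x" using v_ge l gG h(1) by simp
      then show ?thesis using v_eq[OF l h] equi[OF l g h(1), of x] by linarith
    next
      case False
      then have "v l ?y = 0" using v_0 by blast
      then show ?thesis using v_nonneg[OF l, of x] e(1) by linarith
    qed
    moreover have "v l x \<le> v l ?y + e"
    proof (cases "\<exists>h\<in>carrier G. u l h x \<noteq> 0")
      case True
      then obtain h where h: "h \<in> carrier G" "u l h x \<noteq> 0" by blast
      have h': "inv\<^bsub>G\<^esub> g \<otimes>\<^bsub>G\<^esub> h \<in> carrier G" "g \<otimes>\<^bsub>G\<^esub> (inv\<^bsub>G\<^esub> g \<otimes>\<^bsub>G\<^esub> h) = h"
        using gG h(1) by (simp_all flip: G.m_assoc)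
      show ?thesis
        using v_eq[OF l h] equi[OF l g h'(1), of x] v_ge[OF l h'(1), of ?y] unfolding h'(2) by linarith
    next
      case False
      then have "v l x = 0" using v_0 by blast
      then show ?thesis using v_nonneg[OF l, of ?y] e(1) by linarith
    qed
    ultimately show ?thesis by linarith
  qed
  define s where "s x = (\<Sum>l\<le>d. v l x)" for x
  have s1: "1 \<le> s x" for x
  proof -
    obtain l g where "l \<le> d" "g \<in> carrier G" "u l g x = 1" using cover by blast
    then have "1 = v l x" using v_eq[of l g x] by simp
    also have "\<dots> \<le> s x"
      unfolding s_def using v_nonneg \<open>l \<le> d\<close> by (intro member_le_sum) auto
    finally show ?thesis .
  qed
  have s_equi: "\<bar>s (\<alpha> (inv\<^bsub>G\<^esub> g) x) - s x\<bar> \<le> (real d + 1) * e" if g: "g \<in> M" for g x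
  proof -
    have "s (\<alpha> (inv\<^bsub>G\<^esub> g) x) - s x = (\<Sum>l\<le>d. v l (\<alpha> (inv\<^bsub>G\<^esub> g) x) - v l x)"
      by (simp add: s_def sum_subtractf)
    also have "\<bar>\<dots>\<bar> \<le> (\<Sum>l\<le>d. e)" using v_equi g by (intro order_trans[OF sum_abs] sum_mono) auto
    finally show ?thesis by (simp add: algebra_simps)
  qed
  have s_cont: "continuous_on UNIV s"
    unfolding s_def v_def using cont S(2) by (intro continuous_intros) auto
  define w where "w l g x = u l g x / s x" for l g x
  have w_cont: "continuous_on UNIV (w l g)" if "l \<le> d" "g \<in> carrier G" for l g
  proof -
    have "s x \<noteq> 0" for x using s1[of x] by auto
    then show ?thesis unfolding w_def using cont[OF that] s_cont by (intro continuous_on_divide) auto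
  qed
  have w01: "0 \<le> w l g x" "w l g x \<le> 1" if "l \<le> d" "g \<in> carrier G" for l g x
    using u0[OF that, of x] u1[OF that, of x] s1[of x] by (auto simp: w_def divide_le_eq)
  define \<mu> where "\<mu> l g = real_bcontfun (w l g)" for l g
  have \<mu>: "apply_bcontfun (\<mu> l g) x = complex_of_real (w l g x)" if "l \<le> d" "g \<in> carrier G" for l g x
    unfolding \<mu>_def using w_cont w01 that by (intro real_bcontfun_apply) auto
  have \<mu>_supp: "g \<in> S" if l: "l \<le> d" and g: "g \<in> carrier G" and nz: "\<mu> l g \<noteq> 0" for l g
  proof (rule ccontr)
    assume "g \<notin> S"
    then have "u l g x = 0" for x using S_I[OF l g, of x] by blast
    then have "\<mu> l g = 0" by (intro bcontfun_eqI) (simp add: \<mu>[OF l g] w_def zero_bcontfun.rep_eq)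
    then show False using nz by simp
  qed
  have w_equi: "\<bar>w l h (\<alpha> (inv\<^bsub>G\<^esub> g) x) - w l (g \<otimes>\<^bsub>G\<^esub> h) x\<bar> \<le> (real d + 2) * e"
    if l: "l \<le> d" and g: "g \<in> M" and h: "h \<in> carrier G" for l g h x
  proof -
    have gG: "g \<in> carrier G" using g M(2) by blast
    have "\<bar>w l h (\<alpha> (inv\<^bsub>G\<^esub> g) x) - w l (g \<otimes>\<^bsub>G\<^esub> h) x\<bar> \<le> e + (real d + 1) * e"
      unfolding w_def
      by (rule abs_divide_diff_le[OF equi[OF l g h] s_equi[OF g] u0[OF l] u1[OF l] s1 s1]) (use gG h in auto)
    then show ?thesis by (simp add: algebra_simps)
  qed
  have sum_one: "(\<Sum>l\<le>d. \<Sum>g | g \<in> carrier G \<and> \<mu> l g \<noteq> 0. \<mu> l g) * a = a" for a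
  proof (rule bcontfun_eqI)
    fix x
    have "(\<Sum>g | g \<in> carrier G \<and> \<mu> l g \<noteq> 0. apply_bcontfun (\<mu> l g) x) = complex_of_real (v l x / s x)"
      if l: "l \<le> d" for l
    proof -
      have "(\<Sum>g | g \<in> carrier G \<and> \<mu> l g \<noteq> 0. apply_bcontfun (\<mu> l g) x) = (\<Sum>g\<in>S. apply_bcontfun (\<mu> l g) x)"
        using S \<mu>_supp[OF l] by (intro sum.mono_neutral_left) (auto simp: zero_bcontfun.rep_eq)
      also have "\<dots> = (\<Sum>g\<in>S. complex_of_real (w l g x))"
        using \<mu>[OF l] S(2) by (intro sum.cong) auto
      also have "\<dots> = complex_of_real (v l x / s x)"
        by (simp add: w_def v_def sum_divide_distrib)
      finally show ?thesis .
    qed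
    then have "apply_bcontfun (\<Sum>l\<le>d. \<Sum>g | g \<in> carrier G \<and> \<mu> l g \<noteq> 0. \<mu> l g) x
        = (\<Sum>l\<le>d. complex_of_real (v l x / s x))"
      by (simp add: apply_bcontfun_sum)
    also have "\<dots> = complex_of_real ((\<Sum>l\<le>d. v l x) / s x)" by (simp add: sum_divide_distrib)
    also have "\<dots> = 1" using s1[of x] by (simp add: s_def[symmetric])
    finally show "apply_bcontfun ((\<Sum>l\<le>d. \<Sum>g | g \<in> carrier G \<and> \<mu> l g \<noteq> 0. \<mu> l g) * a) x = apply_bcontfun a x"
      by simp
  qed
  have equivariance: "norm ((\<Sum>h\<in>E. induced_action G \<alpha> g (\<mu> l h) - \<mu> l (g \<otimes>\<^bsub>G\<^esub> h)) * a) \<le> \<epsilon>"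
    if a: "a \<in> F" and l: "l \<le> d" and g: "g \<in> M" and E: "finite E" "E \<subseteq> carrier G" for a l g E
  proof -
    have gG: "g \<in> carrier G" using g M(2) by blast
    have "norm (\<Sum>h\<in>E. induced_action G \<alpha> g (\<mu> l h) - \<mu> l (g \<otimes>\<^bsub>G\<^esub> h)) \<le> 2 * ((real d + 2) * e)"
    proof (rule norm_bound)
      fix x
      let ?y = "\<alpha> (inv\<^bsub>G\<^esub> g) x"
      let ?f = "\<lambda>h. w l h ?y - w l (g \<otimes>\<^bsub>G\<^esub> h) x"
      have "apply_bcontfun (\<Sum>h\<in>E. induced_action G \<alpha> g (\<mu> l h) - \<mu> l (g \<otimes>\<^bsub>G\<^esub> h)) x
          = (\<Sum>h\<in>E. complex_of_real (?f h))"
        unfolding apply_bcontfun_sum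
      proof (rule sum.cong)
        fix h assume "h \<in> E"
        then have h: "h \<in> carrier G" using E by blast
        show "apply_bcontfun (induced_action G \<alpha> g (\<mu> l h) - \<mu> l (g \<otimes>\<^bsub>G\<^esub> h)) x = complex_of_real (?f h)"
          using \<mu>[OF l h] \<mu>[OF l, of "g \<otimes>\<^bsub>G\<^esub> h"] h gG
          by (simp add: minus_bcontfun.rep_eq induced_action_apply[OF act])
      qed simp
      also have "norm \<dots> = \<bar>\<Sum>h\<in>E. ?f h\<bar>" by (simp flip: of_real_sum of_real_diff)
      also have "\<dots> \<le> 2 * ((real d + 2) * e)"
      proof (rule abs_sum_le_two_terms[OF E(1), of "{h \<in> E. u l h ?y \<noteq> 0}" "{h \<in> E. u l (g \<otimes>\<^bsub>G\<^esub> h) x \<noteq> 0}"])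
        have "h = h'" if "h \<in> {h \<in> E. u l h ?y \<noteq> 0}" "h' \<in> {h \<in> E. u l h ?y \<noteq> 0}" for h h'
          using that disj[OF l, of h h' ?y] E(2) by blast
        then show "card {h \<in> E. u l h ?y \<noteq> 0} \<le> 1"
          using E(1) by (simp add: card_le_Suc0_iff_eq)
        have "h = h'" if "h \<in> {h \<in> E. u l (g \<otimes>\<^bsub>G\<^esub> h) x \<noteq> 0}" "h' \<in> {h \<in> E. u l (g \<otimes>\<^bsub>G\<^esub> h) x \<noteq> 0}" for h h'
        proof -
          have c: "h \<in> carrier G" "h' \<in> carrier G" using that E(2) by auto
          then have "g \<otimes>\<^bsub>G\<^esub> h = g \<otimes>\<^bsub>G\<^esub> h'"
            using that gG by (intro disj[OF l, of _ _ x]) auto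
          then show ?thesis using c gG by simp
        qed
        then show "card {h \<in> E. u l (g \<otimes>\<^bsub>G\<^esub> h) x \<noteq> 0} \<le> 1"
          using E(1) by (simp add: card_le_Suc0_iff_eq)
        show "\<bar>?f h\<bar> \<le> (real d + 2) * e" if "h \<in> E" for h
          using w_equi[OF l g, of h x] that E(2) by blast
        show "0 \<le> (real d + 2) * e" using e(1) by simp
      qed (auto simp: w_def)
      finally show "norm (apply_bcontfun (\<Sum>h\<in>E. induced_action G \<alpha> g (\<mu> l h) - \<mu> l (g \<otimes>\<^bsub>G\<^esub> h)) x)
          \<le> 2 * ((real d + 2) * e)" .
    qed
    then have "norm (\<Sum>h\<in>E. induced_action G \<alpha> g (\<mu> l h) - \<mu> l (g \<otimes>\<^bsub>G\<^esub> h)) * norm a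
        \<le> 2 * ((real d + 2) * e) * K"
      using K[OF a] e(1) by (intro mult_mono) auto
    then show ?thesis unfolding e(2) using norm_mult_ineq order_trans by blast
  qed
  show "\<exists>\<mu> :: nat \<Rightarrow> 'g \<Rightarrow> ('x \<Rightarrow>\<^sub>C complex).
        (\<forall>l\<le>d. finite {g \<in> carrier G. \<mu> l g \<noteq> 0}) \<and>
        (\<forall>l\<le>d. \<forall>g\<in>carrier G. \<mu> l g \<in> positive_contractions) \<and>
        (\<forall>a\<in>F. norm ((\<Sum>l\<le>d. \<Sum>g | g \<in> carrier G \<and> \<mu> l g \<noteq> 0. \<mu> l g) * a - a) \<le> \<epsilon>) \<and>
        (\<forall>l\<le>d. \<forall>g\<in>carrier G. \<forall>h\<in>carrier G. g \<noteq> h \<longrightarrow> \<mu> l g * \<mu> l h = 0) \<and>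
        (\<forall>a\<in>F. \<forall>l\<le>d. \<forall>g\<in>M. \<forall>E. finite E \<and> E \<subseteq> carrier G \<longrightarrow>
          norm ((\<Sum>h\<in>E. induced_action G \<alpha> g (\<mu> l h) - \<mu> l (g \<otimes>\<^bsub>G\<^esub> h)) * a) \<le> \<epsilon>) \<and>
        (\<forall>a\<in>F. \<forall>l\<le>d. \<forall>E. finite E \<and> E \<subseteq> carrier G \<longrightarrow>
          norm ((\<Sum>g\<in>E. \<mu> l g) * a - a * (\<Sum>g\<in>E. \<mu> l g)) \<le> \<epsilon>)"
  proof (intro exI[of _ \<mu>] conjI allI ballI impI)
    show "finite {g \<in> carrier G. \<mu> l g \<noteq> 0}" if l: "l \<le> d" for l
      by (rule finite_subset[OF _ S(1)]) (use \<mu>_supp[OF l] in blast)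
    show "\<mu> l g \<in> positive_contractions" if "l \<le> d" "g \<in> carrier G" for l g
      unfolding \<mu>_def using w_cont w01 that by (intro real_bcontfun_positive_contraction) auto
    show "norm ((\<Sum>l\<le>d. \<Sum>g | g \<in> carrier G \<and> \<mu> l g \<noteq> 0. \<mu> l g) * a - a) \<le> \<epsilon>" if "a \<in> F" for a
      unfolding sum_one using \<epsilon> by simp
    show "\<mu> l g * \<mu> l h = 0" if l: "l \<le> d" and gh: "g \<in> carrier G" "h \<in> carrier G" "g \<noteq> h" for l g h
    proof (rule bcontfun_eqI)
      fix x
      have "u l g x = 0 \<or> u l h x = 0" using disj[OF l gh(1,2)] gh(3) by blast
      then show "apply_bcontfun (\<mu> l g * \<mu> l h) x = apply_bcontfun 0 x"
        using \<mu>[OF l gh(1)] \<mu>[OF l gh(2)] by (auto simp: w_def zero_bcontfun.rep_eq)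
    qed
    show "norm ((\<Sum>h\<in>E. induced_action G \<alpha> g (\<mu> l h) - \<mu> l (g \<otimes>\<^bsub>G\<^esub> h)) * a) \<le> \<epsilon>"
      if "a \<in> F" "l \<le> d" "g \<in> M" "finite E \<and> E \<subseteq> carrier G" for a l g E
      using equivariance that by blast
    show "norm ((\<Sum>g\<in>E. \<mu> l g) * a - a * (\<Sum>g\<in>E. \<mu> l g)) \<le> \<epsilon>" for a l E
      using \<epsilon> by (simp add: bcontfun_mult_commute[of a])
  qed
qed

section \<open>Equivariant functions from marker sets\<close>

lemma marker_functions:
  fixes Z :: "nat \<Rightarrow> 'x::metric_space set" and \<gamma> :: "'b \<Rightarrow> 'x \<Rightarrow> 'x"
  assumes cpt: "compact (UNIV :: 'x set)" and Z: "\<And>k. open (Z k)" and B: "finite B"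
    and \<gamma>: "\<And>b. b \<in> B \<Longrightarrow> continuous_on UNIV (\<gamma> b)"
    and cover: "\<And>x. \<exists>k\<le>d. \<exists>b\<in>B. \<gamma> b x \<in> Z k"
  obtains \<theta> :: "nat \<Rightarrow> 'x \<Rightarrow> real" where "\<And>k. continuous_on UNIV (\<theta> k)"
    "\<And>k x. 0 \<le> \<theta> k x" "\<And>k x. \<theta> k x \<le> 1" "\<And>k x. \<theta> k x \<noteq> 0 \<Longrightarrow> x \<in> Z k"
    "\<And>x. \<exists>k\<le>d. \<exists>b\<in>B. \<theta> k (\<gamma> b x) = 1"
proof -
  \<comment> \<open>\<open>infdist\<close> to the empty set is zero by convention, the wrong value
    for \<open>Z k = UNIV\<close>.\<close>
  define \<rho> where "\<rho> k x = (if Z k = UNIV then 1 else infdist x (- Z k))" for k x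
  have \<rho>_cont: "continuous_on UNIV (\<rho> k)" for k
    by (cases "Z k = UNIV") (auto simp: \<rho>_def intro!: continuous_intros)
  have \<rho>_nonneg: "0 \<le> \<rho> k x" for k x by (simp add: \<rho>_def infdist_nonneg)
  have \<rho>_pos: "0 < \<rho> k x \<longleftrightarrow> x \<in> Z k" for k x
  proof (cases "Z k = UNIV")
    case False
    then have "infdist x (- Z k) = 0 \<longleftrightarrow> x \<in> - Z k"
      using in_closed_iff_infdist_zero[of "- Z k" x] Z[of k] by (auto simp: closed_def)
    then show ?thesis using False infdist_nonneg[of x "- Z k"] by (auto simp: \<rho>_def)
  qed (simp add: \<rho>_def)
  define h where "h x = (\<Sum>(k, b)\<in>{..d} \<times> B. \<rho> k (\<gamma> b x))" for x
  obtain c where c: "0 < c" "\<And>x. c \<le> h x"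
  proof (rule compact_positive_lower_bound[OF cpt, of h])
    show "continuous_on UNIV h"
      unfolding h_def
      by (auto simp: case_prod_beta intro!: continuous_on_sum continuous_on_compose2[OF \<rho>_cont \<gamma>])
    fix x
    obtain k b where "k \<le> d" "b \<in> B" "\<gamma> b x \<in> Z k" using cover by blast
    then show "0 < h x"
      unfolding h_def using B \<rho>_nonneg \<rho>_pos by (intro sum_pos2[of _ "(k, b)"]) auto
  qed (rule that)
  define m where "m = real (card ({..d} \<times> B))"
  have m: "0 < m"
  proof -
    have "B \<noteq> {}" using cover by blast
    then show ?thesis unfolding m_def of_nat_0_less_iff card_gt_0_iff using B by auto
  qed
  \<comment> \<open>A sum of \<open>m\<close> terms that is at least \<open>c\<close> has a term of
    at least \<open>c / m\<close>, where the rescaled function is cut off to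
    \<open>1\<close>.\<close>
  define c' where "c' = c / m"
  have c': "0 < c'" using c(1) m by (simp add: c'_def)
  have "\<exists>k\<le>d. \<exists>b\<in>B. c' \<le> \<rho> k (\<gamma> b x)" for x
  proof (rule ccontr)
    assume "\<not> ?thesis"
    then have "\<rho> k (\<gamma> b x) < c'" if "k \<le> d" "b \<in> B" for k b
      using that by (meson not_le)
    then have "\<forall>kb\<in>{..d} \<times> B. (case kb of (k, b) \<Rightarrow> \<rho> k (\<gamma> b x)) < c'" by simp
    moreover have "{..d} \<times> B \<noteq> {}" using cover by auto
    ultimately have "h x < (\<Sum>kb\<in>{..d} \<times> B. c')"
      unfolding h_def using B by (intro sum_strict_mono) auto
    also have "\<dots> = c" using m by (simp add: c'_def m_def)
    finally show False using c(2)[of x] by simp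
  qed
  note large = this
  show ?thesis
  proof (rule that[of "\<lambda>k x. min 1 (\<rho> k x / c')"])
    show "continuous_on UNIV (\<lambda>x. min 1 (\<rho> k x / c'))" for k
      using c' by (intro continuous_intros \<rho>_cont) auto
    show "0 \<le> min 1 (\<rho> k x / c')" "min 1 (\<rho> k x / c') \<le> 1" for k x
      using \<rho>_nonneg c' by auto
    show "x \<in> Z k" if "min 1 (\<rho> k x / c') \<noteq> 0" for k x
      using that \<rho>_nonneg[of k x] \<rho>_pos[of k x] by (cases "\<rho> k x = 0") auto
    fix x
    obtain k b where "k \<le> d" "b \<in> B" "c' \<le> \<rho> k (\<gamma> b x)" using large by blast
    then show "\<exists>k\<le>d. \<exists>b\<in>B. min 1 (\<rho> k (\<gamma> b x) / c') = 1"
      using c' by (intro exI[of _ k] conjI bexI[of _ b]) (auto simp: min_def le_divide_eq)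
  qed
qed

text \<open>The function for \<open>g\<close> is a bump value at \<open>g\<close> times a marker
  function at \<open>g^-1 x\<close>. If those for \<open>g \<noteq> h\<close> were both nonzero at
  \<open>x\<close>, then \<open>g^-1 h\<close> in \<open>B\<close> would carry a point of the marker
  set into it. If \<open>b\<close> moves \<open>x\<close> to where a marker function is
  \<open>1\<close>, then \<open>g = b^-1\<close> lies in \<open>B\<close> and some bump function is
  \<open>1\<close> at \<open>g\<close>. Indices start at \<open>0\<close>, so \<open>N\<close> is
  one less than the number of pairs.\<close>

lemma equivariant_bumps_exist:
  fixes \<alpha> :: "'g \<Rightarrow> 'x::metric_space \<Rightarrow> 'x"
  assumes act: "topological_action G \<alpha>" and free: "free_action G \<alpha>" and cpt: "compact (UNIV :: 'x set)"
    and dim: "covering_dim_le (euclidean :: 'x topology) d"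
    and bump: "has_bump_covers G D" and D: "0 < D" and N: "Suc N = D * (d + 1)"
    and \<epsilon>: "0 < \<epsilon>" and M: "finite M" "M \<subseteq> carrier G"
  shows "\<exists>u. equivariant_bumps G \<alpha> N \<epsilon> M u"
proof -
  interpret topological_action G \<alpha> by fact
  obtain B \<phi> where "bump_cover G D \<epsilon> M B \<phi>"
    using bump \<epsilon> M unfolding has_bump_covers_def by blast
  note bump_cover = this and B = bump_coverD[OF this]
  obtain Z where Z: "\<And>k. open (Z k)"
    "\<And>k b x. b \<in> B \<Longrightarrow> b \<noteq> \<one>\<^bsub>G\<^esub> \<Longrightarrow> x \<in> Z k \<Longrightarrow> \<alpha> b x \<notin> Z k"
    "\<And>x. \<exists>k\<le>d. \<exists>b\<in>B. \<alpha> b x \<in> Z k"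
    using free_action_marker_sets[OF act free cpt dim B(1,2,3,4)] by metis
  obtain \<theta> where \<theta>: "\<And>k. continuous_on UNIV (\<theta> k)" "\<And>k x. 0 \<le> \<theta> k x" "\<And>k x. \<theta> k x \<le> (1::real)"
    "\<And>k x. \<theta> k x \<noteq> 0 \<Longrightarrow> x \<in> Z k" "\<And>x. \<exists>k\<le>d. \<exists>b\<in>B. \<theta> k (\<alpha> b x) = 1"
  proof (rule marker_functions[OF cpt Z(1) B(1) _ Z(3)])
    show "continuous_on UNIV (\<alpha> b)" if "b \<in> B" for b
      by (rule continuous_on_act) (use that B(2) in blast)
  qed (rule that)
  define u where "u l g x = \<phi> (l mod D) g * \<theta> (l div D) (\<alpha> (inv\<^bsub>G\<^esub> g) x)" for l g x
  have lD: "l mod D < D" for l using D by simp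
  have "equivariant_bumps G \<alpha> N \<epsilon> M u"
    unfolding equivariant_bumps_def
  proof (intro conjI allI ballI impI)
    show "finite {g \<in> carrier G. \<exists>x. u l g x \<noteq> 0}" for l
      by (rule finite_subset[OF _ G.bump_cover_finite_support[OF bump_cover lD[of l]]]) (auto simp: u_def)
    show "continuous_on UNIV (u l g)" if "g \<in> carrier G" for l g
      unfolding u_def using that
      by (intro continuous_intros continuous_on_compose2[OF \<theta>(1) continuous_on_act]) auto
    show "0 \<le> u l g x" "u l g x \<le> 1" if "g \<in> carrier G" for l g x
      using B(5,6)[OF lD that] \<theta>(2,3) by (auto simp: u_def mult_le_one)
  next
    fix l g h x assume g: "g \<in> carrier G" and h: "h \<in> carrier G" and "g \<noteq> h"
    show "u l g x = 0 \<or> u l h x = 0"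
    proof (rule ccontr)
      assume "\<not> ?thesis"
      then have nz: "\<phi> (l mod D) g \<noteq> 0" "\<phi> (l mod D) h \<noteq> 0"
        and z: "\<alpha> (inv\<^bsub>G\<^esub> g) x \<in> Z (l div D)" "\<alpha> (inv\<^bsub>G\<^esub> h) x \<in> Z (l div D)"
        using \<theta>(4) by (auto simp: u_def)
      have b: "inv\<^bsub>G\<^esub> g \<otimes>\<^bsub>G\<^esub> h \<in> B" by (rule B(7)[OF lD g h nz])
      have "inv\<^bsub>G\<^esub> g \<otimes>\<^bsub>G\<^esub> h \<noteq> \<one>\<^bsub>G\<^esub>" using g h \<open>g \<noteq> h\<close> by (metis G.inv_equality G.inv_inv G.inv_closed)
      then have "\<alpha> (inv\<^bsub>G\<^esub> g \<otimes>\<^bsub>G\<^esub> h) (\<alpha> (inv\<^bsub>G\<^esub> h) x) \<notin> Z (l div D)" using Z(2)[OF b _ z(2)] by blast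
      moreover have "\<alpha> (inv\<^bsub>G\<^esub> g \<otimes>\<^bsub>G\<^esub> h) (\<alpha> (inv\<^bsub>G\<^esub> h) x) = \<alpha> (inv\<^bsub>G\<^esub> g) x"
        using g h by (simp add: act_mult)
      ultimately show False using z(1) by simp
    qed
  next
    fix l g h x assume g: "g \<in> M" and h: "h \<in> carrier G"
    have gG: "g \<in> carrier G" using g M(2) by blast
    \<comment> \<open>The marker function is thus evaluated at the same point on both sides, and the
      difference comes from \<open>\<phi>\<close> alone.\<close>
    have "\<alpha> (inv\<^bsub>G\<^esub> (g \<otimes>\<^bsub>G\<^esub> h)) x = \<alpha> (inv\<^bsub>G\<^esub> h) (\<alpha> (inv\<^bsub>G\<^esub> g) x)"
      using gG h by (simp add: G.inv_mult_group act_mult)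
    then have "u l h (\<alpha> (inv\<^bsub>G\<^esub> g) x) - u l (g \<otimes>\<^bsub>G\<^esub> h) x
        = (\<phi> (l mod D) h - \<phi> (l mod D) (g \<otimes>\<^bsub>G\<^esub> h)) * \<theta> (l div D) (\<alpha> (inv\<^bsub>G\<^esub> h) (\<alpha> (inv\<^bsub>G\<^esub> g) x))"
      by (simp add: u_def left_diff_distrib)
    also have "\<bar>\<dots>\<bar> \<le> \<epsilon> * 1"
      unfolding abs_mult
      using B(8)[OF lD g h, of l] \<theta>(2,3) \<epsilon> by (intro mult_mono) (auto simp: abs_minus_commute)
    finally show "\<bar>u l h (\<alpha> (inv\<^bsub>G\<^esub> g) x) - u l (g \<otimes>\<^bsub>G\<^esub> h) x\<bar> \<le> \<epsilon>" by simp
  next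
    fix x
    obtain k b where k: "k \<le> d" "b \<in> B" "\<theta> k (\<alpha> b x) = 1" using \<theta>(5) by blast
    have bG: "b \<in> carrier G" using k B(2) by blast
    obtain j where j: "j < D" "\<phi> j (inv\<^bsub>G\<^esub> b) = 1" using B(9)[OF B(4)[OF k(2)]] by blast
    have "u (k * D + j) (inv\<^bsub>G\<^esub> b) x = 1" using j k bG by (simp add: u_def)
    moreover have "k * D + j \<le> N"
    proof -
      have "k * D \<le> d * D" using k(1) by (rule mult_le_mono1)
      then have "k * D + j < d * D + D" using j(1) by linarith
      also have "\<dots> = Suc N" unfolding N by (simp add: algebra_simps)
      finally show ?thesis by simp
    qed
    moreover have "inv\<^bsub>G\<^esub> b \<in> carrier G" using bG by simp
    ultimately show "\<exists>l\<le>N. \<exists>g\<in>carrier G. u l g x = 1" by blast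
  qed
  then show ?thesis by blast
qed

theorem theorem7p4:
  fixes G :: "('g, 'm) monoid_scheme"
    and \<alpha> :: "'g \<Rightarrow> 'x::metric_space \<Rightarrow> 'x"
  assumes "group G"
    and "finitely_generated_group G"
    and "infinite (carrier G)"
    and "nilpotent_group G"
    and "compact (UNIV :: 'x set)"
    and "covering_dim (euclidean :: 'x topology) < \<infinity>"
    and "topological_action G \<alpha>"
    and "free_action G \<alpha>"
  shows "amenability_dim G (induced_action G \<alpha>) + 1
    \<le> 3 ^ Hirsch_length G * (covering_dim (euclidean :: 'x topology) + 1)"
proof -
  let ?X = "euclidean :: 'x topology"
  \<comment> \<open>The infimum of the empty set is \<open>\<infinity>\<close>, so finite dimension
    provides some valid bound; the infimum of a nonempty set of extended naturals is
    attained.\<close>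
  have "{enat n |n. covering_dim_le ?X n} \<noteq> {}"
    using assms(6) unfolding covering_dim_def Inf_enat_def by (auto split: if_splits)
  then obtain m where "m \<in> {enat n |n. covering_dim_le ?X n}" by blast
  then have "covering_dim ?X \<in> {enat n |n. covering_dim_le ?X n}"
    unfolding covering_dim_def by (rule wellorder_InfI)
  then obtain d where d: "covering_dim ?X = enat d" "covering_dim_le ?X d" by blast
  define D :: nat where "D = 3 ^ Hirsch_length G"
  have "0 < D * (d + 1)" by (simp add: D_def)
  then obtain N where N: "Suc N = D * (d + 1)" by (metis Suc_pred)
  have "amenability_dim_le G (induced_action G \<alpha>) N"
  proof (rule amenability_dim_le_if_equivariant_bumps[OF assms(7)])
    show "\<exists>u. equivariant_bumps G \<alpha> N \<epsilon> M u" if "\<epsilon> > 0" "finite M" "M \<subseteq> carrier G" for \<epsilon> M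
      using has_bump_covers_Hirsch_length[OF assms(1,2,4)] N that
      by (intro equivariant_bumps_exist[OF assms(7,8,5) d(2), of D]) (simp_all add: D_def)
  qed
  then have "amenability_dim G (induced_action G \<alpha>) \<le> enat N"
    unfolding amenability_dim_def by (intro Inf_lower) blast
  then have "amenability_dim G (induced_action G \<alpha>) + 1 \<le> enat N + 1" by (rule add_right_mono)
  also have "enat N + 1 = enat (Suc N)" by (simp add: one_enat_def)
  also have "\<dots> = enat (D * (d + 1))" unfolding N ..
  also have "\<dots> = enat D * (covering_dim ?X + 1)" by (simp add: d(1) one_enat_def)
  also have "enat D = 3 ^ Hirsch_length G"
    by (simp add: D_def flip: of_nat_eq_enat)
  finally show ?thesis .
qed

end
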